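(* Suppose that $f^\star$ has bounded partial derivatives $\partial_\ell f^\star$, $\ell=1,\dots,d$, and that $n$ is a power of two. Then the infinite interpolating Median Random Forest $f^{\mathrm{MedRF}}_{\infty,n}$ is consistent and satisfies $$\mathcal{R}\big(f^{\mathrm{MedRF}}_{\infty,n}\big)\;\le\; C_1\, d\,\Big(\sum_{\ell=1}^d\|\partial_\ell f^\star\|_\infty^2\Big)\Big(1-\frac{3}{4d}\Big)^{\log_2 n}+\sigma^2\,C_{2,d}\,(\log_2 n)^{-(d-1)/2},$$ where $C_1$ and $C_{2,d}$ are explicit constants, the former being independent of the dimension $d$.
   Context: Regression setting: $X$ is uniform on $[0,1]^d$, $Y=f^\star(X)+\varepsilon\in\mathbb{R}$ with $f^\star(x)=\mathbb{E}[Y\mid X=x]$, and almost surely $\mathbb{E}[\varepsilon\mid X]=0$ and $\mathbb{V}[\varepsilon\mid X]\le\sigma^2<\infty$ for some $\sigma^2\ge 0$. The training set $\mathcal{D}_n=((X_1,Y_1),\dots,(X_n,Y_n))$ consists of i.i.d. copies of $(X,Y)$. The excess risk of an estimator $f_n$ is $\mathcal{R}(f_n)=\mathbb{E}[(f_n(X)-f^\star(X))^2]$; $f_n$ is consistent if $\lim_{n\to\infty}\mathcal{R}(f_n)=0$. Median tree: start from the root cell $[0,1]^d$ containing all $n$ points. Each cell to be split is split along a coordinate direction chosen uniformly at random in $\{1,\dots,d\}$, independently of $\mathcal{D}_n$; $\Theta$ denotes all these random choices. The split is located at the median of the observations of the cell along the chosen direction. For a cell containing $n_c$ observations, the median is defined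 as the midpoint of two consecutive order statistics along that direction: $X_{(n_c/2)}$ and $X_{(n_c/2+1)}$ if $n_c$ is even, $X_{((n_c-1)/2)}$ and $X_{((n_c+1)/2)}$ otherwise. The interpolating median tree is grown until each leaf contains exactly one observation; when $n$ is a power of two it has depth $\log_2 n$. The whole data set is used for every tree (no bootstrap). Let $A_n(x,\Theta)$ be the leaf containing $x$ and $N_n(x,\Theta)$ the number of observations in it. The tree prediction is $f_n(x,\Theta)=\sum_{i=1}^n \frac{\mathbf{1}_{X_i\in A_n(x,\Theta)}Y_i}{N_n(x,\Theta)}\mathbf{1}_{N_n(x,\Theta)>0}$, and the infinite forest is $f^{\mathrm{MedRF}}_{\infty,n}(x)=\mathbb{E}_\Theta[f_n(x,\Theta)]$, the expectation being over $\Theta$ conditionally on $\mathcal{D}_n$.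
   Formalization: Consistency (along powers of two) is claimed only for d ≥ 2 or σ = 0, since for d = 1 with noise the forest is one interpolating tree whose variance persists; the bound is for n ≥ 2, as log₂ 1 = 0 makes it ill-defined; the constants' values are not displayed. *)

theory Defs
  imports "HOL-Probability.Probability"
begin

section \<open>Regression model\<close>

text \<open>
  A point of \<open>[0,1]^d\<close> is an extensional function on \<open>{..<d}\<close>, so coordinates and directions are
  numbered from \<open>0\<close>.
\<close>

definition cube :: "nat \<Rightarrow> (nat \<Rightarrow> real) set" where
  "cube d = {..<d} \<rightarrow>\<^sub>E {0..1}"

text \<open>The uniform distribution; its space is exactly \<open>cube d\<close>.\<close>

definition uniform_cube :: "nat \<Rightarrow> (nat \<Rightarrow> real) measure" where
  "uniform_cube d = (\<Pi>\<^sub>M l\<in>{..<d}. restrict_space lborel {0..1})"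

definition cond_variance :: "'a measure \<Rightarrow> 'a measure \<Rightarrow> ('a \<Rightarrow> real) \<Rightarrow> 'a \<Rightarrow> ennreal" where
  "cond_variance M F Z = nn_cond_exp M F (\<lambda>\<omega>. ennreal ((Z \<omega> - real_cond_exp M F Z \<omega>)\<^sup>2))"

text \<open>
  \<open>P\<close> is the joint law of \<open>(X, Y)\<close>; on its sample space \<open>X\<close> is \<^const>\<open>fst\<close>, \<open>Y\<close> is \<^const>\<open>snd\<close>, and
  conditioning on \<open>X\<close> is conditioning on the \<open>\<sigma>\<close>-algebra generated by \<^const>\<open>fst\<close>.
  The library's conditional expectations are junk values for non-measurable functions;
  the measurability of \<open>f\<close> and the integrability of \<open>Y\<close> rule this out.
\<close>

definition sigma_X :: "nat \<Rightarrow> ((nat \<Rightarrow> real) \<times> real) measure \<Rightarrow> ((nat \<Rightarrow> real) \<times> real) measure" where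
  "sigma_X d P = vimage_algebra (space P) fst (uniform_cube d)"

definition noise :: "((nat \<Rightarrow> real) \<Rightarrow> real) \<Rightarrow> (nat \<Rightarrow> real) \<times> real \<Rightarrow> real" where
  "noise f = (\<lambda>(x, y). y - f x)"

definition regression_model ::
  "nat \<Rightarrow> ((nat \<Rightarrow> real) \<times> real) measure \<Rightarrow> ((nat \<Rightarrow> real) \<Rightarrow> real) \<Rightarrow> real \<Rightarrow> bool" where
  "regression_model d P f \<sigma> \<longleftrightarrow>
     prob_space P \<and>
     sets P = sets (uniform_cube d \<Otimes>\<^sub>M borel) \<and>
     distr P (uniform_cube d) fst = uniform_cube d \<and>
     integrable P snd \<and>
     f \<in> borel_measurable (uniform_cube d) \<and>
     (AE z in P. real_cond_exp P (sigma_X d P) snd z = f (fst z)) \<and>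
     (AE z in P. real_cond_exp P (sigma_X d P) (noise f) z = 0) \<and>
     (AE z in P. cond_variance P (sigma_X d P) (noise f) z \<le> ennreal (\<sigma>\<^sup>2))"

definition partial_deriv :: "((nat \<Rightarrow> real) \<Rightarrow> real) \<Rightarrow> nat \<Rightarrow> (nat \<Rightarrow> real) \<Rightarrow> real" where
  "partial_deriv f l x = vector_derivative (\<lambda>t. f (x(l := t))) (at (x l) within {0..1})"

text \<open>Derivatives are one-sided on the faces of the cube.\<close>

definition bounded_partial_derivs :: "nat \<Rightarrow> ((nat \<Rightarrow> real) \<Rightarrow> real) \<Rightarrow> bool" where
  "bounded_partial_derivs d f \<longleftrightarrow>
     (\<forall>l<d. (\<forall>x\<in>cube d. (\<lambda>t. f (x(l := t))) differentiable (at (x l) within {0..1})) \<and>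
            bounded (partial_deriv f l ` cube d))"

definition sup_norm :: "nat \<Rightarrow> ((nat \<Rightarrow> real) \<Rightarrow> real) \<Rightarrow> real" where
  "sup_norm d g = (SUP x\<in>cube d. \<bar>g x\<bar>)"

section \<open>Median trees\<close>

type_synonym training_set = "nat \<Rightarrow> (nat \<Rightarrow> real) \<times> real"

definition observations :: "nat \<Rightarrow> training_set \<Rightarrow> (nat \<Rightarrow> real) set \<Rightarrow> nat set" where
  "observations n D A = {i. i < n \<and> fst (D i) \<in> A}"

text \<open>The \<open>j\<close>-th smallest (\<open>j = 1, 2, \<dots>\<close>) of the \<open>l\<close>-th coordinates of the observations in \<open>S\<close>.\<close>

definition order_stat :: "training_set \<Rightarrow> nat set \<Rightarrow> nat \<Rightarrow> nat \<Rightarrow> real" where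
  "order_stat D S l j = sort (map (\<lambda>i. fst (D i) l) (sorted_list_of_set S)) ! (j - 1)"

definition cell_median :: "training_set \<Rightarrow> nat set \<Rightarrow> nat \<Rightarrow> real" where
  "cell_median D S l = (let c = card S in
     if even c then (order_stat D S l (c div 2) + order_stat D S l (c div 2 + 1)) / 2
     else (order_stat D S l ((c - 1) div 2) + order_stat D S l ((c + 1) div 2)) / 2)"

text \<open>
  A cell of the tree is addressed by the path from it up to the root (last move first, \<^const>\<open>True\<close>
  being a move to the upper half), and \<open>\<theta> p\<close> is the direction along which the cell at \<open>p\<close> is split.
  Which half receives the splitting hyperplane is immaterial: this is a null set.
\<close>

type_synonym split_directions = "bool list \<Rightarrow> nat"

primrec cell :: "nat \<Rightarrow> nat \<Rightarrow> training_set \<Rightarrow> split_directions \<Rightarrow> bool list \<Rightarrow> (nat \<Rightarrow> real) set" where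
  "cell d n D \<theta> [] = cube d"
| "cell d n D \<theta> (b # p) =
     (let A = cell d n D \<theta> p; m = cell_median D (observations n D A) (\<theta> p)
      in {x \<in> A. if b then x (\<theta> p) > m else x (\<theta> p) \<le> m})"

primrec is_node :: "nat \<Rightarrow> nat \<Rightarrow> training_set \<Rightarrow> split_directions \<Rightarrow> bool list \<Rightarrow> bool" where
  "is_node d n D \<theta> [] = True"
| "is_node d n D \<theta> (b # p) =
     (is_node d n D \<theta> p \<and> card (observations n D (cell d n D \<theta> p)) > 1)"

definition leaves :: "nat \<Rightarrow> nat \<Rightarrow> training_set \<Rightarrow> split_directions \<Rightarrow> (nat \<Rightarrow> real) set set" where
  "leaves d n D \<theta> =
     {cell d n D \<theta> p | p. is_node d n D \<theta> p \<and> card (observations n D (cell d n D \<theta> p)) \<le> 1}"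

text \<open>
  The leaf containing \<open>x\<close>. Leaves are disjoint, so at most one contains \<open>x\<close>. When two
  observations share a coordinate (a null event) a branch may be infinite; the union is then empty
  for some \<open>x\<close>, where the prediction is \<open>0\<close>.
\<close>

definition leaf_cell ::
  "nat \<Rightarrow> nat \<Rightarrow> training_set \<Rightarrow> split_directions \<Rightarrow> (nat \<Rightarrow> real) \<Rightarrow> (nat \<Rightarrow> real) set" where
  "leaf_cell d n D \<theta> x = \<Union>{A \<in> leaves d n D \<theta>. x \<in> A}"

definition tree_prediction ::
  "nat \<Rightarrow> nat \<Rightarrow> training_set \<Rightarrow> split_directions \<Rightarrow> (nat \<Rightarrow> real) \<Rightarrow> real" where
  "tree_prediction d n D \<theta> x =
     (let A = leaf_cell d n D \<theta> x; N = card (observations n D A)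
      in \<Sum>i<n. indicator A (fst (D i)) * snd (D i) / real N * (if N > 0 then 1 else 0))"

section \<open>Infinite forest and risk\<close>

text \<open>
  The law of \<open>\<Theta>\<close>: independent uniform directions, one for each potential cell. Being a fixed
  measure, it is independent of the training set.
\<close>

definition direction_law :: "nat \<Rightarrow> split_directions measure" where
  "direction_law d = (\<Pi>\<^sub>M p\<in>UNIV. uniform_count_measure {..<d})"

definition median_forest :: "nat \<Rightarrow> nat \<Rightarrow> training_set \<Rightarrow> (nat \<Rightarrow> real) \<Rightarrow> real" where
  "median_forest d n D x = (\<integral>\<theta>. tree_prediction d n D \<theta> x \<partial>direction_law d)"

text \<open>
  The risk averages over \<open>n\<close> independent copies of \<open>(X, Y)\<close> and an independent \<open>X\<close>. It takes values
  in \<^typ>\<open>ennreal\<close>, so that a non-integrable error has risk \<open>\<infinity>\<close>, not \<open>0\<close>.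
\<close>

definition excess_risk ::
  "nat \<Rightarrow> ((nat \<Rightarrow> real) \<times> real) measure \<Rightarrow> ((nat \<Rightarrow> real) \<Rightarrow> real) \<Rightarrow> nat \<Rightarrow>
   (training_set \<Rightarrow> (nat \<Rightarrow> real) \<Rightarrow> real) \<Rightarrow> ennreal" where
  "excess_risk d P f n g =
     (\<integral>\<^sup>+ (D, x). ennreal ((g D x - f x)\<^sup>2) \<partial>((\<Pi>\<^sub>M i\<in>{..<n}. P) \<Otimes>\<^sub>M uniform_cube d))"

end

theory Submission
  imports Defs "HOL-Combinatorics.Multiset_Permutations"
begin

text \<open>
  Only the directions met on the way to the leaf of \<open>x\<close> matter, and they are \<open>k = log\<^sub>2 n\<close> independent
  uniform ones, so the forest is a weighted mean of the \<open>Y\<^sub>i\<close> with weights \<open>W\<^sub>i\<close>: the fraction of the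
  direction lists for which \<open>X\<^sub>i\<close> is the observation in the leaf of \<open>x\<close>. Delete \<open>X\<^sub>i\<close> from the
  sample. Every cell of \<open>2h\<close> observations that contains both \<open>x\<close> and \<open>X\<^sub>i\<close> is left with \<open>2h - 1\<close>, and the
  central one separates the half containing \<open>x\<close> and \<open>X\<^sub>i\<close> from the rest. So \<open>X\<^sub>i\<close> lies in the box around
  \<open>x\<close> cut out by these exact medians, which does not depend on \<open>X\<^sub>i\<close>. Given a median, the remaining
  observations are uniform on its two sides; hence the moments of the side lengths of the box are products
  of Beta moments, and the mean of a product of powers of the sides is, up to the factor \<open>e\<^sup>6\<close>, what exact
  halving would give.

  For the bias this yields \<open>E[(X\<^sub>i\<^sub>l - x\<^sub>l)\<^sup>2; i in the leaf of x]\<close> of order \<open>2\<^sup>-\<^sup>k 4\<^sup>-\<^sup>K\<close>, where \<open>K\<close> counts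
  the splits along \<open>l\<close>, and averaging over the lists gives \<open>(1 - 3/(4d))\<^sup>k\<close>. For the variance,
  \<open>n E[W\<^sub>i\<^sup>2]\<close> is the mean over two lists, with counts \<open>K\<close> and \<open>K'\<close>, of the probability that \<open>X\<^sub>i\<close> lies in both
  boxes, at most of order \<open>2\<close> to the power \<open>- \<Sum>\<^sub>l max K\<^sub>l K'\<^sub>l\<close>; what remains is the collision
  probability of two multinomial vectors, of order \<open>k\<close> to the power \<open>-(d - 1)/2\<close>.
\<close>

section \<open>Uniform points in boxes\<close>

text \<open>The actual splits are midpoints of two order statistics, and they move with
  \<open>X_i\<close>. Deleting \<open>X_i\<close> replaces them by single order statistics, whose
  laws are Beta. The query point \<open>x\<close> must be random too: the half kept at each split is
  the one holding \<open>x\<close>, hence size-biased. Treated as one more uniform point,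
  \<open>x\<close> joins \<open>h - 1\<close> observations against \<open>h - 1\<close> on the other
  side, and the kept fraction of the side is Beta(\<open>h + 1\<close>, \<open>h\<close>). Its
  moments of order at most 3 exceed those of exact halving by at most the factor
  \<open>exp (3 / h)\<close>; as \<open>h\<close> runs through 1, 2, 4, ..., the product of these
  factors stays below \<open>exp 6\<close>. Order 3 suffices: one power for the chance that
  \<open>X_i\<close> falls in the box, two for the squared distance. Hence
  \<open>C1 = 2 * exp 6\<close>, where the 2 comes from splitting the error into noise and bias.
  \<open>C2\<close> contains in addition \<open>16 ^ d\<close>, namely \<open>2 ^ d\<close> for the
  multinomial coefficient and \<open>8 ^ d\<close> for two-sided geometric sums.\<close>

lemma prob_space_unit_interval: "prob_space (restrict_space lborel {0..1::real})"
  by (rule prob_spaceI) (simp add: space_restrict_space emeasure_restrict_space)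

lemma prob_space_uniform_cube: "prob_space (uniform_cube d)"
  unfolding uniform_cube_def by (rule prob_space_PiM) (rule prob_space_unit_interval)

interpretation coords: product_sigma_finite "\<lambda>_::nat. restrict_space lborel {0..1::real}"
  by (intro product_sigma_finite.intro prob_space_imp_sigma_finite prob_space_unit_interval)

interpretation points: product_sigma_finite "\<lambda>_::nat. uniform_cube d" for d
  by (intro product_sigma_finite.intro prob_space_imp_sigma_finite prob_space_uniform_cube)

lemma space_uniform_cube: "space (uniform_cube d) = cube d"
  by (simp add: uniform_cube_def cube_def space_PiM space_restrict_space)

lemma measurable_coordinate:
  assumes "l < d" shows "(\<lambda>x. x l) \<in> borel_measurable (uniform_cube d)"
proof -
  have "(\<lambda>x. x l) \<in> measurable (uniform_cube d) (restrict_space lborel {0..1::real})"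
    unfolding uniform_cube_def using assms by (intro measurable_component_singleton) simp
  then show ?thesis
    by (simp add: measurable_restrict_space2_iff)
qed

abbreviation cubes :: "nat \<Rightarrow> nat set \<Rightarrow> (nat \<Rightarrow> nat \<Rightarrow> real) measure" where
  "cubes d J \<equiv> PiM J (\<lambda>_. uniform_cube d)"

lemma measurable_point_coordinate:
  assumes "j \<in> J" "l < d"
  shows "(\<lambda>X. X j l) \<in> borel_measurable (cubes d J)"
  by (rule measurable_compose[OF measurable_component_singleton[OF assms(1)] measurable_coordinate[OF assms(2)]])

definition brick :: "nat \<Rightarrow> (nat \<Rightarrow> real) \<Rightarrow> (nat \<Rightarrow> real) \<Rightarrow> (nat \<Rightarrow> real) set" where
  "brick d a b = {x. \<forall>l<d. a l \<le> x l \<and> x l \<le> b l}"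

text \<open>The point that realises a median matters only through its coordinate \<open>q\<close>,
  the split position. Its other coordinates integrate to side lengths, while the weight
  \<open>g\<close> of the split position stays under a one-dimensional integral.\<close>

lemma nn_integral_box_times:
  assumes q: "q < d" and ab: "\<And>l. l < d \<Longrightarrow> 0 \<le> a l \<and> b l \<le> 1"
    and ab': "\<And>l. l < d \<Longrightarrow> a l \<le> b l"
    and g[measurable]: "g \<in> borel_measurable borel"
  shows "(\<integral>\<^sup>+z. indicator (brick d a b) z * g (z q) \<partial>uniform_cube d) =
    (\<Prod>l\<in>{..<d}-{q}. ennreal (b l - a l)) * (\<integral>\<^sup>+t. indicator {a q..b q} t * g t \<partial>lborel)"
proof -
  define f :: "nat \<Rightarrow> real \<Rightarrow> ennreal" where
    "f l t = indicator {a l..b l} t * (if l = q then g t else 1)" for l t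
  have fm: "f l \<in> borel_measurable borel" for l
    unfolding f_def by (cases "l = q") auto
  have int: "(\<integral>\<^sup>+t. f l t \<partial>restrict_space lborel {0..1}) =
      (if l = q then (\<integral>\<^sup>+t. indicator {a q..b q} t * g t \<partial>lborel) else ennreal (b l - a l))"
    if l: "l < d" for l
  proof -
    have "(\<integral>\<^sup>+t. f l t \<partial>restrict_space lborel {0..1}) = (\<integral>\<^sup>+t. f l t * indicator {0..1} t \<partial>lborel)"
      by (rule nn_integral_restrict_space) simp
    also have "\<dots> = (\<integral>\<^sup>+t. f l t \<partial>lborel)"
      using ab[OF l] by (intro nn_integral_cong) (auto simp: f_def split: split_indicator)
    also have "\<dots> = (if l = q then (\<integral>\<^sup>+t. indicator {a q..b q} t * g t \<partial>lborel) else ennreal (b l - a l))"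
      using ab'[OF l] by (auto simp: f_def)
    finally show ?thesis .
  qed
  have "(\<integral>\<^sup>+z. indicator (brick d a b) z * g (z q) \<partial>uniform_cube d) =
      (\<integral>\<^sup>+z. (\<Prod>l\<in>{..<d}. f l (z l)) \<partial>uniform_cube d)"
  proof (intro nn_integral_cong)
    fix z
    have "(\<Prod>l\<in>{..<d}. f l (z l)) =
        (\<Prod>l\<in>{..<d}. indicator {a l..b l} (z l)) * (\<Prod>l\<in>{..<d}. if l = q then g (z l) else 1)"
      by (simp add: f_def prod.distrib)
    also have "(\<Prod>l\<in>{..<d}. if l = q then g (z l) else 1) = g (z q)"
      using q by (subst prod.delta) auto
    also have "(\<Prod>l\<in>{..<d}. indicator {a l..b l} (z l)) = (indicator (brick d a b) z :: ennreal)"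
    proof (cases "z \<in> brick d a b")
      case True then show ?thesis by (auto simp: brick_def)
    next
      case False
      then obtain l where "l < d" "\<not> (a l \<le> z l \<and> z l \<le> b l)" by (auto simp: brick_def)
      then have "(\<Prod>l\<in>{..<d}. indicator {a l..b l} (z l)) = (0::ennreal)"
        by (intro prod_zero) (auto intro!: bexI[of _ l])
      then show ?thesis using False by simp
    qed
    finally show "indicator (brick d a b) z * g (z q) = (\<Prod>l\<in>{..<d}. f l (z l))" by simp
  qed
  also have "\<dots> = (\<Prod>l\<in>{..<d}. integral\<^sup>N (restrict_space lborel {0..1}) (f l))"
    unfolding uniform_cube_def
    by (rule coords.product_nn_integral_prod) (auto intro!: measurable_restrict_space1 fm simp: measurable_lborel1)
  also have "\<dots> = (\<Prod>l\<in>{..<d}. (if l = q then (\<integral>\<^sup>+t. indicator {a q..b q} t * g t \<partial>lborel) else ennreal (b l - a l)))"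
    by (intro prod.cong) (auto simp: int)
  also have "\<dots> = (\<integral>\<^sup>+t. indicator {a q..b q} t * g t \<partial>lborel) * (\<Prod>l\<in>{..<d}-{q}. ennreal (b l - a l))"
    using q by (subst prod.remove[of _ q]) (auto intro!: arg_cong2[where f="(*)"] prod.cong)
  finally show ?thesis by (subst mult.commute)
qed

lemma nn_integral_box:
  assumes "\<And>l. l < d \<Longrightarrow> 0 \<le> a l \<and> b l \<le> 1" "\<And>l. l < d \<Longrightarrow> a l \<le> b l"
  shows "(\<integral>\<^sup>+z. indicator (brick d a b) z \<partial>uniform_cube d) = (\<Prod>l<d. ennreal (b l - a l))"
proof (cases "d = 0")
  case True
  then show ?thesis
    using prob_space.emeasure_space_1[OF prob_space_uniform_cube[of d]] by (simp add: brick_def)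
next
  case False
  then show ?thesis
    using nn_integral_box_times[of 0 d a b "\<lambda>_. 1"] assms
    by (simp add: prod.remove[of "{..<d}" 0] mult.commute)
qed

text \<open>Integration by parts moves one power from \<open>b - t\<close> to \<open>t - a\<close>,
  so the induction is over \<open>n\<close> with \<open>m\<close> arbitrary.\<close>

lemma beta_has_integral:
  fixes a b :: real
  assumes "a \<le> b"
  shows "((\<lambda>t. (t - a) ^ m * (b - t) ^ n) has_integral
     (b - a) ^ (m + n + 1) * (fact m * fact n / fact (m + n + 1))) {a..b}"
proof (induction n arbitrary: m)
  case 0
  have "((\<lambda>t. (t - a) ^ m) has_integral ((b - a) ^ (m + 1) / (m + 1) - (a - a) ^ (m + 1) / (m + 1))) {a..b}"
  proof (intro fundamental_theorem_of_calculus assms)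
    fix t
    have "((\<lambda>t. (t - a) ^ (m + 1) / real (m + 1)) has_real_derivative
        (real (m + 1) * (1 * (t - a) ^ (m + 1 - Suc 0))) / real (m + 1)) (at t within {a..b})"
      by (intro DERIV_cdivide DERIV_power) (auto intro!: derivative_eq_intros)
    then show "((\<lambda>t. (t - a) ^ (m + 1) / (m + 1)) has_vector_derivative (t - a) ^ m) (at t within {a..b})"
      by (simp add: has_real_derivative_iff_has_vector_derivative[symmetric] add.commute del: of_nat_Suc)
  qed
  moreover have "(fact m * fact 0 / fact (m + 0 + 1) :: real) = 1 / real (m + 1)"
    by (simp add: add_eq_0_iff)
  ultimately show ?case by simp
next
  case (Suc n)
  have D: "((\<lambda>t. (t - a) ^ (m + 1) * (b - t) ^ (n + 1)) has_vector_derivative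
      (real (m + 1) * ((t - a) ^ m * (b - t) ^ (n + 1)) - real (n + 1) * ((t - a) ^ (m + 1) * (b - t) ^ n)))
      (at t within {a..b})" for t
    unfolding has_real_derivative_iff_has_vector_derivative[symmetric]
    by (rule derivative_eq_intros refl)+ (simp add: algebra_simps)
  have "((\<lambda>t. real (m + 1) * ((t - a) ^ m * (b - t) ^ (n + 1)) - real (n + 1) * ((t - a) ^ (m + 1) * (b - t) ^ n))
     has_integral ((b - a) ^ (m + 1) * (b - b) ^ (n + 1) - (a - a) ^ (m + 1) * (b - a) ^ (n + 1))) {a..b}"
    by (rule fundamental_theorem_of_calculus[OF assms D])
  \<comment> \<open>Both boundary values vanish because the two exponents are positive.\<close>
  then have "((\<lambda>t. real (m + 1) * ((t - a) ^ m * (b - t) ^ (n + 1)) - real (n + 1) * ((t - a) ^ (m + 1) * (b - t) ^ n))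
     has_integral 0) {a..b}" by simp
  from has_integral_add[OF this has_integral_mult_right[OF Suc[of "m + 1"], of "real (n + 1)"]]
  have "((\<lambda>t. real (m + 1) * ((t - a) ^ m * (b - t) ^ (n + 1))) has_integral
     real (n + 1) * ((b - a) ^ (m + 1 + n + 1) * (fact (m + 1) * fact n / fact (m + 1 + n + 1)))) {a..b}"
    by simp
  note int = has_integral_mult_right[OF this, of "1 / real (m + 1)"]
  have eq1: "1 / real (m + 1) * (real (n + 1) * ((b - a) ^ (m + 1 + n + 1) * (fact (m + 1) * fact n / fact (m + 1 + n + 1)))) =
      (b - a) ^ (m + Suc n + 1) * (fact m * fact (Suc n) / fact (m + Suc n + 1))"
  proof -
    have "1 / real (m + 1) * (real (n + 1) * (P * (fact (m + 1) * fact n / Q))) = P * (fact m * fact (Suc n) / Q)"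
      for P Q :: real
      by (cases "Q = 0") (simp_all add: divide_simps fact_Suc)
    then show ?thesis by simp
  qed
  have eq2: "(\<lambda>t. 1 / real (m + 1) * (real (m + 1) * ((t - a) ^ m * (b - t) ^ (n + 1)))) =
      (\<lambda>t. (t - a) ^ m * (b - t) ^ Suc n)"
    by (simp add: fun_eq_iff)
  show ?case by (rule has_integral_eq_rhs[OF int[unfolded eq2] eq1[symmetric]])
qed

lemma beta_nn_integral:
  fixes a b :: real
  assumes "a \<le> b"
  shows "(\<integral>\<^sup>+t. indicator {a..b} t * (ennreal (t - a) ^ m * ennreal (b - t) ^ n) \<partial>lborel) =
    ennreal ((b - a) ^ (m + n + 1) * (fact m * fact n / fact (m + n + 1)))"
proof -
  define f where "f t = (if t \<in> {a..b} then (t - a) ^ m * (b - t) ^ n else 0)" for t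
  have "(\<integral>\<^sup>+t. indicator {a..b} t * (ennreal (t - a) ^ m * ennreal (b - t) ^ n) \<partial>lborel) = (\<integral>\<^sup>+t. ennreal (f t) \<partial>lborel)"
    by (intro nn_integral_cong) (auto simp: f_def ennreal_power ennreal_mult split: split_indicator)
  also have "\<dots> = ennreal ((b - a) ^ (m + n + 1) * (fact m * fact n / fact (m + n + 1)))"
  proof (rule nn_integral_has_integral_lborel)
    show "f \<in> borel_measurable borel" unfolding f_def by measurable
    show "0 \<le> f t" for t by (auto simp: f_def)
    show "(f has_integral (b - a) ^ (m + n + 1) * (fact m * fact n / fact (m + n + 1))) UNIV"
      unfolding f_def using beta_has_integral[OF assms, of m n] by (subst has_integral_restrict_UNIV)
  qed
  finally show ?thesis .
qed

text \<open>\<open>s\<close> true is the part below \<open>t\<close>, the opposite of the addresses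
  in \<open>cell\<close>, where \<open>True\<close> is a move up. Strict inequalities leave ties on
  neither side.\<close>

definition side :: "bool \<Rightarrow> real \<Rightarrow> real \<Rightarrow> bool" where
  "side s t u \<longleftrightarrow> (if s then u < t else t < u)"

abbreviation half_lower :: "bool \<Rightarrow> (nat \<Rightarrow> real) \<Rightarrow> nat \<Rightarrow> real \<Rightarrow> nat \<Rightarrow> real" where
  "half_lower s a q t \<equiv> (if s then a else a(q := t))"

abbreviation half_upper :: "bool \<Rightarrow> (nat \<Rightarrow> real) \<Rightarrow> nat \<Rightarrow> real \<Rightarrow> nat \<Rightarrow> real" where
  "half_upper s b q t \<equiv> (if s then b(q := t) else b)"

abbreviation half_brick :: "nat \<Rightarrow> bool \<Rightarrow> (nat \<Rightarrow> real) \<Rightarrow> (nat \<Rightarrow> real) \<Rightarrow> nat \<Rightarrow> real \<Rightarrow> (nat \<Rightarrow> real) set" where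
  "half_brick d s a b q t \<equiv> brick d (half_lower s a q t) (half_upper s b q t)"

abbreviation separates :: "bool \<Rightarrow> (nat \<Rightarrow> nat \<Rightarrow> real) \<Rightarrow> nat set \<Rightarrow> nat \<Rightarrow> nat set \<Rightarrow> nat \<Rightarrow> real \<Rightarrow> bool" where
  "separates s X T r L q u \<equiv> (\<forall>j\<in>L. side s (X r q) (X j q)) \<and>
     (\<forall>j\<in>T - {r} - L. side (\<not> s) (X r q) (X j q)) \<and> side s (X r q) u"

text \<open>\<open>L\<close> collects the points of \<open>T\<close> that fall in the half of
  \<open>x\<close> when \<open>r\<close> is the exact median; the rest of \<open>T - {r}\<close>
  then has the same size.\<close>

definition halves :: "nat set \<Rightarrow> nat \<Rightarrow> nat set set" where
  "halves T r = {L. L \<subseteq> T - {r} \<and> 2 * card L + 1 = card T}"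

text \<open>
  Unless coordinates coincide, the sum has exactly one nonzero term, which is reached by splitting at the
  exact medians of the odd number of points in \<open>T\<close> and following the side of \<open>x\<close>; its value is the
  product of the powers \<open>e\<close> of the sides of the resulting box. Summing over the possible medians \<open>r\<close>
  and halves \<open>L\<close> makes it measurable and splits its integral into independent parts.
\<close>

primrec box_weight :: "nat \<Rightarrow> (nat \<Rightarrow> nat) \<Rightarrow> (nat \<Rightarrow> nat \<Rightarrow> real) \<Rightarrow> (nat \<Rightarrow> real) \<Rightarrow> nat list \<Rightarrow>
    nat set \<Rightarrow> (nat \<Rightarrow> real) \<Rightarrow> (nat \<Rightarrow> real) \<Rightarrow> ennreal" where
  "box_weight d e X x [] T a b = (\<Prod>l<d. ennreal (b l - a l) ^ e l)"
| "box_weight d e X x (q # qs) T a b = (\<Sum>r\<in>T. \<Sum>L\<in>halves T r. \<Sum>s\<in>UNIV.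
     if separates s X T r L q (x q)
     then box_weight d e X x qs L (half_lower s a q (X r q)) (half_upper s b q (X r q)) else 0)"

lemma finite_halves: "finite T \<Longrightarrow> finite (halves T r)"
  by (rule finite_subset[of _ "Pow T"]) (auto simp: halves_def)

lemma box_weight_cong:
  assumes "\<And>j. j \<in> T \<Longrightarrow> X j = X' j"
  shows "box_weight d e X x qs T a b = box_weight d e X' x qs T a b"
  using assms
proof (induction qs arbitrary: T a b)
  case (Cons q qs)
  have "box_weight d e X x qs L a' b' = box_weight d e X' x qs L a' b'" if "L \<in> halves T r" for L r a' b'
    using that by (intro Cons.IH Cons.prems) (auto simp: halves_def)
  moreover have "L \<subseteq> T" if "L \<in> halves T r" for L r
    using that by (auto simp: halves_def)
  ultimately show ?case
    using Cons.prems unfolding box_weight.simps by (intro sum.cong refl if_cong) (auto simp: subset_iff)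
qed simp

section \<open>Measurability of the box weights\<close>

lemma measurable_side:
  "f \<in> borel_measurable M \<Longrightarrow> g \<in> borel_measurable M \<Longrightarrow> Measurable.pred M (\<lambda>x. side s (f x) (g x))"
  unfolding side_def by (cases s) simp_all

text \<open>The bounds vary with \<open>X\<close> because each recursive call replaces one of them
  by a coordinate of the median point.\<close>

lemma measurable_box_weight:
  assumes "finite T" "T \<subseteq> J" "x0 \<in> J" "set qs \<subseteq> {..<d}"
    and "\<And>l. l < d \<Longrightarrow> (\<lambda>X. a X l) \<in> borel_measurable (cubes d J)"
    and "\<And>l. l < d \<Longrightarrow> (\<lambda>X. b X l) \<in> borel_measurable (cubes d J)"
  shows "(\<lambda>X. box_weight d e X (X x0) qs T (a X) (b X)) \<in> borel_measurable (cubes d J)"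
  using assms
proof (induction qs arbitrary: T a b)
  case Nil
  then show ?case by (auto intro!: borel_measurable_prod_ennreal borel_measurable_power_ennreal)
next
  case (Cons q qs)
  have q: "q < d" and qs: "set qs \<subseteq> {..<d}" using Cons.prems by auto
  have main: "(\<lambda>X. if separates s X T r L q (X x0 q)
     then box_weight d e X (X x0) qs L (half_lower s (a X) q (X r q)) (half_upper s (b X) q (X r q)) else 0)
     \<in> borel_measurable (cubes d J)" if r: "r \<in> T" and L: "L \<in> halves T r" for r L s
  proof -
    have "L \<subseteq> T" using L by (auto simp: halves_def)
    then have fin: "finite L" "L \<subseteq> J" "finite (T - {r} - L)"
      using Cons.prems(1,2) finite_subset by blast+
    have rJ: "r \<in> J" using r Cons.prems by auto
    have m0: "(\<lambda>X. box_weight d e X (X x0) qs L (half_lower s (a X) q (X r q)) (half_upper s (b X) q (X r q)))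
       \<in> borel_measurable (cubes d J)"
    proof (rule Cons.IH[where a = "\<lambda>X. half_lower s (a X) q (X r q)" and b = "\<lambda>X. half_upper s (b X) q (X r q)"])
      show "(\<lambda>X. half_lower s (a X) q (X r q) l) \<in> borel_measurable (cubes d J)" if "l < d" for l
        using Cons.prems(5)[OF that] measurable_point_coordinate[OF rJ q]
        by (cases s; cases "l = q") auto
      show "(\<lambda>X. half_upper s (b X) q (X r q) l) \<in> borel_measurable (cubes d J)" if "l < d" for l
        using Cons.prems(6)[OF that] measurable_point_coordinate[OF rJ q]
        by (cases s; cases "l = q") auto
    qed (use fin qs Cons.prems(3) in simp_all)
    have "Measurable.pred (cubes d J) (\<lambda>X. \<forall>j\<in>L. side s (X r q) (X j q))"
      using fin rJ by (intro pred_intros_finite measurable_side measurable_point_coordinate q) auto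
    moreover have "Measurable.pred (cubes d J) (\<lambda>X. \<forall>j\<in>T - {r} - L. side (\<not> s) (X r q) (X j q))"
      using fin rJ Cons.prems by (intro pred_intros_finite measurable_side measurable_point_coordinate q) auto
    moreover have "Measurable.pred (cubes d J) (\<lambda>X. side s (X r q) (X x0 q))"
      using rJ Cons.prems by (intro measurable_side measurable_point_coordinate q) auto
    ultimately have "Measurable.pred (cubes d J) (\<lambda>X. separates s X T r L q (X x0 q))"
      by (intro pred_intros_logic)
    then show ?thesis
      unfolding pred_def by (intro measurable_If m0 measurable_const) simp_all
  qed
  show ?case
    unfolding box_weight.simps by (intro borel_measurable_sum main)
qed

lemma measurable_indicator_box:
  assumes "\<And>l. l < d \<Longrightarrow> (\<lambda>X. a X l) \<in> borel_measurable M" "\<And>l. l < d \<Longrightarrow> (\<lambda>X. b X l) \<in> borel_measurable M"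
    "\<And>l. l < d \<Longrightarrow> (\<lambda>X. f X l) \<in> borel_measurable M"
  shows "(\<lambda>X. indicator (brick d (a X) (b X)) (f X)) \<in> borel_measurable M"
proof (rule borel_measurable_indicator')
  have "Measurable.pred M (\<lambda>X. \<forall>l\<in>{..<d}. a X l \<le> f X l \<and> f X l \<le> b X l)"
  proof (rule pred_intros_finite)
    fix l assume "l \<in> {..<d}"
    then have "l < d" by simp
    note [measurable] = assms[OF this]
    show "Measurable.pred M (\<lambda>X. a X l \<le> f X l \<and> f X l \<le> b X l)" by measurable
  qed simp
  then show "{X \<in> space M. f X \<in> brick d (a X) (b X)} \<in> sets M"
    unfolding pred_def brick_def mem_Collect_eq Ball_def lessThan_iff .
qed

lemma measurable_half_lower:
  assumes "a l \<in> borel_measurable M" "t \<in> borel_measurable M"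
  shows "(\<lambda>X. half_lower s (\<lambda>l. a l X) q (t X) l) \<in> borel_measurable M"
    "(\<lambda>X. half_upper s (\<lambda>l. a l X) q (t X) l) \<in> borel_measurable M"
  using assms by (cases s; cases "l = q"; simp)+

text \<open>Once the position of the split is fixed, the points of \<open>I\<close>
  (\<open>x\<close> and those sharing its half) and the points of \<open>R\<close> (the other half)
  are independent, so the integral factors. \<open>H\<close> stands for the rest of the recursion,
  which sees \<open>I\<close> only, and \<open>V\<close> for its bound.\<close>

lemma nn_integral_split_le:
  fixes H :: "(nat \<Rightarrow> nat \<Rightarrow> real) \<Rightarrow> real \<Rightarrow> ennreal"
  assumes fin: "finite I" "finite R" and disj: "I \<inter> R = {}" "r \<notin> I" "r \<notin> R" and q: "q < d"
    and ab: "\<And>l. l < d \<Longrightarrow> 0 \<le> a l \<and> b l \<le> 1"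
    and ab': "\<And>l. l < d \<Longrightarrow> a l \<le> b l"
    and H: "(\<lambda>X. H X (X r q)) \<in> borel_measurable (cubes d (insert r (I \<union> R)))"
    and H': "\<And>t. (\<lambda>X. H X t) \<in> borel_measurable (cubes d I)"
    and loc: "\<And>X X' t. (\<And>j. j \<in> I \<Longrightarrow> X j = X' j) \<Longrightarrow> H X t = H X' t"
    and V: "\<And>t. a q \<le> t \<Longrightarrow> t \<le> b q \<Longrightarrow>
       (\<integral>\<^sup>+X. (\<Prod>j\<in>I. indicator (half_brick d s a b q t) (X j)) * H X t
           \<partial>cubes d I) \<le> V t"
    and Vm[measurable]: "V \<in> borel_measurable borel"
  shows "(\<integral>\<^sup>+X. indicator (brick d a b) (X r) *
      ((\<Prod>j\<in>I. indicator (half_brick d s a b q (X r q)) (X j)) * H X (X r q) *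
       (\<Prod>j\<in>R. indicator (half_brick d (\<not> s) a b q (X r q)) (X j)))
        \<partial>cubes d (insert r (I \<union> R)))
     \<le> (\<Prod>l\<in>{..<d}-{q}. ennreal (b l - a l)) *
        (\<integral>\<^sup>+t. indicator {a q..b q} t *
          (V t * (\<Prod>l<d. ennreal (half_upper (\<not> s) b q t l - half_lower (\<not> s) a q t l)) ^ card R) \<partial>lborel)"
proof -
  define A where "A X t = (\<Prod>j\<in>I. indicator (half_brick d s a b q t) (X j)) * H X t" for X t
  define B :: "(nat \<Rightarrow> nat \<Rightarrow> real) \<Rightarrow> real \<Rightarrow> ennreal" where
    "B X t = (\<Prod>j\<in>R. indicator (half_brick d (\<not> s) a b q t) (X j))" for X t
  define W where "W t = (\<Prod>l<d. ennreal (half_upper (\<not> s) b q t l - half_lower (\<not> s) a q t l)) ^ card R" for t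
  have Wm[measurable]: "W \<in> borel_measurable borel"
    unfolding W_def
    by (intro borel_measurable_power_ennreal borel_measurable_prod_ennreal measurable_compose[OF _ measurable_ennreal] borel_measurable_diff
        measurable_half_lower[of "\<lambda>l _. a l"] measurable_half_lower[of "\<lambda>l _. b l"]) auto
  have indm: "(\<lambda>X. indicator (half_brick d c a b q (X r q)) (X j))
      \<in> borel_measurable (cubes d (insert r (I \<union> R)))" if "j \<in> I \<union> R" for j c
    using that q
    by (intro measurable_indicator_box measurable_half_lower[of "\<lambda>l _. a l"] measurable_half_lower[of "\<lambda>l _. b l"]
        measurable_point_coordinate) auto
  have Fm: "(\<lambda>X. indicator (brick d a b) (X r) * (A X (X r q) * B X (X r q)))
      \<in> borel_measurable (cubes d (insert r (I \<union> R)))"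
    unfolding A_def B_def
    by (intro borel_measurable_times_ennreal borel_measurable_prod_ennreal H indm
        measurable_indicator_box[where a="\<lambda>_. a" and b="\<lambda>_. b"] measurable_point_coordinate) auto
  have Am: "(\<lambda>X. A X t) \<in> borel_measurable (cubes d I)" for t
    unfolding A_def
    by (intro borel_measurable_times_ennreal borel_measurable_prod_ennreal H' 
        measurable_indicator_box[where a="\<lambda>_. half_lower s a q t" and b="\<lambda>_. half_upper s b q t"] measurable_point_coordinate) auto
  have Bm: "(\<lambda>X. B X t) \<in> borel_measurable (cubes d R)" for t
    unfolding B_def
    by (intro borel_measurable_prod_ennreal
        measurable_indicator_box[where a="\<lambda>_. half_lower (\<not> s) a q t" and b="\<lambda>_. half_upper (\<not> s) b q t"] measurable_point_coordinate) auto
  have Aloc: "A X t = A X' t" if "\<And>j. j \<in> I \<Longrightarrow> X j = X' j" for X X' t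
    unfolding A_def using that loc[of X X' t] by (intro arg_cong2[where f="(*)"] prod.cong) auto
  have Bloc: "B X t = B X' t" if "\<And>j. j \<in> R \<Longrightarrow> X j = X' j" for X X' t
    unfolding B_def using that by (intro prod.cong) auto
  have AmU: "(\<lambda>X. A X t) \<in> borel_measurable (cubes d (I \<union> R))" for t
  proof -
    have "(\<lambda>X. A (restrict X I) t) \<in> borel_measurable (cubes d (I \<union> R))"
      by (rule measurable_compose[OF measurable_restrict_subset Am]) auto
    then show ?thesis using Aloc[of "restrict _ I"] by simp
  qed
  have BmU: "(\<lambda>X. B X t) \<in> borel_measurable (cubes d (I \<union> R))" for t
  proof -
    have "(\<lambda>X. B (restrict X R) t) \<in> borel_measurable (cubes d (I \<union> R))"
      by (rule measurable_compose[OF measurable_restrict_subset Bm]) auto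
    then show ?thesis using Bloc[of "restrict _ R"] by simp
  qed
  have Bint: "(\<integral>\<^sup>+X. B X t \<partial>cubes d R) = W t" if t: "a q \<le> t" "t \<le> b q" for t
  proof -
    have "(\<integral>\<^sup>+X. B X t \<partial>cubes d R) =
        (\<Prod>j\<in>R. \<integral>\<^sup>+z. indicator (half_brick d (\<not> s) a b q t) z \<partial>uniform_cube d)"
      unfolding B_def
      by (intro points.product_nn_integral_prod fin
          measurable_indicator_box[where a="\<lambda>_. half_lower (\<not> s) a q t" and b="\<lambda>_. half_upper (\<not> s) b q t"] measurable_coordinate) auto
    also have "\<dots> = W t"
      unfolding W_def using ab ab' q t order_trans[OF _ t(1), of 0] order_trans[OF t(2), of 1]
      by (subst nn_integral_box) (auto simp: prod_constant)
    finally show ?thesis .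
  qed
  have inner: "(\<integral>\<^sup>+X. A X t * B X t \<partial>cubes d (I \<union> R)) \<le> V t * W t"
    if t: "a q \<le> t" "t \<le> b q" for t
  proof -
    have "(\<integral>\<^sup>+X. A X t * B X t \<partial>cubes d (I \<union> R)) =
       (\<integral>\<^sup>+X. \<integral>\<^sup>+Y. A (merge I R (X, Y)) t * B (merge I R (X, Y)) t \<partial>cubes d R \<partial>cubes d I)"
      by (intro points.product_nn_integral_fold disj fin borel_measurable_times_ennreal AmU BmU)
    also have "\<dots> = (\<integral>\<^sup>+X. \<integral>\<^sup>+Y. A X t * B Y t \<partial>cubes d R \<partial>cubes d I)"
      using disj by (intro nn_integral_cong arg_cong2[where f="(*)"] Aloc Bloc) auto
    also have "\<dots> = (\<integral>\<^sup>+X. A X t * W t \<partial>cubes d I)"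
      by (simp add: nn_integral_cmult Bm Bint[OF t])
    also have "\<dots> = (\<integral>\<^sup>+X. A X t \<partial>cubes d I) * W t"
      by (rule nn_integral_multc[OF Am])
    also have "\<dots> \<le> V t * W t"
      using V[OF t] unfolding A_def by (rule mult_right_mono) simp
    finally show ?thesis .
  qed
  \<comment> \<open>\<open>r\<close> is integrated outermost: both blocks depend on it through
    \<open>X r q\<close> alone.\<close>
  have "(\<integral>\<^sup>+X. indicator (brick d a b) (X r) * (A X (X r q) * B X (X r q)) \<partial>cubes d (insert r (I \<union> R))) =
     (\<integral>\<^sup>+z. \<integral>\<^sup>+X. indicator (brick d a b) ((X(r := z)) r) * (A (X(r := z)) ((X(r := z)) r q) * B (X(r := z)) ((X(r := z)) r q))
         \<partial>cubes d (I \<union> R) \<partial>uniform_cube d)"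
    using fin disj by (intro points.product_nn_integral_insert_rev Fm) auto
  also have "\<dots> = (\<integral>\<^sup>+z. \<integral>\<^sup>+X. indicator (brick d a b) z * (A X (z q) * B X (z q)) \<partial>cubes d (I \<union> R) \<partial>uniform_cube d)"
    using disj by (auto intro!: nn_integral_cong arg_cong2[where f="(*)"] Aloc Bloc)
  also have "\<dots> = (\<integral>\<^sup>+z. indicator (brick d a b) z * (\<integral>\<^sup>+X. A X (z q) * B X (z q) \<partial>cubes d (I \<union> R)) \<partial>uniform_cube d)"
    by (intro nn_integral_cong nn_integral_cmult borel_measurable_times_ennreal AmU BmU)
  also have "\<dots> \<le> (\<integral>\<^sup>+z. indicator (brick d a b) z * (V (z q) * W (z q)) \<partial>uniform_cube d)"
  proof (rule nn_integral_mono)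
    fix z
    show "indicator (brick d a b) z * (\<integral>\<^sup>+X. A X (z q) * B X (z q) \<partial>cubes d (I \<union> R))
        \<le> indicator (brick d a b) z * (V (z q) * W (z q))"
      using q inner[of "z q"] by (cases "z \<in> brick d a b") (auto simp: brick_def)
  qed
  also have "\<dots> = (\<Prod>l\<in>{..<d}-{q}. ennreal (b l - a l)) * (\<integral>\<^sup>+t. indicator {a q..b q} t * (V t * W t) \<partial>lborel)"
    by (intro nn_integral_box_times q ab ab') auto
  finally show ?thesis unfolding A_def B_def W_def .
qed

text \<open>The left side is the moment of order \<open>e\<close> of Beta(\<open>h + 1\<close>,
  \<open>h\<close>), the fraction of a side kept by the half that holds \<open>x\<close>.
  Consecutive moments have ratio \<open>(h + e + 1) / (2 * h + e + 1)\<close>, at most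
  \<open>(1 / 2) * exp ((e + 1) / (2 * h))\<close>, and these exponents add up to
  \<open>e * (e + 1) / (4 * h)\<close>.\<close>

lemma beta_moment_le:
  fixes h :: real
  assumes "h \<ge> 1" and "h = real h'"
  shows "2 * fact (2 * h' - 1) * fact (h' + e) / (fact (h' - 1) * fact (2 * h' + e)) \<le> (1 / 2) ^ e * exp (real (e * (e + 1)) / (4 * h))"
proof -
  define \<rho> where "\<rho> e = (2 * fact (2 * h' - 1) * fact (h' + e) / (fact (h' - 1) * fact (2 * h' + e)) :: real)" for e
  have h: "h' \<ge> 1" using assms by simp
  have \<rho>0: "\<rho> 0 = 1"
  proof -
    have "fact (2 * h') = (2 * h') * (fact (2 * h' - 1) :: real)" "fact h' = h' * (fact (h' - 1) :: real)"
      using h fact_reduce[of "2 * h'"] fact_reduce[of h'] by simp_all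
    then show ?thesis using h by (simp add: \<rho>_def)
  qed
  have \<rho>S: "\<rho> (Suc e) = \<rho> e * ((h + e + 1) / (2 * h + e + 1))" for e
  proof -
    have *: "fact (h' + Suc e) = (h + e + 1) * fact (h' + e)" "fact (2 * h' + Suc e) = (2 * h + e + 1) * fact (2 * h' + e)"
      using assms by (simp_all add: algebra_simps)
    show ?thesis unfolding \<rho>_def * by (simp only: times_divide_times_eq mult_ac)
  qed
  have "\<rho> e \<ge> 0 \<and> \<rho> e \<le> (1 / 2) ^ e * exp (real (e * (e + 1)) / (4 * h))"
  proof (induction e)
    case 0 then show ?case by (simp add: \<rho>0)
  next
    case (Suc e)
    have f: "(h + e + 1) / (2 * h + e + 1) \<le> (1 / 2) * exp ((e + 1) / (2 * h))"
    proof -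
      have "(h + e + 1) / (2 * h + e + 1) \<le> (1 / 2) * (1 + (e + 1) / (2 * h))"
        using assms(1) by (simp add: divide_simps) (simp add: algebra_simps)
      also have "\<dots> \<le> (1 / 2) * exp ((e + 1) / (2 * h))"
        using exp_ge_add_one_self[of "(e + 1) / (2 * h)"] by (intro mult_left_mono) auto
      finally show ?thesis using assms(1) by (simp add: mult.commute)
    qed
    have "\<rho> (Suc e) \<le> ((1 / 2) ^ e * exp (e * (e + 1) / (4 * h))) * ((1 / 2) * exp ((e + 1) / (2 * h)))"
      unfolding \<rho>S using Suc f assms(1) by (intro mult_mono) auto
    also have "\<dots> = (1 / 2) ^ Suc e * exp (e * (e + 1) / (4 * h) + (e + 1) / (2 * h))"
      by (simp add: exp_add)
    also have "e * (e + 1) / (4 * h) + (e + 1) / (2 * h) = (Suc e * (Suc e + 1)) / (4 * h)"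
      using assms(1) by (simp add: field_simps)
    finally have "\<rho> (Suc e) \<le> (1 / 2) ^ Suc e * exp (real (Suc e * (Suc e + 1)) / (4 * h))" .
    moreover have "\<rho> (Suc e) \<ge> 0" unfolding \<rho>S using Suc assms(1) by simp
    ultimately show ?case by (simp add: algebra_simps)
  qed
  then show ?thesis unfolding \<rho>_def by blast
qed

lemma prod_indicator_eq:
  assumes "finite A"
  shows "(\<Prod>j\<in>A. indicator (S j) (X j)) = (if \<forall>j\<in>A. X j \<in> S j then 1 else 0 :: ennreal)"
  using assms by (induction A) (auto split: split_indicator)

lemma card_halves:
  assumes "finite T" "r \<in> T" "card T + 1 = 2 * h"
  shows "card (halves T r) = (2 * h - 2) choose (h - 1)"
proof -
  have "halves T r = {L. L \<subseteq> T - {r} \<and> card L = h - 1}"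
    using assms(3) by (auto simp: halves_def)
  moreover have "card (T - {r}) = 2 * h - 2" using assms by simp
  ultimately show ?thesis using n_subsets[of "T - {r}" "h - 1"] assms(1) by simp
qed

text \<open>The choices of the median, of its half and of the side number exactly the normalising
  constant of the Beta density, which makes the left side a Beta moment. The bound on
  \<open>e\<close> enters through \<open>e * (e + 1) \<le> 12\<close>.\<close>

lemma split_constant_le:
  assumes h: "h \<ge> 1" and e: "e \<le> 3"
  shows "real ((2 * h - 1) * ((2 * h - 2) choose (h - 1)) * 2) * (fact (h + e) * fact (h - 1) / fact (2 * h + e))
    \<le> (1 / 2) ^ e * exp (3 / real h)"
proof -
  have f: "fact (2 * h - 1) = real (2 * h - 1) * fact (2 * h - 2)"
  proof -
    have "2 * h - 1 - 1 = 2 * h - 2" "0 < 2 * h - 1" using h by simp_all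
    then show ?thesis using fact_reduce[of "2 * h - 1", where 'a = real] by (simp only: of_nat_id)
  qed
  have b: "real ((2 * h - 2) choose (h - 1)) = fact (2 * h - 2) / (fact (h - 1) * fact (h - 1))"
    using h binomial_fact[of "h - 1" "2 * h - 2", where 'a = real]
    by (simp add: diff_diff_eq[symmetric] mult_2)
  have "real ((2 * h - 1) * ((2 * h - 2) choose (h - 1)) * 2) * (fact (h + e) * fact (h - 1) / fact (2 * h + e))
     = 2 * fact (2 * h - 1) * fact (h + e) / (fact (h - 1) * fact (2 * h + e))"
    unfolding of_nat_mult b f by (simp add: field_simps)
  also have "\<dots> \<le> (1 / 2) ^ e * exp (real (e * (e + 1)) / (4 * real h))"
    using h by (intro beta_moment_le) auto
  also have "\<dots> \<le> (1 / 2) ^ e * exp (3 / real h)"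
  proof -
    have "e * (e + 1) \<le> 3 * 4" using e by (intro mult_mono) auto
    then have "real (e * (e + 1)) \<le> 12" by (simp del: of_nat_mult of_nat_add)
    then have "real (e * (e + 1)) / (4 * real h) \<le> 12 / (4 * real h)"
      by (intro divide_right_mono) auto
    then show ?thesis by simp
  qed
  finally show ?thesis .
qed

text \<open>Why the induction closes: each direction other than \<open>q\<close> collects the
  exponents \<open>1\<close> from the median point, \<open>h - 1\<close> from the other half and
  \<open>h + e l\<close> from the half of \<open>x\<close>; the Beta integral gives direction
  \<open>q\<close> the same total \<open>2 * h + e q\<close>.\<close>

lemma split_beta_integral:
  assumes q: "q < d" and h: "h \<ge> 1" and abq: "a q \<le> b q"
  shows "(\<Prod>l\<in>{..<d}-{q}. ennreal (b l - a l)) * (\<integral>\<^sup>+t. indicator {a q..b q} t *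
      ((C * (\<Prod>l<d. ennreal (half_upper s b q t l - half_lower s a q t l) ^ (h + e l))) *
       (\<Prod>l<d. ennreal (half_upper (\<not> s) b q t l - half_lower (\<not> s) a q t l)) ^ (h - 1)) \<partial>lborel)
    = C * (ennreal (fact (h + e q) * fact (h - 1) / fact (2 * h + e q)) * (\<Prod>l<d. ennreal (b l - a l) ^ (2 * h + e l)))"
proof -
  define u where "u l = ennreal (b l - a l)" for l
  define P where "P t = (if s then ennreal (t - a q) else ennreal (b q - t))" for t
  define Q where "Q t = (if s then ennreal (b q - t) else ennreal (t - a q))" for t
  have rem: "(\<Prod>l<d. g l) = g q * (\<Prod>l\<in>{..<d}-{q}. g l)" for g :: "nat \<Rightarrow> ennreal"
    using q by (intro prod.remove) auto
  have p1: "(\<Prod>l<d. ennreal (half_upper s b q t l - half_lower s a q t l) ^ (h + e l)) =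
     P t ^ (h + e q) * (\<Prod>l\<in>{..<d}-{q}. u l ^ (h + e l))" for t
    unfolding rem by (intro arg_cong2[where f="(*)"] prod.cong) (auto simp: P_def u_def)
  have p2: "(\<Prod>l<d. ennreal (half_upper (\<not> s) b q t l - half_lower (\<not> s) a q t l)) = Q t * (\<Prod>l\<in>{..<d}-{q}. u l)" for t
    unfolding rem by (intro arg_cong2[where f="(*)"] prod.cong) (auto simp: Q_def u_def)
  have Pm: "P \<in> borel_measurable borel" and Qm: "Q \<in> borel_measurable borel"
    unfolding P_def Q_def by (cases s; simp)+
  have I: "(\<integral>\<^sup>+t. indicator {a q..b q} t * (P t ^ (h + e q) * Q t ^ (h - 1)) \<partial>lborel) =
      ennreal ((b q - a q) ^ (2 * h + e q) * (fact (h + e q) * fact (h - 1) / fact (2 * h + e q)))"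
  proof (cases s)
    case True
    have "h + e q + (h - 1) + 1 = 2 * h + e q" using h by simp
    then show ?thesis using True beta_nn_integral[OF abq, of "h + e q" "h - 1"] by (simp only: P_def Q_def if_True)
  next
    case False
    have "h - 1 + (h + e q) + 1 = 2 * h + e q" using h by simp
    then show ?thesis using False beta_nn_integral[OF abq, of "h - 1" "h + e q"]
      by (simp only: P_def Q_def if_False mult.commute[of "ennreal (b q - _) ^ _"] mult.commute[of "fact (h + e q)"])
  qed
  define D where "D = C * (\<Prod>l\<in>{..<d}-{q}. u l ^ (h + e l)) * (\<Prod>l\<in>{..<d}-{q}. u l) ^ (h - 1)"
  have "(\<integral>\<^sup>+t. indicator {a q..b q} t *
      ((C * (\<Prod>l<d. ennreal (half_upper s b q t l - half_lower s a q t l) ^ (h + e l))) *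
       (\<Prod>l<d. ennreal (half_upper (\<not> s) b q t l - half_lower (\<not> s) a q t l)) ^ (h - 1)) \<partial>lborel) =
     (\<integral>\<^sup>+t. D * (indicator {a q..b q} t * (P t ^ (h + e q) * Q t ^ (h - 1))) \<partial>lborel)"
    unfolding p1 p2 D_def by (intro nn_integral_cong) (simp only: power_mult_distrib mult_ac)
  also have "\<dots> = D * (\<integral>\<^sup>+t. indicator {a q..b q} t * (P t ^ (h + e q) * Q t ^ (h - 1)) \<partial>lborel)"
    using Pm Qm by (intro nn_integral_cmult borel_measurable_times_ennreal borel_measurable_power_ennreal) auto
  also have "\<dots> = D * (ennreal (fact (h + e q) * fact (h - 1) / fact (2 * h + e q)) * u q ^ (2 * h + e q))"
    unfolding I u_def using abq
    by (subst mult.commute[of "(b q - a q) ^ _"], subst ennreal_mult) (auto simp: ennreal_power)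
  also have "(\<Prod>l\<in>{..<d}-{q}. ennreal (b l - a l)) * \<dots> =
      C * (ennreal (fact (h + e q) * fact (h - 1) / fact (2 * h + e q)) *
        (u q ^ (2 * h + e q) * ((\<Prod>l\<in>{..<d}-{q}. u l) * (\<Prod>l\<in>{..<d}-{q}. u l) ^ (h - 1) * (\<Prod>l\<in>{..<d}-{q}. u l ^ (h + e l)))))"
    unfolding D_def u_def[symmetric] by (simp only: mult_ac)
  also have "(\<Prod>l\<in>{..<d}-{q}. u l) * (\<Prod>l\<in>{..<d}-{q}. u l) ^ (h - 1) * (\<Prod>l\<in>{..<d}-{q}. u l ^ (h + e l)) =
      (\<Prod>l\<in>{..<d}-{q}. u l ^ (2 * h + e l))"
  proof -
    have *: "x * x ^ (h - 1) * x ^ (h + k) = x ^ (2 * h + k)" for x :: ennreal and k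
    proof -
      have "2 * h + k = Suc ((h - 1) + (h + k))" using h by simp
      then show ?thesis by (simp only: power_Suc power_add mult.assoc)
    qed
    show ?thesis
      unfolding prod_power_distrib prod.distrib[symmetric] * ..
  qed
  also have "u q ^ (2 * h + e q) * (\<Prod>l\<in>{..<d}-{q}. u l ^ (2 * h + e l)) = (\<Prod>l<d. u l ^ (2 * h + e l))"
    by (rule rem[symmetric])
  finally show ?thesis unfolding u_def .
qed

text \<open>The \<open>2 ^ length qs\<close> points of \<open>insert x0 T\<close> all have to lie in
  the box, which accounts for that exponent beside \<open>e\<close>. The recursion needs an
  arbitrary starting box; on the unit cube its sides contribute the factor 1.\<close>

theorem nn_integral_box_weight_le:
  assumes "finite T" "x0 \<notin> T" "card T + 1 = 2 ^ length qs" "set qs \<subseteq> {..<d}" and e: "\<And>l. e l \<le> 3"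
    and "\<And>l. l < d \<Longrightarrow> 0 \<le> a l \<and> b l \<le> 1" "\<And>l. l < d \<Longrightarrow> a l \<le> b l"
  shows "(\<integral>\<^sup>+X. (\<Prod>j\<in>insert x0 T. indicator (brick d a b) (X j)) * box_weight d e X (X x0) qs T a b
      \<partial>cubes d (insert x0 T))
    \<le> ennreal (exp (\<Sum>j<length qs. 3 / 2 ^ j) * (\<Prod>q\<leftarrow>qs. (1 / 2) ^ e q)) *
       (\<Prod>l<d. ennreal (b l - a l) ^ (2 ^ length qs + e l))"
  using assms(1-4) assms(6-)
proof (induction qs arbitrary: T a b)
  case Nil
  then have T: "T = {}" by simp
  have "(\<integral>\<^sup>+X. (\<Prod>j\<in>insert x0 T. indicator (brick d a b) (X j)) * box_weight d e X (X x0) [] T a b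
      \<partial>cubes d (insert x0 T)) =
     (\<integral>\<^sup>+X. indicator (brick d a b) (X x0) * (\<Prod>l<d. ennreal (b l - a l) ^ e l) \<partial>cubes d {x0})"
    by (simp add: T)
  also have "\<dots> = (\<integral>\<^sup>+z. indicator (brick d a b) z * (\<Prod>l<d. ennreal (b l - a l) ^ e l) \<partial>uniform_cube d)"
    by (intro points.product_nn_integral_singleton borel_measurable_times_ennreal borel_measurable_const
        measurable_indicator_box[where a="\<lambda>_. a" and b="\<lambda>_. b"] measurable_coordinate) auto
  also have "\<dots> = (\<integral>\<^sup>+z. indicator (brick d a b) z \<partial>uniform_cube d) * (\<Prod>l<d. ennreal (b l - a l) ^ e l)"
    by (intro nn_integral_multc measurable_indicator_box[where a="\<lambda>_. a" and b="\<lambda>_. b"] measurable_coordinate) auto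
  also have "\<dots> = (\<Prod>l<d. ennreal (b l - a l) ^ (1 + e l))"
    using Nil.prems by (subst nn_integral_box) (auto simp: prod.distrib)
  finally show ?case by simp
next
  case (Cons q qs)
  let ?M = "cubes d (insert x0 T)"
  define h :: nat where "h = 2 ^ length qs"
  have h: "h \<ge> 1" by (simp add: h_def)
  have q: "q < d" and qs: "set qs \<subseteq> {..<d}" using Cons.prems by auto
  have cT: "card T + 1 = 2 * h" using Cons.prems by (simp add: h_def)
  define c where "c = exp (\<Sum>j<length qs. 3 / 2 ^ j) * (\<Prod>q\<leftarrow>qs. (1 / 2) ^ e q :: real)"
  have c0: "c \<ge> 0" unfolding c_def by (intro mult_nonneg_nonneg prod_list_nonneg) auto
  define H where "H L s X t = box_weight d e X (X x0) qs L (half_lower s a q t) (half_upper s b q t)" for L s X t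
  \<comment> \<open>A term of the recursion with the order conditions relaxed to membership in
    closed half boxes. It has the three groups of \<open>nn_integral_split_le\<close>: the median,
    the half of \<open>x\<close>, the other half.\<close>
  define F where "F r L s X = indicator (brick d a b) (X r) *
      ((\<Prod>j\<in>insert x0 L. indicator (half_brick d s a b q (X r q)) (X j)) * H L s X (X r q) *
       (\<Prod>j\<in>T - {r} - L. indicator (half_brick d (\<not> s) a b q (X r q)) (X j)))"
    for r L s and X :: "nat \<Rightarrow> nat \<Rightarrow> real"
  define \<kappa> :: real where "\<kappa> = fact (h + e q) * fact (h - 1) / fact (2 * h + e q)"
  define Z where "Z = ennreal c * (ennreal \<kappa> * (\<Prod>l<d. ennreal (b l - a l) ^ (2 * h + e l)))"
  have props: "finite L" "L \<subseteq> T" "x0 \<notin> L" "r \<notin> L" "r \<noteq> x0" "insert x0 T = insert r (insert x0 L \<union> (T - {r} - L))"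
    "card L + 1 = h" "card (T - {r} - L) = h - 1" "finite (T - {r} - L)"
    if "r \<in> T" "L \<in> halves T r" for r L
  proof -
    have L: "L \<subseteq> T - {r}" "2 * card L + 1 = card T" using that by (auto simp: halves_def)
    show "finite L" using L Cons.prems(1) finite_subset by blast
    then have "card (T - {r} - L) = card T - 1 - card L"
      using L that Cons.prems(1) by (simp add: card_Diff_subset)
    then show "card L + 1 = h" "card (T - {r} - L) = h - 1" using L cT by auto
    show "finite (T - {r} - L)" using Cons.prems(1) by blast
  qed (use that Cons.prems(2) in \<open>auto simp: halves_def\<close>)
  have Hm: "(\<lambda>X. H L s X (X r q)) \<in> borel_measurable (cubes d J)"
    if "finite L" "L \<subseteq> J" "x0 \<in> J" "r \<in> J" for L J s r
    unfolding H_def using that q qs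
    by (intro measurable_box_weight measurable_half_lower[of "\<lambda>l _. a l"] measurable_half_lower[of "\<lambda>l _. b l"]
        measurable_point_coordinate) auto
  have Fm: "F r L s \<in> borel_measurable ?M" if "r \<in> T" "L \<in> halves T r" for r L s
    unfolding F_def using that props[OF that] q
    by (intro borel_measurable_times_ennreal borel_measurable_prod_ennreal Hm
        measurable_indicator_box[where a="\<lambda>_. a" and b="\<lambda>_. b"] measurable_indicator_box
        measurable_half_lower[of "\<lambda>l _. a l"] measurable_half_lower[of "\<lambda>l _. b l"] measurable_point_coordinate) auto
  \<comment> \<open>The bound \<open>Z\<close> is the same for all \<open>r\<close>,
    \<open>L\<close> and \<open>s\<close>, so that only the number of terms remains to be
    counted.\<close>
  have bound: "(\<integral>\<^sup>+X. F r L s X \<partial>?M) \<le> Z" if rL: "r \<in> T" "L \<in> halves T r" for r L s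
  proof -
    define V where "V t = ennreal c * (\<Prod>l<d. ennreal (half_upper s b q t l - half_lower s a q t l) ^ (h + e l))" for t
    have Vm: "V \<in> borel_measurable borel"
      unfolding V_def
      by (intro borel_measurable_times_ennreal borel_measurable_const borel_measurable_power_ennreal borel_measurable_prod_ennreal
          measurable_compose[OF _ measurable_ennreal] borel_measurable_diff
          measurable_half_lower[of "\<lambda>l _. a l"] measurable_half_lower[of "\<lambda>l _. b l"]) auto
    have V: "(\<integral>\<^sup>+X. (\<Prod>j\<in>insert x0 L. indicator (half_brick d s a b q t) (X j)) * H L s X t
           \<partial>cubes d (insert x0 L)) \<le> V t" if t: "a q \<le> t" "t \<le> b q" for t
      unfolding H_def V_def c_def h_def
    proof (rule Cons.IH)
      show "0 \<le> half_lower s a q t l \<and> half_upper s b q t l \<le> 1" if "l < d" for l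
        using Cons.prems(5)[OF that] t by (cases "l = q") (auto intro: order_trans)
      show "half_lower s a q t l \<le> half_upper s b q t l" if "l < d" for l
        using Cons.prems(6)[OF that] t by (cases "l = q") auto
    qed (use props[OF rL] qs h_def in auto)
    have "(\<integral>\<^sup>+X. F r L s X \<partial>?M) \<le> (\<Prod>l\<in>{..<d}-{q}. ennreal (b l - a l)) *
        (\<integral>\<^sup>+t. indicator {a q..b q} t *
          (V t * (\<Prod>l<d. ennreal (half_upper (\<not> s) b q t l - half_lower (\<not> s) a q t l)) ^ card (T - {r} - L)) \<partial>lborel)"
      unfolding F_def props(6)[OF rL]
    proof (rule nn_integral_split_le)
      show "(\<lambda>X. H L s X (X r q)) \<in> borel_measurable (cubes d (insert r (insert x0 L \<union> (T - {r} - L))))"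
        using props[OF rL] by (intro Hm) auto
      show "(\<lambda>X. H L s X t) \<in> borel_measurable (cubes d (insert x0 L))" for t
        unfolding H_def using qs props[OF rL] by (intro measurable_box_weight) auto
      show "H L s X t = H L s X' t" if "\<And>j. j \<in> insert x0 L \<Longrightarrow> X j = X' j" for X X' t
        unfolding H_def using that box_weight_cong[of L X X'] by simp
      show "insert x0 L \<inter> (T - {r} - L) = {}" using Cons.prems(2) by auto
    qed (use props[OF rL] q Cons.prems V Vm in auto)
    also have "\<dots> = Z"
      unfolding V_def Z_def \<kappa>_def props(8)[OF rL]
      using Cons.prems(6)[OF q] by (intro split_beta_integral q h)
    finally show ?thesis .
  qed
  have "(\<integral>\<^sup>+X. (\<Prod>j\<in>insert x0 T. indicator (brick d a b) (X j)) * box_weight d e X (X x0) (q # qs) T a b \<partial>?M)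
     \<le> (\<integral>\<^sup>+X. (\<Sum>r\<in>T. \<Sum>L\<in>halves T r. \<Sum>s\<in>UNIV. F r L s X) \<partial>?M)"
    unfolding box_weight.simps sum_distrib_left
  proof (intro nn_integral_mono sum_mono)
    fix X r L s assume rL: "r \<in> T" "L \<in> halves T r"
    show "(\<Prod>j\<in>insert x0 T. indicator (brick d a b) (X j)) *
       (if separates s X T r L q (X x0 q)
        then box_weight d e X (X x0) qs L (half_lower s a q (X r q)) (half_upper s b q (X r q)) else 0) \<le> F r L s X"
    proof (cases "separates s X T r L q (X x0 q)
        \<and> (\<forall>j\<in>insert x0 T. X j \<in> brick d a b)")
      case True
      have "(\<Prod>j\<in>insert x0 L. indicator (half_brick d s a b q (X r q)) (X j)) = (1::ennreal)"
        using True props[OF rL] by (subst prod_indicator_eq) (auto simp: brick_def side_def split: if_splits)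
      moreover have "(\<Prod>j\<in>T - {r} - L. indicator (half_brick d (\<not> s) a b q (X r q)) (X j)) = (1::ennreal)"
      proof -
        have "X j \<in> half_brick d (\<not> s) a b q (X r q)" if j: "j \<in> T - {r} - L" for j
        proof -
          have "side (\<not> s) (X r q) (X j q)" "X j \<in> brick d a b" using True j by blast+
          then show ?thesis by (auto simp: brick_def side_def split: if_splits)
        qed
        then show ?thesis using props(9)[OF rL] by (subst prod_indicator_eq) auto
      qed
      moreover have "indicator (brick d a b) (X r) = (1::ennreal)"
        using True rL by simp
      ultimately show ?thesis
        using True Cons.prems(1) unfolding F_def H_def by (subst prod_indicator_eq) auto
    next
      case False
      then have "(\<Prod>j\<in>insert x0 T. indicator (brick d a b) (X j)) *
       (if separates s X T r L q (X x0 q)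
        then box_weight d e X (X x0) qs L (half_lower s a q (X r q)) (half_upper s b q (X r q)) else 0) = 0"
        using Cons.prems(1) by (subst prod_indicator_eq) auto
      then show ?thesis by (simp only: zero_le)
    qed
  qed
  also have "\<dots> = (\<Sum>r\<in>T. \<Sum>L\<in>halves T r. \<Sum>s\<in>UNIV. \<integral>\<^sup>+X. F r L s X \<partial>?M)"
  proof -
    have "(\<integral>\<^sup>+X. (\<Sum>r\<in>T. \<Sum>L\<in>halves T r. \<Sum>s\<in>UNIV. F r L s X) \<partial>?M) = (\<Sum>r\<in>T. \<integral>\<^sup>+X. (\<Sum>L\<in>halves T r. \<Sum>s\<in>UNIV. F r L s X) \<partial>?M)"
      by (intro nn_integral_sum borel_measurable_sum Fm)
    also have "\<dots> = (\<Sum>r\<in>T. \<Sum>L\<in>halves T r. \<integral>\<^sup>+X. (\<Sum>s\<in>UNIV. F r L s X) \<partial>?M)"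
      by (intro sum.cong refl nn_integral_sum borel_measurable_sum Fm)
    also have "\<dots> = (\<Sum>r\<in>T. \<Sum>L\<in>halves T r. \<Sum>s\<in>UNIV. \<integral>\<^sup>+X. F r L s X \<partial>?M)"
      by (intro sum.cong refl nn_integral_sum Fm)
    finally show ?thesis .
  qed
  also have "\<dots> \<le> (\<Sum>r\<in>T. \<Sum>L\<in>halves T r. \<Sum>s\<in>(UNIV::bool set). Z)"
    by (intro sum_mono bound)
  also have "\<dots> = of_nat ((2 * h - 1) * ((2 * h - 2) choose (h - 1)) * 2) * Z"
  proof -
    have "(\<Sum>r\<in>T. \<Sum>L\<in>halves T r. \<Sum>s\<in>(UNIV::bool set). Z) = (\<Sum>r\<in>T. of_nat ((2 * h - 2) choose (h - 1)) * (2 * Z))"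
      using card_halves[OF Cons.prems(1) _ cT] by (intro sum.cong refl) (simp add: UNIV_bool mult_2)
    moreover have "card T = 2 * h - 1" using cT by simp
    ultimately show ?thesis by (simp add: mult.assoc)
  qed
  also have "\<dots> = ennreal (c * (real ((2 * h - 1) * ((2 * h - 2) choose (h - 1)) * 2) * \<kappa>)) *
      (\<Prod>l<d. ennreal (b l - a l) ^ (2 * h + e l))"
  proof -
    have k0: "\<kappa> \<ge> 0" by (simp add: \<kappa>_def)
    have "ennreal (c * (real N * \<kappa>)) = of_nat N * (ennreal c * ennreal \<kappa>)" for N
      using c0 k0 by (simp add: ennreal_mult ennreal_of_nat_eq_real_of_nat mult_ac)
    then show ?thesis unfolding Z_def by (simp only: mult.assoc)
  qed
  also have "\<dots> \<le> ennreal (exp (\<Sum>j<length (q # qs). 3 / 2 ^ j) * (\<Prod>q\<leftarrow>q # qs. (1 / 2) ^ e q)) *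
       (\<Prod>l<d. ennreal (b l - a l) ^ (2 * h + e l))"
  proof (intro mult_right_mono ennreal_leI)
    have "c * (real ((2 * h - 1) * ((2 * h - 2) choose (h - 1)) * 2) * \<kappa>) \<le> c * ((1 / 2) ^ e q * exp (3 / real h))"
      unfolding \<kappa>_def by (intro mult_left_mono split_constant_le h e c0)
    also have "\<dots> = exp (\<Sum>j<length (q # qs). 3 / 2 ^ j) * (\<Prod>q\<leftarrow>q # qs. (1 / 2) ^ e q)"
      by (simp add: c_def exp_add h_def)
    finally show "c * (real ((2 * h - 1) * ((2 * h - 2) choose (h - 1)) * 2) * \<kappa>) \<le>
       exp (\<Sum>j<length (q # qs). 3 / 2 ^ j) * (\<Prod>q\<leftarrow>q # qs. (1 / 2) ^ e q)" .
  qed simp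
  finally show ?case by (simp add: h_def)
qed

section \<open>Leaf mates\<close>

text \<open>
  \<open>i\<close> is in the leaf of \<open>x\<close> when the cells around \<open>x\<close> are split along \<open>qs\<close>, the root first. The inner
  condition compares \<open>x\<close> with the midpoint between the largest value on \<open>L\<close> and the smallest one
  outside \<open>L\<close>.
\<close>

primrec mate :: "(nat \<Rightarrow> nat \<Rightarrow> real) \<Rightarrow> nat \<Rightarrow> (nat \<Rightarrow> real) \<Rightarrow> nat list \<Rightarrow> nat set \<Rightarrow> bool" where
  "mate X i x [] S = (i \<in> S)"
| "mate X i x (q # qs) S = (\<exists>L\<in>Pow S. 2 * card L = card S \<and> (\<forall>j\<in>L. \<forall>j'\<in>S - L. X j q < X j' q) \<and>
     (if \<forall>j'\<in>S - L. \<exists>j\<in>L. 2 * x q \<le> X j q + X j' q then mate X i x qs L else mate X i x qs (S - L)))"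

lemma mate_imp_mem: "mate X i x qs S \<Longrightarrow> i \<in> S"
  by (induction qs arbitrary: S) (auto split: if_splits)

text \<open>\<open>mate\<close> speaks of halves rather than of sorted lists: it is then a finite
  Boolean combination of comparisons between coordinates.\<close>

lemma measurable_mate:
  assumes "finite S" "S \<subseteq> J" "x0 \<in> J" "set qs \<subseteq> {..<d}"
  shows "Measurable.pred (cubes d J) (\<lambda>X. mate X i (X x0) qs S)"
  using assms
proof (induction qs arbitrary: S)
  case (Cons q qs)
  let ?M = "cubes d J"
  have q: "q < d" and qs: "set qs \<subseteq> {..<d}" using Cons.prems by auto
  have x0: "(\<lambda>X. X x0 q) \<in> borel_measurable ?M"
    using Cons.prems q by (intro measurable_point_coordinate) auto
  have X: "(\<lambda>X. X j q) \<in> borel_measurable ?M" if "j \<in> S" for j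
    using Cons.prems that q by (intro measurable_point_coordinate) auto
  have lt: "Measurable.pred ?M (\<lambda>X. X j q < X j' q)" if "j \<in> S" "j' \<in> S" for j j'
    unfolding pred_def by (intro borel_measurable_less X that)
  have le: "Measurable.pred ?M (\<lambda>X. 2 * X x0 q \<le> X j q + X j' q)" if "j \<in> S" "j' \<in> S" for j j'
    unfolding pred_def by (intro borel_measurable_le borel_measurable_add borel_measurable_times borel_measurable_const x0 X that)
  show ?case
    unfolding mate.simps
  proof (intro pred_intros_finite)
    show "finite (Pow S)" using Cons.prems by simp
    fix L assume L: "L \<in> Pow S"
    then have fin: "finite L" "finite (S - L)" "L \<subseteq> S" using Cons.prems finite_subset by blast+
    have 1: "Measurable.pred ?M (\<lambda>X. \<forall>j\<in>L. \<forall>j'\<in>S - L. X j q < X j' q)"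
      using fin by (intro pred_intros_finite lt) auto
    have 2: "Measurable.pred ?M (\<lambda>X. \<forall>j'\<in>S - L. \<exists>j\<in>L. 2 * X x0 q \<le> X j q + X j' q)"
      using fin by (intro pred_intros_finite le) auto
    have 3: "Measurable.pred ?M (\<lambda>X. mate X i (X x0) qs L)" "Measurable.pred ?M (\<lambda>X. mate X i (X x0) qs (S - L))"
      using fin Cons.prems qs by (auto intro!: Cons.IH)
    have "Measurable.pred ?M (\<lambda>X. if \<forall>j'\<in>S - L. \<exists>j\<in>L. 2 * X x0 q \<le> X j q + X j' q
        then mate X i (X x0) qs L else mate X i (X x0) qs (S - L))"
      using 2 3 unfolding if_bool_eq_conj by (intro pred_intros_logic)
    then show "Measurable.pred ?M (\<lambda>X. 2 * card L = card S \<and> (\<forall>j\<in>L. \<forall>j'\<in>S - L. X j q < X j' q) \<and>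
       (if \<forall>j'\<in>S - L. \<exists>j\<in>L. 2 * X x0 q \<le> X j q + X j' q then mate X i (X x0) qs L else mate X i (X x0) qs (S - L)))"
      using 1 by (intro pred_intros_logic measurable_const) simp_all
  qed
qed simp

section \<open>From leaf mates to a box that ignores the deleted point\<close>

lemma exists_rank:
  fixes f :: "'a \<Rightarrow> real"
  assumes "finite T" "inj_on f T" "k < card T"
  shows "\<exists>r\<in>T. card {j\<in>T. f j < f r} = k"
  using assms
proof (induction "card T" arbitrary: T)
  case (Suc m)
  then have ne: "T \<noteq> {}" by auto
  then obtain z where z: "z \<in> T" "\<And>j. j \<in> T \<Longrightarrow> f j \<le> f z"
  proof -
    have "Max (f ` T) \<in> f ` T" using ne Suc.prems(1) by (intro Max_in) auto
    then obtain z where "z \<in> T" "f z = Max (f ` T)" by auto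
    then show ?thesis using Suc.prems(1) by (intro that[of z]) auto
  qed
  have zl: "f j < f z" if "j \<in> T - {z}" for j
    using z that Suc.prems(2) by (metis DiffE inj_onD insertI1 order_le_less)
  show ?case
  proof (cases "k = m")
    case True
    have "{j\<in>T. f j < f z} = T - {z}" using zl by auto
    then show ?thesis using True z(1) Suc by (intro bexI[of _ z]) auto
  next
    case False
    have "\<exists>r\<in>T - {z}. card {j\<in>T - {z}. f j < f r} = k"
      using Suc z False by (intro Suc.hyps) (auto intro: inj_on_subset)
    then obtain r where r: "r \<in> T - {z}" "card {j\<in>T - {z}. f j < f r} = k" by blast
    have "{j\<in>T. f j < f r} = {j\<in>T - {z}. f j < f r}" using zl[OF r(1)] by auto
    then show ?thesis using r by (intro bexI[of _ r]) simp_all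
  qed
qed simp

lemma median_split:
  fixes f :: "nat \<Rightarrow> real"
  assumes T: "finite T" "card T + 1 = 2 * h" and r: "r \<in> T" "card {j\<in>T. f j < f r} = h - 1"
    and inj: "inj_on f T"
  shows "{j\<in>T. side s (f r) (f j)} \<in> halves T r"
    "T - {r} - {j\<in>T. side s (f r) (f j)} = {j\<in>T. side (\<not> s) (f r) (f j)}"
    "card {j\<in>T. f r < f j} = h - 1"
proof -
  let ?A = "{j\<in>T. f j < f r}" and ?B = "{j\<in>T. f r < f j}"
  have eq: "T = insert r (?A \<union> ?B)"
  proof
    show "T \<subseteq> insert r (?A \<union> ?B)" using inj r(1) by (auto simp: inj_on_def) (metis linorder_neqE_linordered_idom)
  qed (use r in auto)
  have "card T = Suc (card ?A + card ?B)"
    by (subst eq, subst card_insert_disjoint) (use T in \<open>auto intro!: card_Un_disjoint\<close>)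
  then show B: "card ?B = h - 1" using T r by simp
  show "{j\<in>T. side s (f r) (f j)} \<in> halves T r"
    using r B T by (cases s) (auto simp: halves_def side_def)
  show "T - {r} - {j\<in>T. side s (f r) (f j)} = {j\<in>T. side (\<not> s) (f r) (f j)}"
    using eq by (cases s) (auto simp: side_def)
qed

text \<open>A single term is kept of a sum of nonnegative ones, which gives upper bounds through
  \<open>box_weight\<close> with no appeal to uniqueness of the median.\<close>

lemma box_weight_Cons_ge:
  assumes "finite T" "r \<in> T" "L \<in> halves T r"
    "\<forall>j\<in>L. side s (X r q) (X j q)" "\<forall>j\<in>T - {r} - L. side (\<not> s) (X r q) (X j q)" "side s (X r q) (x q)"
  shows "box_weight d e X x qs L (half_lower s a q (X r q)) (half_upper s b q (X r q)) \<le> box_weight d e X x (q # qs) T a b"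
proof -
  define g where "g r L s = (if separates s X T r L q (x q)
     then box_weight d e X x qs L (half_lower s a q (X r q)) (half_upper s b q (X r q)) else 0)" for r L s
  have "box_weight d e X x qs L (half_lower s a q (X r q)) (half_upper s b q (X r q)) = g r L s"
    using assms by (simp add: g_def)
  also have "\<dots> \<le> (\<Sum>s\<in>UNIV. g r L s)" by (rule member_le_sum) auto
  also have "\<dots> \<le> (\<Sum>L\<in>halves T r. \<Sum>s\<in>UNIV. g r L s)"
    using assms finite_halves by (intro member_le_sum[of L]) auto
  also have "\<dots> \<le> (\<Sum>r\<in>T. \<Sum>L\<in>halves T r. \<Sum>s\<in>UNIV. g r L s)"
    using assms by (intro member_le_sum[of r]) auto
  finally show ?thesis by (simp only: box_weight.simps g_def)
qed

text \<open>
  Deleting observation \<open>i\<close> from a cell of \<open>2h\<close> observations leaves \<open>2h - 1\<close> of them, whose central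
  one, \<open>r\<close>, separates the half containing \<open>i\<close> from the rest. The resulting boxes depend on the other
  observations only, so \<open>i\<close> is independent of them.
\<close>

lemma mate_imp_box:
  assumes "finite T" "i \<notin> T" "card T + 1 = 2 ^ length qs" "set qs \<subseteq> {..<d}"
    and "\<forall>q<d. inj_on (\<lambda>j. X j q) T" "\<forall>j\<in>T. \<forall>q<d. x q \<noteq> X j q" "x \<in> brick d a b"
    and "\<forall>j\<in>T. X j \<in> brick d a b"
  shows "\<exists>a' b'. (\<forall>e. (\<Prod>l<d. ennreal (b' l - a' l) ^ e l) \<le> box_weight d e X x qs T a b) \<and>
     (\<forall>l<d. a l \<le> a' l \<and> b' l \<le> b l) \<and> x \<in> brick d a' b' \<and>
     (\<forall>y\<in>brick d a b. mate (X(i := y)) i x qs (insert i T) \<longrightarrow> y \<in> brick d a' b')"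
  using assms
proof (induction qs arbitrary: T a b)
  case Nil
  then show ?case by (intro exI[of _ a] exI[of _ b]) auto
next
  case (Cons q qs)
  define h :: nat where "h = 2 ^ length qs"
  have h: "h \<ge> 1" by (simp add: h_def)
  have q: "q < d" and qs: "set qs \<subseteq> {..<d}" using Cons.prems by auto
  have cT: "card T + 1 = 2 * h" using Cons.prems by (simp add: h_def)
  have inj: "inj_on (\<lambda>j. X j q) T" using Cons.prems q by blast
  obtain r where r: "r \<in> T" "card {j\<in>T. X j q < X r q} = h - 1"
  proof -
    have "h - 1 < card T" using cT h by linarith
    then show ?thesis using exists_rank[OF Cons.prems(1) inj, of "h - 1"] that by blast
  qed
  define t where "t = X r q"
  \<comment> \<open>The side is chosen from \<open>x\<close> and the remaining points, before
    \<open>y\<close> is introduced; this keeps the box independent of the deleted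
    observation.\<close>
  define s where "s \<longleftrightarrow> x q < t"
  have xs: "side s t (x q)" proof -
    have "x q \<noteq> X r q" using Cons.prems(6) r q by blast
    then show ?thesis by (auto simp: s_def side_def t_def)
  qed
  define L where "L = {j\<in>T. side s t (X j q)}"
  have L: "L \<in> halves T r" "T - {r} - L = {j\<in>T. side (\<not> s) t (X j q)}" "card {j\<in>T. X r q < X j q} = h - 1"
    unfolding L_def t_def using median_split[OF Cons.prems(1) cT r inj] by auto
  have LT: "L \<subseteq> T" "finite L" using Cons.prems(1) by (auto simp: L_def)
  have cL: "card L + 1 = h" using L(1) cT by (auto simp: halves_def)
  have xb: "x \<in> half_brick d s a b q t"
    using Cons.prems(7) xs q by (auto simp: brick_def side_def split: if_splits)
  have "\<exists>a' b'. (\<forall>e. (\<Prod>l<d. ennreal (b' l - a' l) ^ e l) \<le> box_weight d e X x qs L (half_lower s a q t) (half_upper s b q t)) \<and>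
     (\<forall>l<d. half_lower s a q t l \<le> a' l \<and> b' l \<le> half_upper s b q t l) \<and> x \<in> brick d a' b' \<and>
     (\<forall>y\<in>half_brick d s a b q t. mate (X(i := y)) i x qs (insert i L) \<longrightarrow> y \<in> brick d a' b')"
  proof (rule Cons.IH)
    show "\<forall>q<d. inj_on (\<lambda>j. X j q) L" using Cons.prems(5) LT inj_on_subset by blast
    show "\<forall>j\<in>L. X j \<in> half_brick d s a b q t"
      using Cons.prems(8) by (auto simp: L_def brick_def side_def split: if_splits)
  qed (use Cons.prems LT cL qs xb h_def in auto)
  then obtain a' b' where ab': "\<And>e. (\<Prod>l<d. ennreal (b' l - a' l) ^ e l) \<le> box_weight d e X x qs L (half_lower s a q t) (half_upper s b q t)"
     "\<And>l. l < d \<Longrightarrow> half_lower s a q t l \<le> a' l \<and> b' l \<le> half_upper s b q t l" "x \<in> brick d a' b'"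
     "\<And>y. y \<in> half_brick d s a b q t \<Longrightarrow> mate (X(i := y)) i x qs (insert i L) \<Longrightarrow> y \<in> brick d a' b'"
    by blast
  have "y \<in> brick d a' b'" if y: "y \<in> brick d a b" and m: "mate (X(i := y)) i x (q # qs) (insert i T)" for y
  proof -
    let ?X = "X(i := y)"
    have XT: "?X j = X j" if "j \<in> T" for j using that Cons.prems(2) by auto
    from m obtain L' where L': "L' \<subseteq> insert i T" "2 * card L' = card (insert i T)"
      "\<And>j j'. j \<in> L' \<Longrightarrow> j' \<in> insert i T - L' \<Longrightarrow> ?X j q < ?X j' q"
      "if \<forall>j'\<in>insert i T - L'. \<exists>j\<in>L'. 2 * x q \<le> ?X j q + ?X j' q then mate ?X i x qs L' else mate ?X i x qs (insert i T - L')"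
      by auto
    have cL': "card L' = h" "finite L'"
      using L'(1,2) Cons.prems(1,2) cT finite_subset by auto
    \<comment> \<open>The half kept by the true tree, with \<open>y\<close> in place of the deleted
      point, is \<open>i\<close> together with the half of the exact median.\<close>
    have "insert i L = (if \<forall>j'\<in>insert i T - L'. \<exists>j\<in>L'. 2 * x q \<le> ?X j q + ?X j' q then L' else insert i T - L') \<and> side s t (y q)"
    proof (cases "\<forall>j'\<in>insert i T - L'. \<exists>j\<in>L'. 2 * x q \<le> ?X j q + ?X j' q")
      case True
      then have i: "i \<in> L'" using L'(4) mate_imp_mem by fastforce
      \<comment> \<open>If \<open>r\<close> were in the lower half, so would be \<open>i\<close> and
        the \<open>h - 1\<close> points below \<open>r\<close>: one point too many.\<close>
      have rL': "r \<notin> L'"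
      proof
        assume rL: "r \<in> L'"
        have "{j\<in>T. X j q < X r q} \<subseteq> L' - {i, r}"
        proof
          fix j assume "j \<in> {j\<in>T. X j q < X r q}"
          then have j: "j \<in> T" "?X j q < ?X r q" using XT r by auto
          have "j \<in> L'"
          proof (rule ccontr)
            assume "j \<notin> L'"
            then have "?X r q < ?X j q" using j(1) rL by (intro L'(3)) auto
            then show False using j(2) by simp
          qed
          then show "j \<in> L' - {i, r}" using j Cons.prems(2) by auto
        qed
        then have "h - 1 \<le> card (L' - {i, r})" using r(2) cL'(2) by (metis card_mono finite_Diff)
        moreover have "i \<noteq> r" using r Cons.prems(2) by auto
        moreover have "card (L' - {i, r}) = h - card {i, r}" using i rL r Cons.prems(2) cL' by (subst card_Diff_subset) auto
        moreover have "h \<ge> 2" using i rL r Cons.prems(2) cL' card_mono[of L' "{i, r}"] by (cases "i = r") auto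
        ultimately show False by auto
      qed
      have sub: "L' - {i} \<subseteq> {j\<in>T. X j q < X r q}"
      proof
        fix j assume "j \<in> L' - {i}"
        then have j: "j \<in> L'" "j \<in> T" using L'(1) by auto
        then have "?X j q < ?X r q" using rL' r by (intro L'(3)) auto
        then show "j \<in> {j\<in>T. X j q < X r q}" using j XT r by auto
      qed
      have "L' - {i} = {j\<in>T. X j q < X r q}"
        using r i cL' Cons.prems(1) by (intro card_subset_eq sub) auto
      moreover have yt: "y q < t" using L'(3)[OF i, of r] rL' r XT by (auto simp: t_def)
      \<comment> \<open>\<open>x\<close> is at most the midpoint of \<open>r\<close> and some point
        below it, hence below \<open>r\<close>: the midpoint rule and the exact median agree on the
        side of \<open>x\<close>.\<close>
      moreover have "x q < t"
      proof -
        obtain j where j: "j \<in> L'" "2 * x q \<le> ?X j q + ?X r q" using True r rL' by blast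
        moreover have "?X j q < ?X r q" using j rL' r by (intro L'(3)) auto
        ultimately show ?thesis using XT[OF r(1)] by (simp add: t_def)
      qed
      then have s by (simp add: s_def)
      ultimately show ?thesis using True i by (auto simp: L_def side_def t_def)
    next
      case False
      then have "mate ?X i x qs (insert i T - L')" using L'(4) by meson
      then have i: "i \<notin> L'" using mate_imp_mem by fastforce
      then have L'T: "L' \<subseteq> T" using L'(1) by auto
      \<comment> \<open>Otherwise the \<open>h\<close> points of \<open>L'\<close> would all lie
        among the \<open>h - 1\<close> points below \<open>r\<close>.\<close>
      have rL': "r \<in> L'"
      proof (rule ccontr)
        assume rL: "r \<notin> L'"
        have "L' \<subseteq> {j\<in>T. X j q < X r q}"
        proof
          fix j assume j: "j \<in> L'"
          then have "?X j q < ?X r q" using rL r by (intro L'(3)) auto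
          then show "j \<in> {j\<in>T. X j q < X r q}" using j L'T XT r by auto
        qed
        then have "card L' \<le> card {j\<in>T. X j q < X r q}" using Cons.prems(1) by (intro card_mono) auto
        then have "h \<le> h - 1" using r(2) cL' by simp
        then show False using h by simp
      qed
      have sub: "T - L' \<subseteq> {j\<in>T. X r q < X j q}"
      proof
        fix j assume j: "j \<in> T - L'"
        then have "?X r q < ?X j q" using rL' by (intro L'(3)) auto
        then show "j \<in> {j\<in>T. X r q < X j q}" using j XT r by auto
      qed
      have "card (T - L') = h - 1" using L'T cL' cT by (subst card_Diff_subset) auto
      then have TL': "T - L' = {j\<in>T. X r q < X j q}"
        using L(3) Cons.prems(1) by (intro card_subset_eq sub) auto
      have yt: "t < y q" using L'(3)[OF rL', of i] i r XT by (auto simp: t_def)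
      have "t < x q"
      proof -
        obtain j' where j': "j' \<in> insert i T - L'" "?X r q + ?X j' q < 2 * x q" using False rL' by (meson not_le)
        moreover have "?X r q < ?X j' q" using j' rL' by (intro L'(3)) auto
        ultimately show ?thesis using XT[OF r(1)] by (simp add: t_def)
      qed
      then have s: "\<not> s" by (simp add: s_def)
      have "insert i T - L' = insert i (T - L')" using i by auto
      also have "T - L' = L" unfolding TL' L_def side_def t_def using s by simp
      finally show ?thesis unfolding if_not_P[OF False] using s yt by (simp add: side_def)
    qed
    then have "mate ?X i x qs (insert i L)" "side s t (y q)" using L'(4) by (auto split: if_splits)
    moreover from this have "y \<in> half_brick d s a b q t"
      using y q by (auto simp: brick_def side_def split: if_splits)
    ultimately show ?thesis using ab'(4) by blast
  qed
  moreover have "(\<Prod>l<d. ennreal (b' l - a' l) ^ e l) \<le> box_weight d e X x (q # qs) T a b" for e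
  proof -
    have "(\<Prod>l<d. ennreal (b' l - a' l) ^ e l) \<le> box_weight d e X x qs L (half_lower s a q t) (half_upper s b q t)"
      by (rule ab'(1))
    also have "\<dots> \<le> box_weight d e X x (q # qs) T a b"
      unfolding t_def using xs L(1,2)
      by (intro box_weight_Cons_ge Cons.prems(1) r) (auto simp: t_def L_def)
    finally show ?thesis .
  qed
  moreover have "\<forall>l<d. a l \<le> a' l \<and> b' l \<le> b l"
  proof (intro allI impI)
    fix l assume "l < d"
    moreover have "a q \<le> t" "t \<le> b q" using Cons.prems(8) q r by (auto simp: brick_def t_def)
    ultimately show "a l \<le> a' l \<and> b' l \<le> b l"
      using ab'(2)[of l] by (cases s; cases "l = q") auto
  qed
  ultimately show ?case using ab'(3) by blast
qed

section \<open>Trees and the forest weights\<close>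

text \<open>Replaces the sorted list behind \<open>order_stat\<close> by a partition in the style of
  \<open>mate\<close>: \<open>L\<close> is the lower half, and \<open>l\<close> and \<open>u\<close>
  carry the two central order statistics.\<close>

lemma cell_median_split:
  fixes D :: training_set
  assumes S: "finite S" "card S = 2 * h" "h \<ge> 1" and inj: "inj_on (\<lambda>i. fst (D i) q) S"
  shows "\<exists>L l u. L \<subseteq> S \<and> card L = h \<and> l \<in> L \<and> u \<in> S - L \<and> (\<forall>j\<in>L. fst (D j) q \<le> fst (D l) q) \<and>
    (\<forall>j\<in>S - L. fst (D u) q \<le> fst (D j) q) \<and> fst (D l) q < fst (D u) q \<and>
    cell_median D S q = (fst (D l) q + fst (D u) q) / 2"
proof -
  define f where "f = (\<lambda>i. fst (D i) q)"
  define ys where "ys = sort (map f (sorted_list_of_set S))"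
  have f: "inj_on f S" using inj by (simp add: f_def)
  have ys: "sorted ys" "distinct ys" "set ys = f ` S" "length ys = 2 * h"
    using S f by (auto simp: ys_def distinct_map)
  have nth_less: "ys ! i < ys ! j" if "i < j" "j < 2 * h" for i j
    using that ys by (metis distinct_conv_nth le_neq_trans less_imp_le less_trans nat_neq_iff sorted_nth_mono)
  have nth_le_iff: "ys ! i \<le> ys ! j \<longleftrightarrow> i \<le> j" if "i < 2 * h" "j < 2 * h" for i j
    using that nth_less by (metis leD le_less linorder_le_less_linear)
  define L where "L = {i\<in>S. f i \<le> ys ! (h - 1)}"
  have fL: "f ` L = (\<lambda>i. ys ! i) ` {..<h}"
  proof
    show "f ` L \<subseteq> (\<lambda>i. ys ! i) ` {..<h}"
    proof
      fix y assume "y \<in> f ` L"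
      then have "y \<in> set ys" "y \<le> ys ! (h - 1)" using ys(3) by (auto simp: L_def)
      then obtain i where "i < 2 * h" "y = ys ! i" using ys(4) by (auto simp: in_set_conv_nth)
      then have "i \<le> h - 1" using \<open>y \<le> ys ! (h - 1)\<close> nth_le_iff[of i "h - 1"] S by auto
      then have "i < h" using S(3) by linarith
      then show "y \<in> (\<lambda>i. ys ! i) ` {..<h}" using \<open>y = ys ! i\<close> by blast
    qed
    show "(\<lambda>i. ys ! i) ` {..<h} \<subseteq> f ` L"
    proof
      fix y assume "y \<in> (\<lambda>i. ys ! i) ` {..<h}"
      then obtain i where i: "i < h" "y = ys ! i" by auto
      then have "y \<in> f ` S" using ys by (metis nth_mem mult_2 trans_less_add1)
      then show "y \<in> f ` L" using i nth_le_iff[of i "h - 1"] S by (auto simp: L_def)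
    qed
  qed
  have "card L = card (f ` L)" using f by (intro card_image[symmetric] inj_on_subset[OF f]) (auto simp: L_def)
  also have "\<dots> = h"
    unfolding fL using ys by (subst card_image) (auto simp: inj_on_def nth_eq_iff_index_eq)
  finally have cL: "card L = h" .
  have "ys ! (h - 1) \<in> set ys" "ys ! h \<in> set ys" using S ys(4) by (auto intro!: nth_mem)
  then obtain l u where lu: "l \<in> S" "f l = ys ! (h - 1)" "u \<in> S" "f u = ys ! h" unfolding ys(3) by force
  have less: "f l < f u" using nth_less[of "h - 1" h] S lu by simp
  have uL: "u \<in> S - L" using less lu by (auto simp: L_def)
  have "f u \<le> f j" if "j \<in> S - L" for j
  proof -
    have "f j \<in> set ys" "\<not> f j \<le> ys ! (h - 1)" using that ys(3) by (auto simp: L_def)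
    then obtain i where "i < 2 * h" "f j = ys ! i" using ys(4) by (auto simp: in_set_conv_nth)
    then show ?thesis using nth_le_iff[of i "h - 1"] nth_le_iff[of h i] S \<open>\<not> f j \<le> ys ! (h - 1)\<close> lu by auto
  qed
  moreover have "cell_median D S q = (f l + f u) / 2"
    using S lu by (simp add: cell_median_def order_stat_def ys_def f_def)
  ultimately show ?thesis
    using lu less uL cL unfolding f_def
    by (intro exI[of _ L] exI[of _ l] exI[of _ u]) (auto simp: L_def f_def)
qed

text \<open>One step of the tree as \<open>x\<close> sees it, a function of the set of observations
  alone and not of the cell.\<close>

definition half_obs :: "training_set \<Rightarrow> (nat \<Rightarrow> real) \<Rightarrow> nat \<Rightarrow> nat set \<Rightarrow> nat set" where
  "half_obs D x q S = {i\<in>S. cell_median D S q < fst (D i) q \<longleftrightarrow> cell_median D S q < x q}"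

text \<open>The midpoint median lies strictly between the two halves, and the quantified condition
  of \<open>mate\<close> is tight at the largest lower and the smallest upper point, where it
  compares \<open>x\<close> with this midpoint. The half \<open>L\<close> is unique: two different
  ones of equal size would order a pair of points both ways.\<close>

lemma half_obs_mate:
  assumes S: "finite S" "card S = 2 * h" "h \<ge> 1" and inj: "inj_on (\<lambda>i. fst (D i) q) S"
  shows "card (half_obs D x q S) = h"
    "mate (\<lambda>i. fst (D i)) i x (q # qs) S \<longleftrightarrow> mate (\<lambda>i. fst (D i)) i x qs (half_obs D x q S)"
proof -
  let ?X = "\<lambda>i. fst (D i) q"
  obtain L l u where L: "L \<subseteq> S" "card L = h" "l \<in> L" "u \<in> S - L" "\<And>j. j \<in> L \<Longrightarrow> ?X j \<le> ?X l"
    "\<And>j. j \<in> S - L \<Longrightarrow> ?X u \<le> ?X j" "?X l < ?X u" and m: "cell_median D S q = (?X l + ?X u) / 2"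
    using cell_median_split[OF assms] by blast
  have fin: "finite L" using L(1) S(1) finite_subset by blast
  have lo: "?X j \<le> cell_median D S q" if "j \<in> L" for j using L(5)[OF that] L(7) m by simp
  have hi: "cell_median D S q < ?X j" if "j \<in> S - L" for j using L(6)[OF that] L(7) m by simp
  have half: "half_obs D x q S = (if x q \<le> cell_median D S q then L else S - L)"
    using lo hi L(1) by (auto simp: half_obs_def) (meson leD)+
  then show "card (half_obs D x q S) = h"
    using L S fin by (auto simp: card_Diff_subset)
  have cond: "(\<forall>j'\<in>S - L. \<exists>j\<in>L. 2 * x q \<le> ?X j + ?X j') \<longleftrightarrow> x q \<le> cell_median D S q"
  proof
    assume "\<forall>j'\<in>S - L. \<exists>j\<in>L. 2 * x q \<le> ?X j + ?X j'"
    then obtain j where "j \<in> L" "2 * x q \<le> ?X j + ?X u" using L(4) by blast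
    then show "x q \<le> cell_median D S q" using L(5)[of j] m by simp
  next
    assume x: "x q \<le> cell_median D S q"
    show "\<forall>j'\<in>S - L. \<exists>j\<in>L. 2 * x q \<le> ?X j + ?X j'"
    proof
      fix j' assume "j' \<in> S - L"
      then have "2 * x q \<le> ?X l + ?X j'" using x m L(6)[of j'] by simp
      then show "\<exists>j\<in>L. 2 * x q \<le> ?X j + ?X j'" using L(3) by blast
    qed
  qed
  have uniq: "L' = L" if L': "L' \<subseteq> S" "2 * card L' = card S" "\<forall>j\<in>L'. \<forall>j'\<in>S - L'. ?X j < ?X j'" for L'
  proof -
    have c: "card L' = card L" using L' L S by simp
    have fin': "finite L'" using L' S finite_subset by blast
    show ?thesis
    proof (rule ccontr)
      assume ne: "L' \<noteq> L"
      have "\<not> L' \<subseteq> L" using ne c card_subset_eq[OF fin] by blast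
      moreover have "\<not> L \<subseteq> L'" using ne c card_subset_eq[OF fin'] by metis
      ultimately obtain j j' where "j \<in> L'" "j \<notin> L" "j' \<in> L" "j' \<notin> L'" by blast
      then have "?X j < ?X j'" "?X j' < ?X j"
        using L' L(1) lo[of j'] hi[of j] by (blast, force)
      then show False by simp
    qed
  qed
  have ok: "L \<in> Pow S" "2 * card L = card S" "\<forall>j\<in>L. \<forall>j'\<in>S - L. ?X j < ?X j'"
    using L(1,2) S lo hi by (auto intro: le_less_trans)
  have "mate (\<lambda>i. fst (D i)) i x (q # qs) S \<longleftrightarrow>
     (if \<forall>j'\<in>S - L. \<exists>j\<in>L. 2 * x q \<le> ?X j + ?X j' then mate (\<lambda>i. fst (D i)) i x qs L else mate (\<lambda>i. fst (D i)) i x qs (S - L))"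
    unfolding mate.simps using uniq ok by blast
  then show "mate (\<lambda>i. fst (D i)) i x (q # qs) S \<longleftrightarrow> mate (\<lambda>i. fst (D i)) i x qs (half_obs D x q S)"
    unfolding cond half by simp
qed

lemma half_obs_subset: "half_obs D x q S \<subseteq> S"
  by (auto simp: half_obs_def)

lemma mate_fold:
  assumes "finite S" "card S = 2 ^ length qs" "set qs \<subseteq> {..<d}" "\<forall>q<d. inj_on (\<lambda>i. fst (D i) q) S"
  shows "card (fold (half_obs D x) qs S) = 1 \<and> (\<forall>i. mate (\<lambda>i. fst (D i)) i x qs S \<longleftrightarrow> i \<in> fold (half_obs D x) qs S)"
  using assms
proof (induction qs arbitrary: S)
  case (Cons q qs)
  have c: "card S = 2 * 2 ^ length qs" using Cons.prems by simp
  have inj: "inj_on (\<lambda>i. fst (D i) q) S" using Cons.prems by auto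
  have "(1::nat) \<le> 2 ^ length qs" by simp
  note H = half_obs_mate[OF Cons.prems(1) c this inj]
  have "card (fold (half_obs D x) qs (half_obs D x q S)) = 1 \<and>
      (\<forall>i. mate (\<lambda>i. fst (D i)) i x qs (half_obs D x q S) \<longleftrightarrow> i \<in> fold (half_obs D x) qs (half_obs D x q S))"
  proof (rule Cons.IH)
    show "finite (half_obs D x q S)" by (rule finite_subset[OF half_obs_subset Cons.prems(1)])
    show "\<forall>q'<d. inj_on (\<lambda>i. fst (D i) q') (half_obs D x q S)"
      using Cons.prems(4) inj_on_subset[OF _ half_obs_subset] by blast
  qed (use Cons.prems H in auto)
  then show ?case using H(2) by simp
qed auto

section \<open>The path of a fixed query point through the tree\<close>

context
  fixes d k :: nat and D :: training_set and x :: "nat \<Rightarrow> real"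
begin

text \<open>As in \<^const>\<open>cell\<close>, the last move comes first in \<open>rs\<close>.\<close>

definition path_obs :: "nat list \<Rightarrow> nat set" where
  "path_obs rs = foldr (half_obs D x) rs {..<2 ^ k}"

text \<open>The address of the cell of \<open>x\<close> after the splits \<open>rs\<close>, computed
  without \<open>\<theta>\<close>; so \<open>follows \<theta> rs\<close> prescribes
  \<open>\<theta>\<close> at fixed addresses.\<close>

primrec path_addr :: "nat list \<Rightarrow> bool list" where
  "path_addr [] = []"
| "path_addr (q # rs) = (cell_median D (path_obs rs) q < x q) # path_addr rs"

primrec follows :: "split_directions \<Rightarrow> nat list \<Rightarrow> bool" where
  "follows \<theta> [] = True"
| "follows \<theta> (q # rs) = (follows \<theta> rs \<and> \<theta> (path_addr rs) = q)"

primrec path_dirs :: "split_directions \<Rightarrow> nat \<Rightarrow> nat list" where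
  "path_dirs \<theta> 0 = []"
| "path_dirs \<theta> (Suc j) = \<theta> (path_addr (path_dirs \<theta> j)) # path_dirs \<theta> j"

lemma length_path_addr [simp]: "length (path_addr rs) = length rs"
  by (induction rs) auto

lemma follows_iff: "follows \<theta> rs \<longleftrightarrow> rs = path_dirs \<theta> (length rs)"
  by (induction rs) auto

lemma length_path_dirs [simp]: "length (path_dirs \<theta> j) = j"
  by (induction j) auto

context
  assumes x: "x \<in> cube d" and X: "\<forall>i<2 ^ k. fst (D i) \<in> cube d"
    and inj: "\<forall>q<d. inj_on (\<lambda>i. fst (D i) q) {..<2 ^ k}"
begin

lemma cell_path:
  "follows \<theta> rs \<Longrightarrow> x \<in> cell d (2 ^ k) D \<theta> (path_addr rs) \<and>
    observations (2 ^ k) D (cell d (2 ^ k) D \<theta> (path_addr rs)) = path_obs rs"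
proof (induction rs)
  case Nil
  then show ?case using x X by (auto simp: observations_def path_obs_def)
next
  case (Cons q rs)
  then have IH: "x \<in> cell d (2 ^ k) D \<theta> (path_addr rs)"
    "observations (2 ^ k) D (cell d (2 ^ k) D \<theta> (path_addr rs)) = path_obs rs" and q: "\<theta> (path_addr rs) = q" by auto
  have "path_obs (q # rs) = half_obs D x q (path_obs rs)" by (simp add: path_obs_def)
  moreover have "observations (2 ^ k) D (cell d (2 ^ k) D \<theta> (path_addr (q # rs))) = half_obs D x q (path_obs rs)"
    by (auto simp: Let_def q IH(2) half_obs_def) (auto simp: IH(2)[symmetric] observations_def)
  ultimately show ?case using IH(1) by (auto simp: Let_def q IH(2))
qed

lemma card_path_obs: "set rs \<subseteq> {..<d} \<Longrightarrow> length rs \<le> k \<Longrightarrow> card (path_obs rs) = 2 ^ (k - length rs) \<and> path_obs rs \<subseteq> {..<2 ^ k}"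
proof (induction rs)
  case Nil
  then show ?case by (simp add: path_obs_def)
next
  case (Cons q rs)
  then have IH: "card (path_obs rs) = 2 ^ (k - length rs)" "path_obs rs \<subseteq> {..<2 ^ k}" by auto
  have "path_obs (q # rs) = half_obs D x q (path_obs rs)" by (simp add: path_obs_def)
  moreover have "card (path_obs rs) = 2 * 2 ^ (k - length (q # rs))"
    unfolding IH(1) power_Suc[symmetric] using Cons.prems by (simp add: Suc_diff_Suc)
  moreover have "inj_on (\<lambda>i. fst (D i) q) (path_obs rs)"
    using inj Cons.prems IH(2) by (auto intro: inj_on_subset)
  moreover have "finite (path_obs rs)" using IH(2) finite_subset by blast
  ultimately show ?case
    using half_obs_mate(1)[of "path_obs rs" "2 ^ (k - length (q # rs))" D q x] half_obs_subset[of D x q "path_obs rs"] IH(2)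
    by auto
qed

text \<open>The two children of a cell are disjoint, so every cell containing \<open>x\<close>,
  whatever its address, lies on the path of \<open>x\<close>.\<close>

lemma path_of_cell:
  "x \<in> cell d (2 ^ k) D \<theta> p \<Longrightarrow> path_addr (path_dirs \<theta> (length p)) = p"
proof (induction p)
  case (Cons b p)
  then have IH: "path_addr (path_dirs \<theta> (length p)) = p" by (auto simp: Let_def)
  have "observations (2 ^ k) D (cell d (2 ^ k) D \<theta> p) = path_obs (path_dirs \<theta> (length p))"
    using cell_path[of \<theta> "path_dirs \<theta> (length p)"] by (simp add: follows_iff IH)
  then show ?case using Cons.prems by (auto simp: Let_def IH split: if_splits)
qed simp

context
  fixes \<theta> :: split_directions
  assumes \<theta>: "\<And>p. \<theta> p < d"
begin

lemma set_path_dirs: "set (path_dirs \<theta> j) \<subseteq> {..<d}"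
  using \<theta> by (induction j) auto

lemma cell_path_dirs:
  "x \<in> cell d (2 ^ k) D \<theta> (path_addr (path_dirs \<theta> j))"
  "observations (2 ^ k) D (cell d (2 ^ k) D \<theta> (path_addr (path_dirs \<theta> j))) = path_obs (path_dirs \<theta> j)"
  using cell_path[of \<theta> "path_dirs \<theta> j"] by (simp_all add: follows_iff)

lemma card_path_obs_dirs: "j \<le> k \<Longrightarrow> card (path_obs (path_dirs \<theta> j)) = 2 ^ (k - j)"
  using card_path_obs[of "path_dirs \<theta> j"] set_path_dirs by simp

lemma is_node_path_dirs: "j \<le> k \<Longrightarrow> is_node d (2 ^ k) D \<theta> (path_addr (path_dirs \<theta> j))"
proof (induction j)
  case (Suc j)
  moreover have "(1::nat) < 2 ^ (k - j)" using Suc.prems by (intro one_less_power) auto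
  ultimately show ?case using card_path_obs_dirs[of j] cell_path_dirs(2)[of j] by simp
qed simp

lemma node_depth_le: "is_node d (2 ^ k) D \<theta> p \<Longrightarrow> x \<in> cell d (2 ^ k) D \<theta> p \<Longrightarrow> length p \<le> k"
proof (induction p)
  case (Cons b p)
  then have x': "x \<in> cell d (2 ^ k) D \<theta> p" and node: "is_node d (2 ^ k) D \<theta> p"
    "card (observations (2 ^ k) D (cell d (2 ^ k) D \<theta> p)) > 1" by (auto simp: Let_def)
  have le: "length p \<le> k" using Cons.IH node x' by blast
  then have "card (observations (2 ^ k) D (cell d (2 ^ k) D \<theta> p)) = 2 ^ (k - length p)"
    using card_path_obs_dirs[OF le] cell_path_dirs(2)[of "length p"] path_of_cell[OF x'] by simp
  then have "length p \<noteq> k" using node by auto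
  then show ?case using le by simp
qed simp

text \<open>A leaf containing \<open>x\<close> lies on the path of \<open>x\<close>, where the cell
  at depth \<open>j\<close> holds \<open>2 ^ (k - j)\<close> observations; having at most one forces
  depth \<open>k\<close>.\<close>

lemma leaf_cell_eq: "leaf_cell d (2 ^ k) D \<theta> x = cell d (2 ^ k) D \<theta> (path_addr (path_dirs \<theta> k))"
proof -
  let ?A = "cell d (2 ^ k) D \<theta> (path_addr (path_dirs \<theta> k))"
  have "?A \<in> leaves d (2 ^ k) D \<theta>"
    unfolding leaves_def using is_node_path_dirs[of k] card_path_obs_dirs[of k] cell_path_dirs(2)[of k] by auto
  moreover have "A = ?A" if A: "A \<in> leaves d (2 ^ k) D \<theta>" "x \<in> A" for A
  proof -
    obtain p where p: "A = cell d (2 ^ k) D \<theta> p" "is_node d (2 ^ k) D \<theta> p"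
      "card (observations (2 ^ k) D (cell d (2 ^ k) D \<theta> p)) \<le> 1" using A(1) by (auto simp: leaves_def)
    have le: "length p \<le> k" using node_depth_le p A by blast
    have pd: "path_addr (path_dirs \<theta> (length p)) = p" using path_of_cell p A by blast
    have "card (observations (2 ^ k) D (cell d (2 ^ k) D \<theta> p)) = 2 ^ (k - length p)"
      using card_path_obs_dirs[OF le] cell_path_dirs(2)[of "length p"] pd by simp
    then have "length p = k" using p(3) le one_less_power[of "2::nat" "k - length p"] by fastforce
    then show ?thesis using p pd by simp
  qed
  ultimately have "{A \<in> leaves d (2 ^ k) D \<theta>. x \<in> A} = {?A}"
    using cell_path_dirs(1)[of k] by blast
  then show ?thesis by (simp add: leaf_cell_def)
qed

lemma tree_prediction_eq:
  "tree_prediction d (2 ^ k) D \<theta> x = (\<Sum>i<2 ^ k. of_bool (mate (\<lambda>i. fst (D i)) i x (rev (path_dirs \<theta> k)) {..<2 ^ k}) * snd (D i))"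
proof -
  let ?A = "cell d (2 ^ k) D \<theta> (path_addr (path_dirs \<theta> k))"
  have c: "card (observations (2 ^ k) D ?A) = 1"
    using card_path_obs_dirs[of k] cell_path_dirs(2)[of k] by simp
  have m: "mate (\<lambda>i. fst (D i)) i x (rev (path_dirs \<theta> k)) {..<2 ^ k} \<longleftrightarrow> i \<in> path_obs (path_dirs \<theta> k)" for i
    using mate_fold[of "{..<2 ^ k}" "rev (path_dirs \<theta> k)" d D x] inj set_path_dirs
    by (auto simp: path_obs_def foldr_conv_fold)
  have "fst (D i) \<in> ?A \<longleftrightarrow> i \<in> path_obs (path_dirs \<theta> k)" if "i < 2 ^ k" for i
    using cell_path_dirs(2)[of k] that by (auto simp: observations_def)
  then have "(\<Sum>i<2 ^ k. indicator ?A (fst (D i)) * snd (D i)) =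
     (\<Sum>i<2 ^ k. of_bool (mate (\<lambda>i. fst (D i)) i x (rev (path_dirs \<theta> k)) {..<2 ^ k}) * snd (D i))"
    by (intro sum.cong refl) (auto simp: m indicator_def)
  then show ?thesis
    unfolding tree_prediction_def leaf_cell_eq Let_def c by simp
qed

end

end

text \<open>The addresses met along \<open>rs\<close> have pairwise different lengths, so
  \<open>follows\<close> fixes as many distinct coordinates of \<open>\<theta>\<close> as
  \<open>rs\<close> has entries. These are independent under \<open>direction_law\<close>.\<close>

lemma follows_cylinder:
  "set rs \<subseteq> {..<d} \<Longrightarrow> \<exists>J c. finite J \<and> card J = length rs \<and> (\<forall>p\<in>J. length p < length rs \<and> c p < d) \<and>
     (\<forall>\<theta>. follows \<theta> rs \<longleftrightarrow> (\<forall>p\<in>J. \<theta> p \<in> {c p}))"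
proof (induction rs)
  case Nil
  then show ?case by (intro exI[of _ "{}"]) auto
next
  case (Cons q rs)
  then obtain J c where J: "finite J" "card J = length rs" "\<forall>p\<in>J. length p < length rs \<and> c p < d"
    "\<forall>\<theta>. follows \<theta> rs \<longleftrightarrow> (\<forall>p\<in>J. \<theta> p \<in> {c p})" by auto
  have n: "path_addr rs \<notin> J" using J(3) length_path_addr by fastforce
  show ?case
    using J n Cons.prems
    by (intro exI[of _ "insert (path_addr rs) J"] exI[of _ "c(path_addr rs := q)"]) auto
qed

lemma prob_follows:
  assumes "d \<ge> 1" "set rs \<subseteq> {..<d}"
  shows "{\<theta>\<in>space (direction_law d). follows \<theta> rs} \<in> sets (direction_law d)"
    "measure (direction_law d) {\<theta>\<in>space (direction_law d). follows \<theta> rs} = (1 / real d) ^ length rs"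
proof -
  interpret product_prob_space "\<lambda>_::bool list. uniform_count_measure {..<d}" UNIV
    using assms(1) by (intro product_prob_spaceI prob_space_uniform_count_measure) (auto simp: lessThan_empty_iff)
  obtain J c where J: "finite J" "card J = length rs" "\<forall>p\<in>J. length p < length rs \<and> c p < d"
    "\<forall>\<theta>. follows \<theta> rs \<longleftrightarrow> (\<forall>p\<in>J. \<theta> p \<in> {c p})" using follows_cylinder[OF assms(2)] by blast
  have "emeasure (direction_law d) {\<theta>\<in>space (direction_law d). \<forall>p\<in>J. \<theta> p \<in> {c p}} =
     (\<Prod>p\<in>J. emeasure (uniform_count_measure {..<d}) {c p})"
    unfolding direction_law_def using J by (intro emeasure_PiM_Collect) (auto simp: sets_uniform_count_measure)
  also have "\<dots> = (\<Prod>p\<in>J. ennreal (1 / real d))"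
    using J(3) by (intro prod.cong refl) (auto simp: emeasure_uniform_count_measure)
  also have "\<dots> = ennreal ((1 / real d) ^ length rs)"
    by (simp add: J(2) ennreal_power)
  finally show "measure (direction_law d) {\<theta>\<in>space (direction_law d). follows \<theta> rs} = (1 / real d) ^ length rs"
    using J(4) by (simp add: measure_def)
  have "{\<theta>\<in>space (direction_law d). \<forall>p\<in>J. \<theta> p \<in> {c p}} \<in> sets (direction_law d)"
    unfolding direction_law_def using J by (intro sets.sets_Collect_finite_All sets_Collect_single) (auto simp: sets_uniform_count_measure)
  then show "{\<theta>\<in>space (direction_law d). follows \<theta> rs} \<in> sets (direction_law d)"
    using J(4) by simp
qed

end

section \<open>The forest as a weighted mean of the responses\<close>

definition dir_lists :: "nat \<Rightarrow> nat \<Rightarrow> nat list set" where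
  "dir_lists d k = {qs. set qs \<subseteq> {..<d} \<and> length qs = k}"

text \<open>A function of the inputs alone, which lets the noise be integrated with the weights held
  fixed.\<close>

definition forest_weight :: "nat \<Rightarrow> nat \<Rightarrow> (nat \<Rightarrow> nat \<Rightarrow> real) \<Rightarrow> (nat \<Rightarrow> real) \<Rightarrow> nat \<Rightarrow> real" where
  "forest_weight d k X x i = (\<Sum>qs\<in>dir_lists d k. of_bool (mate X i x qs {..<2 ^ k})) / real d ^ k"

lemma finite_dir_lists [simp]: "finite (dir_lists d k)"
  unfolding dir_lists_def by (rule finite_lists_length_eq) simp

lemma card_dir_lists: "card (dir_lists d k) = d ^ k"
  unfolding dir_lists_def by (simp add: card_lists_length_eq)

lemma sum_forest_weight:
  fixes D :: training_set
  assumes "d \<ge> 1" "\<forall>q<d. inj_on (\<lambda>i. fst (D i) q) {..<2 ^ k}"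
  shows "(\<Sum>i<2 ^ k. forest_weight d k (\<lambda>i. fst (D i)) x i) = 1"
proof -
  have one: "(\<Sum>i<2 ^ k. of_bool (mate (\<lambda>i. fst (D i)) i x qs {..<2 ^ k})) = (1::real)" if "qs \<in> dir_lists d k" for qs
  proof -
    let ?F = "fold (half_obs D x) qs {..<2 ^ k}"
    have F: "card ?F = 1" "\<And>i. mate (\<lambda>i. fst (D i)) i x qs {..<2 ^ k} \<longleftrightarrow> i \<in> ?F"
      using mate_fold[of "{..<2 ^ k}" qs d D x] assms(2) that by (auto simp: dir_lists_def)
    have "?F \<subseteq> {..<2 ^ k}" using F(2) mate_imp_mem by blast
    then show ?thesis using F by (simp add: of_bool_def sum.If_cases Int_absorb1)
  qed
  have "(\<Sum>i<2 ^ k. forest_weight d k (\<lambda>i. fst (D i)) x i) =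
      (\<Sum>qs\<in>dir_lists d k. \<Sum>i<2 ^ k. of_bool (mate (\<lambda>i. fst (D i)) i x qs {..<2 ^ k})) / real d ^ k"
    unfolding forest_weight_def sum_divide_distrib[symmetric] by (subst sum.swap) simp
  also have "\<dots> = (\<Sum>qs\<in>dir_lists d k. 1) / real d ^ k"
    by (intro arg_cong2[where f="(/)"] sum.cong refl one)
  also have "\<dots> = 1" using assms(1) by (simp add: card_dir_lists)
  finally show ?thesis .
qed

text \<open>A given \<open>\<theta>\<close> follows exactly one list of length \<open>k\<close>, and
  all lists are equally likely, so the expectation is a finite average. \<open>rev\<close> mediates
  between \<open>path_dirs\<close>, with the last split first, and \<open>mate\<close>, with the
  root first.\<close>

lemma median_forest_eq:
  assumes "d \<ge> 1" "x \<in> cube d" "\<forall>i<2 ^ k. fst (D i) \<in> cube d" "\<forall>q<d. inj_on (\<lambda>i. fst (D i) q) {..<2 ^ k}"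
  shows "median_forest d (2 ^ k) D x = (\<Sum>i<2 ^ k. forest_weight d k (\<lambda>i. fst (D i)) x i * snd (D i))"
proof -
  interpret product_prob_space "\<lambda>_::bool list. uniform_count_measure {..<d}" UNIV
    using assms(1) by (intro product_prob_spaceI prob_space_uniform_count_measure) (auto simp: lessThan_empty_iff)
  let ?Y = "\<lambda>qs. \<Sum>i<2 ^ k. of_bool (mate (\<lambda>i. fst (D i)) i x qs {..<2 ^ k}) * snd (D i)"
  let ?E = "\<lambda>rs. {\<theta>\<in>space (direction_law d). follows k D x \<theta> rs}"
  have E: "?E rs \<in> sets (direction_law d)" "measure (direction_law d) (?E rs) = (1 / real d) ^ k"
    if "rs \<in> dir_lists d k" for rs
    using that prob_follows[OF assms(1), of rs k D x] by (auto simp: dir_lists_def)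
  have "median_forest d (2 ^ k) D x = (\<integral>\<theta>. (\<Sum>rs\<in>dir_lists d k. indicator (?E rs) \<theta> * ?Y (rev rs)) \<partial>direction_law d)"
    unfolding median_forest_def
  proof (rule Bochner_Integration.integral_cong[OF refl])
    fix \<theta> assume \<theta>s: "\<theta> \<in> space (direction_law d)"
    then have \<theta>: "\<theta> p < d" for p by (auto simp: direction_law_def space_PiM space_uniform_count_measure)
    have "(\<Sum>rs\<in>dir_lists d k. indicator (?E rs) \<theta> * ?Y (rev rs)) =
       (\<Sum>rs\<in>dir_lists d k. if rs = path_dirs k D x \<theta> k then ?Y (rev rs) else 0)"
      using \<theta>s by (intro sum.cong refl) (auto simp: follows_iff dir_lists_def indicator_def)
    also have "\<dots> = ?Y (rev (path_dirs k D x \<theta> k))"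
    proof -
      have "set (path_dirs k D x \<theta> k) \<subseteq> {..<d}" by (rule set_path_dirs[OF assms(2-4)]) (rule \<theta>)
      then have "path_dirs k D x \<theta> k \<in> dir_lists d k" by (simp add: dir_lists_def)
      then show ?thesis unfolding sum.delta[OF finite_dir_lists] by (rule if_P)
    qed
    finally show "tree_prediction d (2 ^ k) D \<theta> x = (\<Sum>rs\<in>dir_lists d k. indicator (?E rs) \<theta> * ?Y (rev rs))"
      using tree_prediction_eq[OF assms(2-4), where \<theta> = \<theta>, OF \<theta>] by (simp only:)
  qed
  also have "\<dots> = (\<Sum>rs\<in>dir_lists d k. \<integral>\<theta>. indicator (?E rs) \<theta> * ?Y (rev rs) \<partial>direction_law d)"
    using E(1) unfolding direction_law_def
    by (intro Bochner_Integration.integral_sum integrable_mult_left integrable_real_indicator) (auto simp: less_top[symmetric] emeasure_finite)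
  also have "\<dots> = (\<Sum>rs\<in>dir_lists d k. (1 / real d) ^ k * ?Y (rev rs))"
    using E sets.sets_into_space[OF E(1)] by (intro sum.cong refl) (simp add: Int_absorb1)
  also have "\<dots> = (\<Sum>qs\<in>dir_lists d k. (1 / real d) ^ k * ?Y qs)"
    by (rule sum.reindex_bij_witness[of _ rev rev]) (auto simp: dir_lists_def)
  also have "\<dots> = (\<Sum>i<2 ^ k. forest_weight d k (\<lambda>i. fst (D i)) x i * snd (D i))"
    unfolding forest_weight_def sum_distrib_left sum_distrib_right sum_divide_distrib
    by (subst sum.swap) (simp add: power_divide)
  finally show ?thesis .
qed

section \<open>Collisions of multinomial counts\<close>

lemma dir_lists_Suc: "dir_lists d (Suc k) = (\<lambda>(q, qs). q # qs) ` ({..<d} \<times> dir_lists d k)"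
  by (auto simp: dir_lists_def image_iff length_Suc_conv)

lemma sum_dir_lists_prod:
  fixes g :: "nat \<Rightarrow> real"
  shows "(\<Sum>qs\<in>dir_lists d k. \<Prod>q\<leftarrow>qs. g q) = (\<Sum>l<d. g l) ^ k"
proof (induction k)
  case 0
  have "dir_lists d 0 = {[]}" by (auto simp: dir_lists_def)
  then show ?case by simp
next
  case (Suc k)
  have "(\<Sum>qs\<in>dir_lists d (Suc k). \<Prod>q\<leftarrow>qs. g q) = (\<Sum>(q, qs)\<in>{..<d} \<times> dir_lists d k. g q * (\<Prod>q\<leftarrow>qs. g q))"
    unfolding dir_lists_Suc by (subst sum.reindex) (auto simp: inj_on_def case_prod_unfold)
  also have "\<dots> = (\<Sum>l<d. g l) * (\<Sum>qs\<in>dir_lists d k. \<Prod>q\<leftarrow>qs. g q)"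
    by (simp add: sum_product sum.cartesian_product)
  finally show ?case by (simp add: Suc)
qed

lemma sum_count_list_dirs: "qs \<in> dir_lists d k \<Longrightarrow> (\<Sum>l<d. count_list qs l) = k"
  using sum_count_set[of qs "{..<d}"] by (simp add: dir_lists_def)

lemma prod_list_eq_prod_count:
  fixes g :: "nat \<Rightarrow> 'a :: comm_monoid_mult"
  assumes "set qs \<subseteq> {..<d}"
  shows "(\<Prod>q\<leftarrow>qs. g q) = (\<Prod>l<d. g l ^ count_list qs l)"
  using assms
proof (induction qs)
  case (Cons q qs)
  have "(\<Prod>l<d. g l ^ count_list (q # qs) l) = (\<Prod>l<d. (if l = q then g l else 1) * g l ^ count_list qs l)"
    by (intro prod.cong) auto
  also have "\<dots> = g q * (\<Prod>l<d. g l ^ count_list qs l)"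
    using Cons.prems by (simp add: prod.distrib prod.delta)
  finally show ?case using Cons by simp
qed simp

lemma fact_mult_prod: "fact (n + d) = fact n * (\<Prod>i=1..d. real (n + i))"
  by (induction d) (simp_all add: algebra_simps)

text \<open>From \<open>K\<close> to \<open>K + 1\<close> the ratio \<open>fact K / m ^ K\<close>
  changes by the factor \<open>(K + 1) / m\<close>, which is at most 1 while \<open>K < m\<close>
  and at least 1 from then on; so the ratio is smallest at \<open>K = m\<close>.\<close>

lemma fact_tangent:
  assumes "m \<ge> 1"
  shows "fact m * real m ^ K \<le> fact K * real m ^ m"
proof (cases "m \<le> K")
  case True
  then show ?thesis
  proof (induction K rule: dec_induct)
    case (step K)
    have "fact m * real m ^ Suc K = (fact m * real m ^ K) * real m" by simp
    also have "\<dots> \<le> (fact K * real m ^ m) * real (Suc K)"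
      using step by (intro mult_mono[of "fact m * real m ^ K"]) auto
    finally show ?case by (simp add: mult_ac)
  qed simp
next
  case False
  then have "K \<le> m" by simp
  then show ?thesis
  proof (induction K rule: inc_induct)
    case (step K)
    have "(fact m * real m ^ K) * real m \<le> fact (Suc K) * real m ^ m" using step by (simp add: mult_ac)
    also have "\<dots> \<le> (fact K * real m ^ m) * real m"
      using step by (auto simp: mult_ac intro!: mult_left_mono simp del: of_nat_Suc)
    finally show ?case using assms by simp
  qed simp
qed

text \<open>
  Passing from \<open>m\<close> to \<open>m + 1\<close> multiplies the ratio of the two sides without the last factor by the product
  of \<open>1 - (d - i) / (d (m + 1))\<close> over \<open>i \<le> d\<close>, so no Stirling formula is needed.
\<close>

lemma fact_mult_le:
  assumes "d \<ge> 1"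
  shows "fact (d * m) \<le> fact m ^ d * real d ^ (d * m) * real (m + 1) powr (- ((real d - 1) / 2))"
proof (induction m)
  case (Suc m)
  define D where "D = real d * (m + 1)"
  have D: "D > 0" using assms by (simp add: D_def)
  have "(\<Prod>i=1..d. real (d * m + i)) \<le> (\<Prod>i=1..d. D * exp (- (real (d - i) / D)))"
  proof (intro prod_mono conjI)
    fix i assume i: "i \<in> {1..d}"
    have "real (d * m + i) = D * (1 + (- (real (d - i) / D)))"
      using i D by (simp add: field_simps D_def of_nat_diff)
    also have "\<dots> \<le> D * exp (- (real (d - i) / D))"
      using D by (intro mult_left_mono exp_ge_add_one_self) auto
    finally show "real (d * m + i) \<le> D * exp (- (real (d - i) / D))" .
  qed simp
  also have "\<dots> = D ^ d * exp (- ((\<Sum>i=1..d. real (d - i)) / D))"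
    by (simp add: prod.distrib exp_sum[symmetric] sum_negf sum_divide_distrib)
  also have "(\<Sum>i=1..d. real (d - i)) = real d * (real d - 1) / 2"
  proof -
    have "(\<Sum>i=1..d. real (d - i)) = (\<Sum>i<d. real i)"
      by (rule sum.reindex_bij_witness[of _ "\<lambda>i. d - i" "\<lambda>i. d - i"]) auto
    also have "\<dots> = real d * (real d - 1) / 2"
      by (induction d) (simp_all add: field_simps)
    finally show ?thesis .
  qed
  also have "real d * (real d - 1) / 2 / D = (real d - 1) / 2 * (1 / real (m + 1))"
  proof -
    have "x * y / 2 / (x * z) = y / 2 * (1 / z)" if "x \<noteq> 0" for x y z :: real using that by simp
    then show ?thesis unfolding D_def using assms by simp
  qed
  \<comment> \<open>\<open>ln (1 + u) \<le> u\<close> at \<open>u = 1 / (m + 1)\<close> turns the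
    exponential into a ratio of powers, which telescopes along the induction.\<close>
  also have "exp (- ((real d - 1) / 2 * (1 / real (m + 1)))) \<le> (real (m + 2) / real (m + 1)) powr (- ((real d - 1) / 2))"
  proof -
    have "ln (real (m + 2) / real (m + 1)) \<le> real (m + 2) / real (m + 1) - 1"
      by (intro ln_le_minus_one) simp
    also have "\<dots> = 1 / real (m + 1)" by (simp add: field_simps)
    finally have "(real d - 1) / 2 * ln (real (m + 2) / real (m + 1)) \<le> (real d - 1) / 2 * (1 / real (m + 1))"
      using assms by (intro mult_left_mono) auto
    then show ?thesis by (simp add: powr_def)
  qed
  finally have P: "(\<Prod>i=1..d. real (d * m + i)) \<le> D ^ d * (real (m + 2) / real (m + 1)) powr (- ((real d - 1) / 2))"
    using D by (simp add: mult_left_mono)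
  have "fact (d * Suc m) = fact (d * m) * (\<Prod>i=1..d. real (d * m + i))"
    using fact_mult_prod[of "d * m" d] by (simp add: add.commute)
  also have "\<dots> \<le> (fact m ^ d * real d ^ (d * m) * real (m + 1) powr (- ((real d - 1) / 2))) *
      (D ^ d * (real (m + 2) / real (m + 1)) powr (- ((real d - 1) / 2)))"
    by (intro mult_mono Suc P prod_nonneg) auto
  also have "\<dots> = (fact m * real (m + 1)) ^ d * (real d ^ (d * m) * real d ^ d) *
      (real (m + 1) powr (- ((real d - 1) / 2)) * (real (m + 2) / real (m + 1)) powr (- ((real d - 1) / 2)))"
    by (simp only: D_def power_mult_distrib mult_ac)
  also have "real (m + 1) powr (- ((real d - 1) / 2)) * (real (m + 2) / real (m + 1)) powr (- ((real d - 1) / 2))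
      = real (m + 2) powr (- ((real d - 1) / 2))"
    by (subst powr_mult[symmetric]) simp_all
  also have "fact m * real (m + 1) = fact (Suc m)" by simp
  also have "real d ^ (d * m) * real d ^ d = real d ^ (d * Suc m)"
    by (simp add: power_add[symmetric] add.commute)
  finally show ?case by simp
qed simp

text \<open>The order of the largest multinomial probability. \<open>k div d\<close> is the balanced
  count, and the \<open>+ 1\<close> keeps the base positive when \<open>k < d\<close>.\<close>

abbreviation decay :: "nat \<Rightarrow> nat \<Rightarrow> real" where
  "decay d k \<equiv> real (k div d + 1) powr (- ((real d - 1) / 2))"

text \<open>Up to a constant, the balanced counts \<open>\<kappa> l = k div d\<close> maximise the multinomial coefficient.\<close>

lemma card_dirs_with_counts_le:
  assumes d: "d \<ge> 1"
  shows "real (card {qs\<in>dir_lists d k. \<forall>l<d. count_list qs l = \<kappa> l})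
    \<le> real d ^ k * (2 ^ d * decay d k)"
proof -
  define m where "m = k div d"
  define r where "r = k mod d"
  define N where "N = card {qs\<in>dir_lists d k. \<forall>l<d. count_list qs l = \<kappa> l}"
  define \<beta> where "\<beta> = real (m + 1) powr (- ((real d - 1) / 2))"
  have \<beta>0: "\<beta> \<ge> 0" by (simp add: \<beta>_def)
  have k: "k = d * m + r" and r: "r < d" using d by (auto simp: m_def r_def)
  have "real N \<le> real d ^ k * (2 ^ d * \<beta>)"
  proof (cases "m = 0")
    case True
    have "N \<le> card (dir_lists d k)" unfolding N_def by (intro card_mono) auto
    then have "real N \<le> real d ^ k * 1" by (simp add: card_dir_lists)
    also have "\<dots> \<le> real d ^ k * (2 ^ d * \<beta>)"
      using True by (intro mult_left_mono) (auto simp: \<beta>_def)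
    finally show ?thesis .
  next
    case False
    then have m: "m \<ge> 1" by simp
    show ?thesis
    proof (cases "{qs\<in>dir_lists d k. \<forall>l<d. count_list qs l = \<kappa> l} = {}")
      case True
      then have "N = 0" by (simp only: N_def card.empty)
      then show ?thesis using \<beta>0 by simp
    next
      case False
      then obtain q0 where q0: "q0 \<in> dir_lists d k" "\<And>l. l < d \<Longrightarrow> count_list q0 l = \<kappa> l" by auto
      have cnt: "count (mset qs) l = count_list qs l" for qs :: "nat list" and l
        by (induction qs) auto
      \<comment> \<open>The lists with these counts are the arrangements of one multiset, which
        brings in the multinomial coefficient.\<close>
      have eq: "{qs\<in>dir_lists d k. \<forall>l<d. count_list qs l = \<kappa> l} = permutations_of_multiset (mset q0)"
      proof (intro equalityI subsetI)
        fix qs assume qs: "qs \<in> {qs\<in>dir_lists d k. \<forall>l<d. count_list qs l = \<kappa> l}"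
        have "count (mset qs) l = count (mset q0) l" for l
        proof (cases "l < d")
          case False
          then have "l \<notin> set qs" "l \<notin> set q0" using qs q0(1) by (auto simp: dir_lists_def)
          then show ?thesis by (simp add: cnt)
        qed (use qs q0 in \<open>auto simp: cnt\<close>)
        then show "qs \<in> permutations_of_multiset (mset q0)" by (simp add: permutations_of_multiset_def multiset_eq_iff)
      next
        fix qs assume "qs \<in> permutations_of_multiset (mset q0)"
        then have mm: "mset qs = mset q0" by (simp add: permutations_of_multiset_def)
        then have "set qs = set q0" "length qs = length q0"
          using mset_eq_setD mset_eq_length by blast+
        moreover have "count_list qs l = count_list q0 l" for l using mm cnt[of qs l] cnt[of q0 l] by simp
        ultimately show "qs \<in> {qs\<in>dir_lists d k. \<forall>l<d. count_list qs l = \<kappa> l}" using q0 by (auto simp: dir_lists_def)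
      qed
      have prodeq: "(\<Prod>x\<in>set_mset (mset q0). fact (count (mset q0) x)) = (\<Prod>l<d. fact (\<kappa> l) :: nat)"
      proof -
        have "(\<Prod>x\<in>set q0. fact (count_list q0 x)) = (\<Prod>l<d. fact (count_list q0 l) :: nat)"
          using q0(1) by (intro prod.mono_neutral_left) (auto simp: dir_lists_def)
        then show ?thesis using q0(2) by (simp add: cnt)
      qed
      have "N * (\<Prod>l<d. fact (\<kappa> l)) = fact k"
        using card_permutations_of_multiset_aux[of "mset q0"] q0(1)
        unfolding N_def eq prodeq by (simp add: dir_lists_def)
      then have N: "real N * (\<Prod>l<d. fact (\<kappa> l)) = fact k"
        by (metis (mono_tags, lifting) of_nat_fact of_nat_mult of_nat_prod prod.cong)
      have sum\<kappa>: "(\<Sum>l<d. \<kappa> l) = k" using sum_count_list_dirs[OF q0(1)] q0(2) by simp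
      have m0: "real m > 0" using m by simp
      \<comment> \<open>The counts add up to \<open>d * m + r\<close>, so the \<open>d\<close>
        inequalities of \<open>fact_tangent\<close> multiply to one with the surplus power
        \<open>m ^ r\<close>.\<close>
      have "fact m ^ d * real m ^ k = (\<Prod>l<d. fact m * real m ^ \<kappa> l)"
        by (simp add: prod.distrib power_sum[symmetric] sum\<kappa>)
      also have "\<dots> \<le> (\<Prod>l<d. fact (\<kappa> l) * real m ^ m)"
        by (intro prod_mono conjI fact_tangent m) auto
      also have "\<dots> = (\<Prod>l<d. fact (\<kappa> l)) * real m ^ (d * m)"
        by (simp add: prod.distrib power_mult[symmetric] mult.commute)
      finally have "fact m ^ d * real m ^ r * real m ^ (d * m) \<le> (\<Prod>l<d. fact (\<kappa> l)) * real m ^ (d * m)"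
        by (simp add: k power_add mult_ac)
      then have F: "fact m ^ d * real m ^ r \<le> (\<Prod>l<d. fact (\<kappa> l) :: real)"
        using m0 by simp
      have "real N * (fact m ^ d * real m ^ r) \<le> fact k"
        unfolding N[symmetric] by (intro mult_left_mono F) auto
      also have "fact k = fact (d * m) * (\<Prod>i=1..r. real (d * m + i))"
        unfolding k by (rule fact_mult_prod)
      also have "\<dots> \<le> (fact m ^ d * real d ^ (d * m) * \<beta>) * (real d * (2 * m)) ^ r"
      proof (intro mult_mono)
        show "fact (d * m) \<le> fact m ^ d * real d ^ (d * m) * \<beta>" unfolding \<beta>_def by (rule fact_mult_le[OF d])
        \<comment> \<open>Each of the \<open>r < d\<close> leftover factors is at most
          \<open>2 * d * m\<close>; this is the source of \<open>2 ^ d\<close>.\<close>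
        have "(\<Prod>i=1..r. real (d * m + i)) \<le> (\<Prod>i=1..r. real d * (2 * m))"
        proof (intro prod_mono conjI)
          fix i assume "i \<in> {1..r}"
          then have "d * m + i \<le> d * m + d * 1" using r by simp
          also have "\<dots> \<le> d * m + d * m" using m by (intro add_left_mono mult_left_mono) auto
          finally show "real (d * m + i) \<le> real d * (2 * m)"
            by (metis mult_2 of_nat_le_iff of_nat_mult of_nat_numeral distrib_left)
        qed simp
        then show "(\<Prod>i=1..r. real (d * m + i)) \<le> (real d * (2 * m)) ^ r" by simp
      qed (auto intro!: mult_nonneg_nonneg \<beta>0 prod_nonneg)
      also have "\<dots> = (real d ^ k * (2 ^ r * \<beta>)) * (fact m ^ d * real m ^ r)"
        by (simp add: k power_add power_mult_distrib mult_ac)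
      finally have "real N \<le> real d ^ k * (2 ^ r * \<beta>)"
        using m0 by simp
      also have "\<dots> \<le> real d ^ k * (2 ^ d * \<beta>)"
        using r \<beta>0 by (intro mult_left_mono mult_right_mono power_increasing) auto
      finally show ?thesis .
    qed
  qed
  then show ?thesis by (simp add: N_def \<beta>_def m_def)
qed

text \<open>One of the truncated differences is zero, so the exponent is \<open>|j - c|\<close> and
  two geometric series bound the sum.\<close>

lemma sum_geometric_two_sided_le:
  fixes \<rho> :: real
  assumes "0 \<le> \<rho>" "\<rho> < 1"
  shows "(\<Sum>j\<le>k. \<rho> ^ ((j - c) + (c - j))) \<le> 2 / (1 - \<rho>)"
proof -
  have geo: "(\<Sum>i\<le>n. \<rho> ^ i) \<le> 1 / (1 - \<rho>)" for n
  proof -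
    have "(\<Sum>i\<le>n. \<rho> ^ i) \<le> (\<Sum>i. \<rho> ^ i)"
      using assms by (intro sum_le_suminf summable_geometric) auto
    then show ?thesis using assms suminf_geometric[of \<rho>] by simp
  qed
  have "(\<Sum>j\<le>k. \<rho> ^ ((j - c) + (c - j))) \<le> (\<Sum>j\<in>{c..c + k} \<union> {..c}. \<rho> ^ ((j - c) + (c - j)))"
    using assms by (intro sum_mono2) auto
  also have "\<dots> \<le> (\<Sum>j\<in>{c..c + k}. \<rho> ^ ((j - c) + (c - j))) + (\<Sum>j\<in>{..c}. \<rho> ^ ((j - c) + (c - j)))"
    using assms by (subst sum_Un) (auto intro!: sum_nonneg)
  also have "(\<Sum>j\<in>{c..c + k}. \<rho> ^ ((j - c) + (c - j))) = (\<Sum>i\<le>k. \<rho> ^ i)"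
    by (rule sum.reindex_bij_witness[of _ "\<lambda>i. i + c" "\<lambda>j. j - c"]) auto
  also have "(\<Sum>j\<in>{..c}. \<rho> ^ ((j - c) + (c - j))) = (\<Sum>i\<le>c. \<rho> ^ i)"
    by (rule sum.reindex_bij_witness[of _ "\<lambda>i. c - i" "\<lambda>j. c - j"]) auto
  also have "(\<Sum>i\<le>k. \<rho> ^ i) + (\<Sum>i\<le>c. \<rho> ^ i) \<le> 1 / (1 - \<rho>) + 1 / (1 - \<rho>)"
    by (intro add_mono geo)
  finally show ?thesis by simp
qed

text \<open>Lists are grouped by their counts and each group is bounded by the largest multinomial
  coefficient. Letting the counts range freely, without the constraint that they add up to
  \<open>k\<close>, makes the remaining sum a product over the directions.\<close>

lemma sum_dirs_collision_le:
  assumes d: "d \<ge> 1" and \<rho>: "0 \<le> \<rho>" "\<rho> < 1"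
  shows "(\<Sum>qs\<in>dir_lists d k. \<Prod>l<d. \<rho> ^ ((count_list qs l - c l) + (c l - count_list qs l)))
    \<le> real d ^ k * (2 ^ d * decay d k) * (2 / (1 - \<rho>)) ^ d"
proof -
  define M where "M = real d ^ k * (2 ^ d * decay d k)"
  define K where "K qs = restrict (count_list qs) {..<d}" for qs :: "nat list"
  define g where "g \<kappa> = (\<Prod>l<d. \<rho> ^ ((\<kappa> l - c l) + (c l - \<kappa> l)))" for \<kappa> :: "nat \<Rightarrow> nat"
  have g0: "g \<kappa> \<ge> 0" for \<kappa> using \<rho> by (auto simp: g_def intro!: prod_nonneg)
  have sub: "K ` dir_lists d k \<subseteq> {..<d} \<rightarrow>\<^sub>E {..k}"
  proof (intro image_subsetI)
    fix qs assume "qs \<in> dir_lists d k"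
    then have "count_list qs l \<le> k" for l using count_le_length[of qs l] by (simp add: dir_lists_def)
    then show "K qs \<in> {..<d} \<rightarrow>\<^sub>E {..k}" by (simp add: K_def)
  qed
  have "(\<Sum>qs\<in>dir_lists d k. \<Prod>l<d. \<rho> ^ ((count_list qs l - c l) + (c l - count_list qs l))) = (\<Sum>qs\<in>dir_lists d k. g (K qs))"
    by (intro sum.cong refl) (simp add: g_def K_def)
  also have "\<dots> = (\<Sum>\<kappa>\<in>K ` dir_lists d k. \<Sum>qs\<in>{qs\<in>dir_lists d k. K qs = \<kappa>}. g (K qs))"
    by (rule sum.image_gen) simp
  also have "\<dots> = (\<Sum>\<kappa>\<in>K ` dir_lists d k. real (card {qs\<in>dir_lists d k. K qs = \<kappa>}) * g \<kappa>)"
    by (intro sum.cong refl) simp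
  also have "\<dots> \<le> (\<Sum>\<kappa>\<in>K ` dir_lists d k. M * g \<kappa>)"
  proof (intro sum_mono mult_right_mono g0)
    fix \<kappa> assume "\<kappa> \<in> K ` dir_lists d k"
    have "{qs\<in>dir_lists d k. K qs = \<kappa>} \<subseteq> {qs\<in>dir_lists d k. \<forall>l<d. count_list qs l = \<kappa> l}"
      by (auto simp: K_def)
    then have "card {qs\<in>dir_lists d k. K qs = \<kappa>} \<le> card {qs\<in>dir_lists d k. \<forall>l<d. count_list qs l = \<kappa> l}"
      by (intro card_mono) auto
    then show "real (card {qs\<in>dir_lists d k. K qs = \<kappa>}) \<le> M"
      using card_dirs_with_counts_le[OF d, of k \<kappa>] unfolding M_def by linarith
  qed
  also have "\<dots> \<le> (\<Sum>\<kappa>\<in>{..<d} \<rightarrow>\<^sub>E {..k}. M * g \<kappa>)"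
    using sub g0 by (intro sum_mono2) (auto simp: M_def intro!: finite_PiE)
  also have "\<dots> = M * (\<Prod>l<d. \<Sum>j\<le>k. \<rho> ^ ((j - c l) + (c l - j)))"
    unfolding g_def sum_distrib_left[symmetric] by (subst prod_sum_PiE) auto
  also have "\<dots> \<le> M * (\<Prod>l<d. 2 / (1 - \<rho>))"
    using \<rho> by (intro mult_left_mono prod_mono conjI sum_geometric_two_sided_le sum_nonneg) (auto simp: M_def)
  finally show ?thesis by (simp add: M_def)
qed

section \<open>Moments of the forest weights\<close>

lemma nn_integral_coordinate_singleton:
  assumes "q < d"
  shows "(\<integral>\<^sup>+z. indicator {c} (z q) \<partial>uniform_cube d) = 0"
proof -
  have "(\<integral>\<^sup>+z. indicator {c} (z q) \<partial>uniform_cube d) =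
      (\<integral>\<^sup>+z. indicator (brick d (\<lambda>_. 0) (\<lambda>_. 1)) z * indicator {c} (z q) \<partial>uniform_cube d)"
    by (intro nn_integral_cong) (auto simp: space_uniform_cube cube_def brick_def PiE_iff split: split_indicator)
  also have "\<dots> = (\<integral>\<^sup>+t. indicator {0..1} t * indicator {c} t \<partial>lborel)"
    using assms by (subst nn_integral_box_times) auto
  also have "\<dots> \<le> (\<integral>\<^sup>+t. indicator {c} t \<partial>lborel)"
    by (intro nn_integral_mono) (auto split: split_indicator)
  also have "\<dots> = 0" by simp
  finally show ?thesis by simp
qed

lemma AE_coordinates_differ:
  assumes "finite (J :: nat set)" "i \<in> J" "j \<in> J" "i \<noteq> j" "q < d"
  shows "AE X in cubes d J. X i q \<noteq> X j q"
proof -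
  let ?M = "cubes d J"
  have J: "J = insert i (J - {i})" using assms by auto
  have m: "(\<lambda>X. X i q) \<in> borel_measurable ?M" "(\<lambda>X. X j q) \<in> borel_measurable ?M"
    using assms by (auto intro!: measurable_point_coordinate)
  have ind: "(\<lambda>X. indicator {X j q} (X i q) :: ennreal) \<in> borel_measurable ?M"
  proof (rule borel_measurable_indicator')
    have "{X \<in> space ?M. X i q = X j q} \<in> sets ?M"
      by (rule borel_measurable_eq[OF m])
    then show "{X \<in> space ?M. X i q \<in> {X j q}} \<in> sets ?M" by (simp only: singleton_iff)
  qed
  have "(\<integral>\<^sup>+X. indicator {X j q} (X i q) \<partial>?M) =
      (\<integral>\<^sup>+X. (\<integral>\<^sup>+y. indicator {(X(i := y)) j q} ((X(i := y)) i q) \<partial>uniform_cube d) \<partial>cubes d (J - {i}))"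
    using points.product_nn_integral_insert[of "J - {i}" i "\<lambda>X. indicator {X j q} (X i q)" d] ind assms(1) J by simp
  also have "\<dots> = (\<integral>\<^sup>+X. 0 \<partial>cubes d (J - {i}))"
    using assms by (intro nn_integral_cong) (simp add: nn_integral_coordinate_singleton)
  finally have "(\<integral>\<^sup>+X. indicator {X j q} (X i q) \<partial>?M) = 0" by simp
  then have "AE X in ?M. indicator {X j q} (X i q) = (0::ennreal)"
    by (subst (asm) nn_integral_0_iff_AE[OF ind])
  then show ?thesis by (rule eventually_mono) (auto split: split_indicator_asm)
qed

lemma AE_no_ties:
  assumes "finite (J :: nat set)"
  shows "AE X in cubes d J. \<forall>q<d. inj_on (\<lambda>j. X j q) J"
proof -
  have "AE X in cubes d J. \<forall>q\<in>{..<d}. \<forall>i\<in>J. \<forall>j\<in>J. i \<noteq> j \<longrightarrow> X i q \<noteq> X j q"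
  proof (intro AE_finite_allI assms finite_lessThan)
    fix q i j assume "q \<in> {..<d}" "i \<in> J" "j \<in> J"
    then show "AE X in cubes d J. i \<noteq> j \<longrightarrow> X i q \<noteq> X j q"
      using AE_coordinates_differ[OF assms, of i j q d] by (cases "i = j") auto
  qed
  then show ?thesis by (rule eventually_mono) (auto simp: inj_on_def)
qed

lemma exp_geometric_le: "exp (\<Sum>j<k. 3 / 2 ^ j) \<le> exp (6::real)"
proof -
  have "(\<Sum>j<k. 3 / 2 ^ j) = 6 - 6 / (2::real) ^ k"
    by (induction k) (simp_all add: field_simps)
  then show ?thesis by simp
qed

lemma nn_integral_box_weight_cube_le:
  assumes "finite T" "x0 \<notin> T" "card T + 1 = 2 ^ length qs" "set qs \<subseteq> {..<d}" "\<And>l. e l \<le> 3"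
  shows "(\<integral>\<^sup>+X. box_weight d e X (X x0) qs T (\<lambda>_. 0) (\<lambda>_. 1) \<partial>cubes d (insert x0 T))
    \<le> ennreal (exp 6 * (\<Prod>q\<leftarrow>qs. (1 / 2) ^ e q))"
proof -
  have "(\<integral>\<^sup>+X. box_weight d e X (X x0) qs T (\<lambda>_. 0) (\<lambda>_. 1) \<partial>cubes d (insert x0 T)) =
     (\<integral>\<^sup>+X. (\<Prod>j\<in>insert x0 T. indicator (brick d (\<lambda>_. 0) (\<lambda>_. 1)) (X j)) * box_weight d e X (X x0) qs T (\<lambda>_. 0) (\<lambda>_. 1)
        \<partial>cubes d (insert x0 T))"
  proof (rule nn_integral_cong)
    fix X assume "X \<in> space (cubes d (insert x0 T))"
    then have "\<forall>j\<in>insert x0 T. X j \<in> brick d (\<lambda>_. 0) (\<lambda>_. 1)"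
      by (auto simp: space_PiM space_uniform_cube cube_def brick_def PiE_iff)
    then have "(\<Prod>j\<in>insert x0 T. indicator (brick d (\<lambda>_. 0) (\<lambda>_. 1)) (X j)) = (1::ennreal)"
      using assms(1) by (subst prod_indicator_eq) auto
    then show "box_weight d e X (X x0) qs T (\<lambda>_. 0) (\<lambda>_. 1) = (\<Prod>j\<in>insert x0 T. indicator (brick d (\<lambda>_. 0) (\<lambda>_. 1)) (X j)) *
        box_weight d e X (X x0) qs T (\<lambda>_. 0) (\<lambda>_. 1)" by (simp only: mult_1)
  qed
  also have "\<dots> \<le> ennreal (exp (\<Sum>j<length qs. 3 / 2 ^ j) * (\<Prod>q\<leftarrow>qs. (1 / 2) ^ e q)) *
       (\<Prod>l<d. ennreal (1 - 0) ^ (2 ^ length qs + e l))"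
    using assms by (intro nn_integral_box_weight_le) auto
  also have "\<dots> \<le> ennreal (exp 6 * (\<Prod>q\<leftarrow>qs. (1 / 2) ^ e q))"
    using exp_geometric_le[of "length qs"] by (auto intro!: ennreal_leI mult_right_mono prod_list_nonneg)
  finally show ?thesis .
qed

text \<open>
  Integrating the point \<open>X\<^sub>i\<close> last, against the boxes of the tree built from the other observations.
\<close>

lemma nn_integral_mate_le:
  fixes \<phi> :: "(nat \<Rightarrow> nat \<Rightarrow> real) \<Rightarrow> ennreal"
  assumes i: "i < n" and \<phi>: "\<phi> \<in> borel_measurable (cubes d {..n})"
    and le: "\<And>X. X \<in> space (cubes d (insert n ({..<n} - {i}))) \<Longrightarrow>
        \<forall>q<d. inj_on (\<lambda>j. X j q) (insert n ({..<n} - {i})) \<Longrightarrow>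
        (\<integral>\<^sup>+y. \<phi> (X(i := y)) \<partial>uniform_cube d) \<le> \<psi> X"
    and C: "(\<integral>\<^sup>+X. \<psi> X \<partial>cubes d (insert n ({..<n} - {i}))) \<le> C"
  shows "(\<integral>\<^sup>+X. \<phi> X \<partial>cubes d {..n}) \<le> C"
proof -
  let ?I = "insert n ({..<n} - {i})"
  have eq: "{..n} = insert i ?I" using i by auto
  have "(\<integral>\<^sup>+X. \<phi> X \<partial>cubes d {..n}) =
      (\<integral>\<^sup>+X. \<integral>\<^sup>+y. \<phi> (X(i := y)) \<partial>uniform_cube d \<partial>cubes d ?I)"
    using i \<phi> unfolding eq by (intro points.product_nn_integral_insert) auto
  also have "\<dots> \<le> (\<integral>\<^sup>+X. \<psi> X \<partial>cubes d ?I)"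
  proof (rule nn_integral_mono_AE)
    have "AE X in cubes d ?I. \<forall>q<d. inj_on (\<lambda>j. X j q) ?I"
      by (intro AE_no_ties) simp
    with AE_space show "AE X in cubes d ?I. (\<integral>\<^sup>+y. \<phi> (X(i := y)) \<partial>uniform_cube d) \<le> \<psi> X"
      by eventually_elim (rule le)
  qed
  finally show ?thesis using C by simp
qed

text \<open>\<open>mate_imp_box\<close> started from the unit cube. One box serves all exponents
  \<open>e\<close> and all positions \<open>y\<close> of the deleted point.\<close>

lemma mate_box_of_tree:
  assumes X: "X \<in> space (cubes d (insert n ({..<n} - {i})))"
    and ties: "\<forall>q<d. inj_on (\<lambda>j. X j q) (insert n ({..<n} - {i}))"
    and i: "i < n" and qs: "n = 2 ^ length qs" "set qs \<subseteq> {..<d}"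
  obtains a b where "\<And>e. (\<Prod>l<d. ennreal (b l - a l) ^ e l) \<le> box_weight d e X (X n) qs ({..<n} - {i}) (\<lambda>_. 0) (\<lambda>_. 1)"
    "\<And>l. l < d \<Longrightarrow> 0 \<le> a l \<and> b l \<le> 1" "X n \<in> brick d a b"
    "\<And>y. y \<in> cube d \<Longrightarrow> mate (X(i := y)) i (X n) qs {..<n} \<Longrightarrow> y \<in> brick d a b"
proof -
  let ?T = "{..<n} - {i}"
  have cube: "y \<in> brick d (\<lambda>_. 0) (\<lambda>_. 1)" if "y \<in> cube d" for y :: "nat \<Rightarrow> real"
    using that unfolding cube_def brick_def by (simp add: PiE_iff)
  have Xc: "X j \<in> cube d" if "j \<in> insert n ?T" for j
    using X that unfolding space_PiM space_uniform_cube PiE_iff by blast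
  have "\<exists>a b. (\<forall>e. (\<Prod>l<d. ennreal (b l - a l) ^ e l) \<le> box_weight d e X (X n) qs ?T (\<lambda>_. 0) (\<lambda>_. 1)) \<and>
     (\<forall>l<d. 0 \<le> a l \<and> b l \<le> 1) \<and> X n \<in> brick d a b \<and>
     (\<forall>y\<in>brick d (\<lambda>_. 0) (\<lambda>_. 1). mate (X(i := y)) i (X n) qs (insert i ?T) \<longrightarrow> y \<in> brick d a b)"
  proof (rule mate_imp_box)
    show "card ?T + 1 = 2 ^ length qs" using i qs by simp
    show "\<forall>q<d. inj_on (\<lambda>j. X j q) ?T" using ties by simp
    show "X n \<in> brick d (\<lambda>_. 0) (\<lambda>_. 1)" "\<forall>j\<in>?T. X j \<in> brick d (\<lambda>_. 0) (\<lambda>_. 1)"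
      by (simp_all add: cube Xc)
    show "\<forall>j\<in>?T. \<forall>q<d. X n q \<noteq> X j q"
    proof (intro ballI allI impI)
      fix j q assume j: "j \<in> ?T" and q: "q < d"
      have "inj_on (\<lambda>j. X j q) (insert n ?T)" using ties q by blast
      then show "X n q \<noteq> X j q" using inj_onD[of "\<lambda>j. X j q" "insert n ?T" n j] j by auto
    qed
  qed (use qs in simp_all)
  then obtain a b where ab: "(\<forall>e. (\<Prod>l<d. ennreal (b l - a l) ^ e l) \<le> box_weight d e X (X n) qs ?T (\<lambda>_. 0) (\<lambda>_. 1)) \<and>
     (\<forall>l<d. 0 \<le> a l \<and> b l \<le> 1) \<and> X n \<in> brick d a b \<and>
     (\<forall>y\<in>brick d (\<lambda>_. 0) (\<lambda>_. 1). mate (X(i := y)) i (X n) qs (insert i ?T) \<longrightarrow> y \<in> brick d a b)"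
    by (elim exE)
  have eq: "insert i ?T = {..<n}" using i by auto
  show ?thesis
  proof (rule that)
    show "(\<Prod>l<d. ennreal (b l - a l) ^ e l) \<le> box_weight d e X (X n) qs ?T (\<lambda>_. 0) (\<lambda>_. 1)" for e
      using ab by (elim conjE allE)
    show "0 \<le> a l \<and> b l \<le> 1" if "l < d" for l using conjunct1[OF conjunct2[OF ab]] that by blast
    show "X n \<in> brick d a b" using ab by (elim conjE)
    show "y \<in> brick d a b" if "y \<in> cube d" "mate (X(i := y)) i (X n) qs {..<n}" for y
      using conjunct2[OF conjunct2[OF conjunct2[OF ab]]] cube[OF that(1)] that(2) unfolding eq by blast
  qed
qed

lemma box_side_le: "x \<in> brick d a b \<Longrightarrow> l < d \<Longrightarrow> a l \<le> b l"
  by (auto simp: brick_def intro: order_trans)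

lemma nn_integral_box_subset:
  assumes "\<And>y. y \<in> cube d \<Longrightarrow> P y \<Longrightarrow> y \<in> brick d a b" "\<And>l. l < d \<Longrightarrow> 0 \<le> a l \<and> b l \<le> 1" "x \<in> brick d a b"
  shows "(\<integral>\<^sup>+y. of_bool (P y) \<partial>uniform_cube d) \<le> (\<Prod>l<d. ennreal (b l - a l))"
proof -
  have "(\<integral>\<^sup>+y. of_bool (P y) \<partial>uniform_cube d) \<le> (\<integral>\<^sup>+y. indicator (brick d a b) y \<partial>uniform_cube d)"
    using assms(1) by (intro nn_integral_mono) (auto simp: space_uniform_cube split: split_indicator)
  also have "\<dots> = (\<Prod>l<d. ennreal (b l - a l))"
    using assms(2) box_side_le[OF assms(3)] by (intro nn_integral_box) auto
  finally show ?thesis .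
qed

lemma measurable_mate_indicator:
  assumes "set qs \<subseteq> {..<d}"
  shows "(\<lambda>X. of_bool (mate X i (X n) qs {..<n}) :: ennreal) \<in> borel_measurable (cubes d {..n})"
proof -
  have "Measurable.pred (cubes d {..n}) (\<lambda>X. mate X i (X n) qs {..<n})"
    using assms by (intro measurable_mate) auto
  then show ?thesis
    unfolding of_bool_def pred_def by (intro measurable_If measurable_const) simp_all
qed

text \<open>The exponent 3 along \<open>l\<close> is one power of the side for the probability that
  \<open>X_i\<close> falls in the box and two for the squared distance, which the box bounds since
  it contains both points. The other directions contribute to the probability only.\<close>

lemma mate_distance_moment:
  assumes i: "i < n" and qs: "n = 2 ^ length qs" "set qs \<subseteq> {..<d}" and l: "l < d"
  shows "(\<integral>\<^sup>+X. of_bool (mate X i (X n) qs {..<n}) * ennreal ((X i l - X n l)\<^sup>2) \<partial>cubes d {..n})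
    \<le> ennreal (exp 6 * (\<Prod>q\<leftarrow>qs. (1 / 2) ^ (if q = l then 3 else 1)))"
proof (rule nn_integral_mate_le[OF i])
  define e :: "nat \<Rightarrow> nat" where "e q = (if q = l then 3 else 1)" for q
  let ?T = "{..<n} - {i}"
  let ?\<phi> = "\<lambda>X. of_bool (mate X i (X n) qs {..<n}) * ennreal ((X i l - X n l)\<^sup>2)"
  show "?\<phi> \<in> borel_measurable (cubes d {..n})"
    using i l qs
    by (intro borel_measurable_times_ennreal measurable_mate_indicator measurable_compose[OF _ measurable_ennreal]
        borel_measurable_power borel_measurable_diff measurable_point_coordinate) auto
  show "(\<integral>\<^sup>+X. box_weight d e X (X n) qs ?T (\<lambda>_. 0) (\<lambda>_. 1) \<partial>cubes d (insert n ?T))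
      \<le> ennreal (exp 6 * (\<Prod>q\<leftarrow>qs. (1 / 2) ^ (if q = l then 3 else 1)))"
    using nn_integral_box_weight_cube_le[of ?T n qs d e] i qs by (auto simp: e_def)
  fix X assume X: "X \<in> space (cubes d (insert n ?T))" "\<forall>q<d. inj_on (\<lambda>j. X j q) (insert n ?T)"
  obtain a b where ab: "\<And>e. (\<Prod>l<d. ennreal (b l - a l) ^ e l) \<le> box_weight d e X (X n) qs ?T (\<lambda>_. 0) (\<lambda>_. 1)"
    "\<And>l. l < d \<Longrightarrow> 0 \<le> a l \<and> b l \<le> 1" "X n \<in> brick d a b"
    "\<And>y. y \<in> cube d \<Longrightarrow> mate (X(i := y)) i (X n) qs {..<n} \<Longrightarrow> y \<in> brick d a b"
    by (rule mate_box_of_tree[OF X i qs]) (rule that)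
  have "(\<integral>\<^sup>+y. ?\<phi> (X(i := y)) \<partial>uniform_cube d) \<le>
      (\<integral>\<^sup>+y. of_bool (y \<in> brick d a b) * ennreal (b l - a l) ^ 2 \<partial>uniform_cube d)"
  proof (rule nn_integral_mono)
    fix y assume y: "y \<in> space (uniform_cube d)"
    show "?\<phi> (X(i := y)) \<le> of_bool (y \<in> brick d a b) * ennreal (b l - a l) ^ 2"
    proof (cases "mate (X(i := y)) i (X n) qs {..<n}")
      case True
      then have yb: "y \<in> brick d a b" using ab(4) y by (simp add: space_uniform_cube)
      then have "\<bar>y l - X n l\<bar> \<le> b l - a l" using ab(3) l by (force simp: brick_def)
      then have "(y l - X n l)\<^sup>2 \<le> (b l - a l)\<^sup>2" using power_mono[of "\<bar>y l - X n l\<bar>" _ 2] by simp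
      then have "ennreal ((y l - X n l)\<^sup>2) \<le> ennreal (b l - a l) ^ 2"
        using box_side_le[OF ab(3) l] by (simp add: ennreal_power ennreal_leI)
      then show ?thesis using True yb i by simp
    qed (use i in simp)
  qed
  also have "\<dots> = (\<integral>\<^sup>+y. of_bool (y \<in> brick d a b) \<partial>uniform_cube d) * ennreal (b l - a l) ^ 2"
  proof (rule nn_integral_multc)
    have "(\<lambda>y. indicator (brick d a b) y :: ennreal) \<in> borel_measurable (uniform_cube d)"
      by (intro measurable_indicator_box[where a="\<lambda>_. a" and b="\<lambda>_. b"] measurable_coordinate) auto
    then show "(\<lambda>y. of_bool (y \<in> brick d a b) :: ennreal) \<in> borel_measurable (uniform_cube d)"
      by (simp add: indicator_def of_bool_def)
  qed
  also have "\<dots> \<le> (\<Prod>l<d. ennreal (b l - a l)) * ennreal (b l - a l) ^ 2"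
    using ab by (intro mult_right_mono nn_integral_box_subset) auto
  also have "\<dots> = (\<Prod>l<d. ennreal (b l - a l) ^ e l)"
  proof -
    have *: "(\<Prod>l<d. g l) = g l * (\<Prod>l\<in>{..<d}-{l}. g l)" for g :: "nat \<Rightarrow> ennreal"
      using l by (intro prod.remove) auto
    have "(\<Prod>l\<in>{..<d}-{l}. ennreal (b l - a l) ^ e l) = (\<Prod>l\<in>{..<d}-{l}. ennreal (b l - a l))"
      by (intro prod.cong) (auto simp: e_def)
    then show ?thesis unfolding *[of "\<lambda>l. ennreal (b l - a l) ^ e l"] *[of "\<lambda>l. ennreal (b l - a l)"]
      by (simp add: e_def power3_eq_cube power2_eq_square mult_ac)
  qed
  also have "\<dots> \<le> box_weight d e X (X n) qs ?T (\<lambda>_. 0) (\<lambda>_. 1)" by (rule ab(1))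
  finally show "(\<integral>\<^sup>+y. ?\<phi> (X(i := y)) \<partial>uniform_cube d) \<le> box_weight d e X (X n) qs ?T (\<lambda>_. 0) (\<lambda>_. 1)" .
qed

lemma ennreal_am_gm:
  fixes u v :: ennreal
  assumes "0 < \<nu>"
  shows "u * v \<le> ennreal (\<nu> / 2) * u\<^sup>2 + ennreal (1 / (2 * \<nu>)) * v\<^sup>2"
proof (cases u; cases v)
  fix r s assume rs: "u = ennreal r" "0 \<le> r" "v = ennreal s" "0 \<le> s"
  have "0 \<le> (\<nu> * r - s)\<^sup>2" by simp
  then have "r * s \<le> \<nu> / 2 * r\<^sup>2 + 1 / (2 * \<nu>) * s\<^sup>2"
    using assms by (simp add: field_simps power2_eq_square)
  then show ?thesis
    using assms rs by (simp add: ennreal_mult[symmetric] ennreal_plus[symmetric] ennreal_power ennreal_leI del: ennreal_plus)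
qed (use assms in \<open>auto simp: ennreal_mult_top power2_eq_square ennreal_top_mult\<close>)

abbreviation both_mates :: "nat \<Rightarrow> nat \<Rightarrow> nat list \<Rightarrow> nat list \<Rightarrow> (nat \<Rightarrow> nat \<Rightarrow> real) \<Rightarrow> 'a::semiring_1" where
  "both_mates i n qs qs' X \<equiv> of_bool (mate X i (X n) qs {..<n}) * of_bool (mate X i (X n) qs' {..<n})"

text \<open>
  The intersection of the two boxes is at most the product over the directions of the side that was split
  more often. AM-GM with the weight \<open>\<nu>\<close> separates the two boxes, which are dependent.
\<close>

lemma two_mates_probability:
  assumes i: "i < n" and qs: "n = 2 ^ length qs" "set qs \<subseteq> {..<d}" and qs': "n = 2 ^ length qs'" "set qs' \<subseteq> {..<d}"
  shows "(\<integral>\<^sup>+X. both_mates i n qs qs' X \<partial>cubes d {..n})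
    \<le> ennreal (exp 6 * (\<Prod>l<d. (1 / 2) ^ max (count_list qs l) (count_list qs' l)))"
proof (rule nn_integral_mate_le[OF i])
  define G where "G l \<longleftrightarrow> count_list qs' l \<le> count_list qs l" for l
  \<comment> \<open>In each direction only the box split more often is kept; the exponent is 2
    because AM-GM squares both factors.\<close>
  define e :: "nat \<Rightarrow> nat" where "e l = (if G l then 2 else 0)" for l
  define e' :: "nat \<Rightarrow> nat" where "e' l = (if G l then 0 else 2)" for l
  define U :: real where "U = (\<Prod>l<d. (1 / 2) ^ (if G l then count_list qs l else 0))"
  define V :: real where "V = (\<Prod>l<d. (1 / 2) ^ (if G l then 0 else count_list qs' l))"
  have UV: "U > 0" "V > 0" by (auto simp: U_def V_def intro!: prod_pos)
  \<comment> \<open>With this weight the two terms have equal bounds, and their sum is the bound for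
    the product \<open>U * V\<close>.\<close>
  define \<nu> where "\<nu> = V / U"
  have \<nu>: "\<nu> > 0" using UV by (simp add: \<nu>_def)
  let ?T = "{..<n} - {i}"
  let ?\<phi> = "\<lambda>X. both_mates i n qs qs' X :: ennreal"
  let ?w = "\<lambda>e qs X. box_weight d e X (X n) qs ?T (\<lambda>_. 0) (\<lambda>_. 1)"
  let ?\<psi> = "\<lambda>X. ennreal (\<nu> / 2) * ?w e qs X + ennreal (1 / (2 * \<nu>)) * ?w e' qs' X"
  show "?\<phi> \<in> borel_measurable (cubes d {..n})"
    using qs qs' by (intro borel_measurable_times_ennreal measurable_mate_indicator) auto
  have m: "?w e qs \<in> borel_measurable (cubes d (insert n ?T))" if "set qs \<subseteq> {..<d}" for e qs
    using that by (intro measurable_box_weight[where a="\<lambda>_ _. 0" and b="\<lambda>_ _. 1"]) auto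
  have bound: "(\<integral>\<^sup>+X. ?w e qs X \<partial>cubes d (insert n ?T)) \<le> ennreal (exp 6 * (\<Prod>q\<leftarrow>qs. (1 / 2) ^ e q))"
    if "n = 2 ^ length qs" "set qs \<subseteq> {..<d}" "\<And>l. e l \<le> 3" for e qs
    using nn_integral_box_weight_cube_le[of ?T n qs d e] i that by auto
  have U2: "(\<Prod>q\<leftarrow>qs. (1 / 2) ^ e q) = U\<^sup>2"
    unfolding prod_list_eq_prod_count[OF qs(2)] U_def prod_power_distrib
    by (intro prod.cong) (auto simp: e_def power_mult[symmetric] mult.commute)
  have V2: "(\<Prod>q\<leftarrow>qs'. (1 / 2) ^ e' q) = V\<^sup>2"
    unfolding prod_list_eq_prod_count[OF qs'(2)] V_def prod_power_distrib
    by (intro prod.cong) (auto simp: e'_def power_mult[symmetric] mult.commute)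
  have "(\<integral>\<^sup>+X. ?\<psi> X \<partial>cubes d (insert n ?T)) =
      ennreal (\<nu> / 2) * (\<integral>\<^sup>+X. ?w e qs X \<partial>cubes d (insert n ?T)) +
      ennreal (1 / (2 * \<nu>)) * (\<integral>\<^sup>+X. ?w e' qs' X \<partial>cubes d (insert n ?T))"
    using qs qs' m by (subst nn_integral_add) (auto simp: nn_integral_cmult)
  also have "\<dots> \<le> ennreal (\<nu> / 2) * ennreal (exp 6 * U\<^sup>2) + ennreal (1 / (2 * \<nu>)) * ennreal (exp 6 * V\<^sup>2)"
    unfolding U2[symmetric] V2[symmetric]
    using qs qs' by (intro add_mono mult_left_mono bound) (auto simp: e_def e'_def)
  also have "\<dots> = ennreal (\<nu> / 2 * (exp 6 * U\<^sup>2) + 1 / (2 * \<nu>) * (exp 6 * V\<^sup>2))"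
    using \<nu> by (simp add: ennreal_mult[symmetric] ennreal_plus[symmetric] del: ennreal_plus)
  also have "\<nu> / 2 * (exp 6 * U\<^sup>2) + 1 / (2 * \<nu>) * (exp 6 * V\<^sup>2) = exp 6 * (U * V)"
    using UV by (simp add: \<nu>_def field_simps power2_eq_square)
  also have "U * V = (\<Prod>l<d. (1 / 2) ^ max (count_list qs l) (count_list qs' l))"
    unfolding U_def V_def prod.distrib[symmetric] by (intro prod.cong) (auto simp: G_def max_def)
  finally show "(\<integral>\<^sup>+X. ?\<psi> X \<partial>cubes d (insert n ?T)) \<le>
      ennreal (exp 6 * (\<Prod>l<d. (1 / 2) ^ max (count_list qs l) (count_list qs' l)))" .
  fix X assume X: "X \<in> space (cubes d (insert n ?T))" "\<forall>q<d. inj_on (\<lambda>j. X j q) (insert n ?T)"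
  obtain a b where ab: "\<And>e. (\<Prod>l<d. ennreal (b l - a l) ^ e l) \<le> box_weight d e X (X n) qs ?T (\<lambda>_. 0) (\<lambda>_. 1)"
    "\<And>l. l < d \<Longrightarrow> 0 \<le> a l \<and> b l \<le> 1" "X n \<in> brick d a b"
    "\<And>y. y \<in> cube d \<Longrightarrow> mate (X(i := y)) i (X n) qs {..<n} \<Longrightarrow> y \<in> brick d a b"
    by (rule mate_box_of_tree[OF X i qs]) (rule that)
  obtain a' b' where ab': "\<And>e. (\<Prod>l<d. ennreal (b' l - a' l) ^ e l) \<le> box_weight d e X (X n) qs' ?T (\<lambda>_. 0) (\<lambda>_. 1)"
    "\<And>l. l < d \<Longrightarrow> 0 \<le> a' l \<and> b' l \<le> 1" "X n \<in> brick d a' b'"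
    "\<And>y. y \<in> cube d \<Longrightarrow> mate (X(i := y)) i (X n) qs' {..<n} \<Longrightarrow> y \<in> brick d a' b'"
    by (rule mate_box_of_tree[OF X i qs']) (rule that)
  define A where "A l = (if G l then a l else a' l)" for l
  define B where "B l = (if G l then b l else b' l)" for l
  have "(\<integral>\<^sup>+y. ?\<phi> (X(i := y)) \<partial>uniform_cube d) =
     (\<integral>\<^sup>+y. of_bool (mate (X(i := y)) i (X n) qs {..<n} \<and> mate (X(i := y)) i (X n) qs' {..<n}) \<partial>uniform_cube d)"
    using i by (intro nn_integral_cong) simp
  also have "\<dots> \<le> (\<Prod>l<d. ennreal (B l - A l))"
  proof (rule nn_integral_box_subset)
    fix y assume "y \<in> cube d" "mate (X(i := y)) i (X n) qs {..<n} \<and> mate (X(i := y)) i (X n) qs' {..<n}"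
    then have "y \<in> brick d a b" "y \<in> brick d a' b'" using ab(4) ab'(4) by auto
    then show "y \<in> brick d A B" by (auto simp: brick_def A_def B_def)
  next
    show "X n \<in> brick d A B" using ab(3) ab'(3) by (auto simp: brick_def A_def B_def)
  qed (use ab(2) ab'(2) in \<open>auto simp: A_def B_def\<close>)
  also have "\<dots> = (\<Prod>l<d. ennreal (b l - a l) ^ (if G l then 1 else 0)) * (\<Prod>l<d. ennreal (b' l - a' l) ^ (if G l then 0 else 1))"
    unfolding prod.distrib[symmetric] by (intro prod.cong) (auto simp: A_def B_def)
  also have "\<dots> \<le> ennreal (\<nu> / 2) * (\<Prod>l<d. ennreal (b l - a l) ^ (if G l then 1 else 0))\<^sup>2 +
      ennreal (1 / (2 * \<nu>)) * (\<Prod>l<d. ennreal (b' l - a' l) ^ (if G l then 0 else 1))\<^sup>2"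
    by (rule ennreal_am_gm[OF \<nu>])
  also have "(\<Prod>l<d. ennreal (b l - a l) ^ (if G l then 1 else 0))\<^sup>2 = (\<Prod>l<d. ennreal (b l - a l) ^ e l)"
    unfolding prod_power_distrib by (intro prod.cong) (auto simp: e_def)
  also have "(\<Prod>l<d. ennreal (b' l - a' l) ^ (if G l then 0 else 1))\<^sup>2 = (\<Prod>l<d. ennreal (b' l - a' l) ^ e' l)"
    unfolding prod_power_distrib by (intro prod.cong) (auto simp: e'_def)
  also have "ennreal (\<nu> / 2) * (\<Prod>l<d. ennreal (b l - a l) ^ e l) + ennreal (1 / (2 * \<nu>)) * (\<Prod>l<d. ennreal (b' l - a' l) ^ e' l) \<le> ?\<psi> X"
    by (intro add_mono mult_left_mono ab(1) ab'(1)) auto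
  finally show "(\<integral>\<^sup>+y. ?\<phi> (X(i := y)) \<partial>uniform_cube d) \<le> ?\<psi> X" .
qed

lemma sum_const_ennreal: "0 \<le> c \<Longrightarrow> (\<Sum>i<n. ennreal c) = ennreal (real n * c)"
  by (subst sum_ennreal) simp_all

text \<open>A split along \<open>l\<close> contributes \<open>1 / 8\<close> and any other split
  \<open>1 / 2\<close>, so the sum over the lists is the \<open>k\<close>-th power of
  \<open>(d - 1) / 2 + 1 / 8 = (d - 3 / 4) / 2\<close>. The number \<open>2 ^ k\<close> of
  observations cancels the halves, and division by \<open>d ^ k\<close> leaves the
  \<open>k\<close>-th power of \<open>1 - 3 / (4 * d)\<close>.\<close>

lemma bias_moment:
  assumes d: "d \<ge> 1" and l: "l < d"
  shows "(\<Sum>i<2 ^ k. \<integral>\<^sup>+X. ennreal (forest_weight d k X (X (2 ^ k)) i * (X i l - X (2 ^ k) l)\<^sup>2) \<partial>cubes d {..2 ^ k})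
    \<le> ennreal (exp 6 * (1 - 3 / (4 * real d)) ^ k)"
proof -
  define n :: nat where "n = 2 ^ k"
  let ?M = "cubes d {..n}"
  have one: "(\<integral>\<^sup>+X. ennreal (forest_weight d k X (X n) i * (X i l - X n l)\<^sup>2) \<partial>?M)
      \<le> ennreal (exp 6 * ((real d - 3 / 4) / 2) ^ k / real d ^ k)" if i: "i < n" for i
  proof -
    have m: "(\<lambda>X. of_bool (mate X i (X n) qs {..<n}) * ennreal ((X i l - X n l)\<^sup>2)) \<in> borel_measurable ?M"
      if "qs \<in> dir_lists d k" for qs
      using i l that
      by (intro borel_measurable_times_ennreal measurable_mate_indicator measurable_compose[OF _ measurable_ennreal]
        borel_measurable_power borel_measurable_diff measurable_point_coordinate) (auto simp: dir_lists_def)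
    have "(\<integral>\<^sup>+X. ennreal (forest_weight d k X (X n) i * (X i l - X n l)\<^sup>2) \<partial>?M) =
      (\<integral>\<^sup>+X. ennreal (1 / real d ^ k) * (\<Sum>qs\<in>dir_lists d k. of_bool (mate X i (X n) qs {..<n}) * ennreal ((X i l - X n l)\<^sup>2)) \<partial>?M)"
    proof (rule nn_integral_cong)
      fix X
      have "ennreal (forest_weight d k X (X n) i * (X i l - X n l)\<^sup>2) =
        ennreal (1 / real d ^ k * (\<Sum>qs\<in>dir_lists d k. of_bool (mate X i (X n) qs {..<n}) * (X i l - X n l)\<^sup>2))"
        by (simp add: forest_weight_def n_def sum_distrib_right)
      also have "\<dots> = ennreal (1 / real d ^ k) * (\<Sum>qs\<in>dir_lists d k. ennreal (of_bool (mate X i (X n) qs {..<n}) * (X i l - X n l)\<^sup>2))"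
        by (subst ennreal_mult) (auto intro!: sum_nonneg simp: sum_ennreal)
      also have "(\<Sum>qs\<in>dir_lists d k. ennreal (of_bool (mate X i (X n) qs {..<n}) * (X i l - X n l)\<^sup>2)) =
          (\<Sum>qs\<in>dir_lists d k. of_bool (mate X i (X n) qs {..<n}) * ennreal ((X i l - X n l)\<^sup>2))"
        by (intro sum.cong) auto
      finally show "ennreal (forest_weight d k X (X n) i * (X i l - X n l)\<^sup>2) =
        ennreal (1 / real d ^ k) * (\<Sum>qs\<in>dir_lists d k. of_bool (mate X i (X n) qs {..<n}) * ennreal ((X i l - X n l)\<^sup>2))" .
    qed
    also have "\<dots> = ennreal (1 / real d ^ k) * (\<Sum>qs\<in>dir_lists d k. \<integral>\<^sup>+X. of_bool (mate X i (X n) qs {..<n}) * ennreal ((X i l - X n l)\<^sup>2) \<partial>?M)"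
      by (subst nn_integral_sum[OF m, symmetric]) (assumption, intro nn_integral_cmult borel_measurable_sum m)
    also have "\<dots> \<le> ennreal (1 / real d ^ k) * (\<Sum>qs\<in>dir_lists d k. ennreal (exp 6 * (\<Prod>q\<leftarrow>qs. (1 / 2) ^ (if q = l then 3 else 1))))"
      using i l by (intro mult_left_mono sum_mono mate_distance_moment) (auto simp: dir_lists_def n_def)
    also have "\<dots> = ennreal (1 / real d ^ k * (\<Sum>qs\<in>dir_lists d k. exp 6 * (\<Prod>q\<leftarrow>qs. (1 / 2) ^ (if q = l then 3 else 1))))"
    proof -
      have p0: "0 \<le> exp 6 * (\<Prod>q\<leftarrow>qs. (1 / 2 :: real) ^ (if q = l then 3 else 1))" for qs
        by (intro mult_nonneg_nonneg prod_list_nonneg) auto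
      show ?thesis
        unfolding sum_ennreal[of "dir_lists d k" "\<lambda>qs. exp 6 * (\<Prod>q\<leftarrow>qs. (1 / 2) ^ (if q = l then 3 else 1))", OF p0]
        by (intro ennreal_mult[symmetric] sum_nonneg p0) simp
    qed
    also have "(\<Sum>qs\<in>dir_lists d k. exp 6 * (\<Prod>q\<leftarrow>qs. (1 / 2 :: real) ^ (if q = l then 3 else 1))) = exp 6 * (\<Sum>q<d. (1 / 2) ^ (if q = l then 3 else 1)) ^ k"
      unfolding sum_distrib_left[symmetric] sum_dir_lists_prod ..
    also have "(\<Sum>q<d. (1 / 2) ^ (if q = l then 3 else 1)) = (real d - 3 / 4) / (2::real)"
    proof -
      have "(\<Sum>q<d. (1 / 2) ^ (if q = l then 3 else 1)) = (\<Sum>q<d. 1 / 2 - (if q = l then 3 / 8 else 0 :: real))"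
        by (intro sum.cong) (auto simp: power3_eq_cube)
      also have "\<dots> = (real d - 3 / 4) / 2" using l by (simp add: sum_subtractf)
      finally show ?thesis .
    qed
    finally show ?thesis by simp
  qed
  have "(\<Sum>i<n. \<integral>\<^sup>+X. ennreal (forest_weight d k X (X n) i * (X i l - X n l)\<^sup>2) \<partial>?M) \<le>
      (\<Sum>i<n. ennreal (exp 6 * ((real d - 3 / 4) / 2) ^ k / real d ^ k))"
    by (intro sum_mono one) auto
  also have "\<dots> = ennreal (real n * (exp 6 * ((real d - 3 / 4) / 2) ^ k / real d ^ k))"
    using d by (intro sum_const_ennreal) simp
  also have "real n * (exp 6 * ((real d - 3 / 4) / 2) ^ k / real d ^ k) = exp 6 * (1 - 3 / (4 * real d)) ^ k"
  proof -
    have "1 - 3 / (4 * real d) = (real d - 3 / 4) / real d" using d by (simp add: field_simps)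
    then show ?thesis by (simp add: n_def power_divide)
  qed
  finally show ?thesis by (simp add: n_def)
qed

text \<open>\<open>max c c'\<close> is half of \<open>c + c' + |c - c'|\<close>, and both families
  of counts add up to \<open>k\<close>; hence the base \<open>sqrt (1 / 2)\<close> and the
  cancellation of \<open>2 ^ k\<close>.\<close>

lemma half_power_max:
  assumes "(\<Sum>l<d. c l) = k" "(\<Sum>l<d. c' l) = k"
  shows "2 ^ k * (\<Prod>l<d. (1 / 2) ^ max (c l) (c' l)) = (\<Prod>l<d. sqrt (1 / 2) ^ ((c l - c' l) + (c' l - c l)))"
proof -
  have "(\<Prod>l<d. (1 / 2) ^ max (c l) (c' l)) = (\<Prod>l<d. sqrt (1 / 2) ^ (c l + c' l + ((c l - c' l) + (c' l - c l))))"
  proof (intro prod.cong refl)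
    fix l
    have "(1 / 2 :: real) ^ max (c l) (c' l) = (sqrt (1 / 2) ^ 2) ^ max (c l) (c' l)" by simp
    also have "\<dots> = sqrt (1 / 2) ^ (c l + c' l + ((c l - c' l) + (c' l - c l)))"
      unfolding power_mult[symmetric] by (rule arg_cong[where f="\<lambda>n. sqrt (1 / 2) ^ n"]) auto
    finally show "(1 / 2) ^ max (c l) (c' l) = sqrt (1 / 2) ^ (c l + c' l + ((c l - c' l) + (c' l - c l)))" .
  qed
  also have "\<dots> = sqrt (1 / 2) ^ (k + k) * (\<Prod>l<d. sqrt (1 / 2) ^ ((c l - c' l) + (c' l - c l)))"
    by (simp only: power_add prod.distrib power_sum[symmetric] assms)
  also have "sqrt (1 / 2) ^ (k + k) = 1 / 2 ^ k"
    unfolding mult_2[symmetric] power_mult by (simp add: power_divide)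
  finally show ?thesis by simp
qed

lemma variance_moment:
  assumes d: "d \<ge> 1"
  shows "(\<Sum>i<2 ^ k. \<integral>\<^sup>+X. ennreal ((forest_weight d k X (X (2 ^ k)) i)\<^sup>2) \<partial>cubes d {..2 ^ k})
    \<le> ennreal (exp 6 * 16 ^ d * decay d k)"
proof -
  define n :: nat where "n = 2 ^ k"
  define \<rho> where "\<rho> = sqrt (1 / 2)"
  define \<beta> where "\<beta> = decay d k"
  let ?M = "cubes d {..n}"
  let ?L = "dir_lists d k"
  \<comment> \<open>A rational bound on \<open>sqrt (1 / 2)\<close> for which
    \<open>2 / (1 - \<rho>) \<le> 8\<close>; with the \<open>2 ^ d\<close> of the multinomial bound
    this gives \<open>16 ^ d\<close>.\<close>
  have \<rho>: "0 \<le> \<rho>" "\<rho> \<le> 3 / 4"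
  proof -
    show "\<rho> \<le> 3 / 4" unfolding \<rho>_def by (rule real_le_lsqrt) (auto simp: power2_eq_square)
  qed (simp add: \<rho>_def)
  define S where "S = (\<Sum>qs\<in>?L. \<Sum>qs'\<in>?L. (\<Prod>l<d. (1 / 2 :: real) ^ max (count_list qs l) (count_list qs' l)))"
  have S0: "S \<ge> 0" by (auto simp: S_def intro!: sum_nonneg prod_nonneg)
  have one: "(\<integral>\<^sup>+X. ennreal ((forest_weight d k X (X n) i)\<^sup>2) \<partial>?M) \<le> ennreal (exp 6 * S / (real d ^ k)\<^sup>2)" if i: "i < n" for i
  proof -
    have m: "(\<lambda>X. both_mates i n qs qs' X :: ennreal) \<in> borel_measurable ?M"
      if "qs \<in> ?L" "qs' \<in> ?L" for qs qs'
      using that by (intro borel_measurable_times_ennreal measurable_mate_indicator) (auto simp: dir_lists_def)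
    have "(\<integral>\<^sup>+X. ennreal ((forest_weight d k X (X n) i)\<^sup>2) \<partial>?M) =
      (\<integral>\<^sup>+X. ennreal (1 / (real d ^ k)\<^sup>2) * (\<Sum>qs\<in>?L. \<Sum>qs'\<in>?L. both_mates i n qs qs' X) \<partial>?M)"
    proof (rule nn_integral_cong)
      fix X
      have "(forest_weight d k X (X n) i)\<^sup>2 =
        1 / (real d ^ k)\<^sup>2 * (\<Sum>qs\<in>?L. \<Sum>qs'\<in>?L. both_mates i n qs qs' X)"
        unfolding forest_weight_def n_def power_divide power2_eq_square[of "sum _ _"] sum_product by simp
      then have "ennreal ((forest_weight d k X (X n) i)\<^sup>2) = ennreal (1 / (real d ^ k)\<^sup>2) *
         ennreal (\<Sum>qs\<in>?L. \<Sum>qs'\<in>?L. both_mates i n qs qs' X)"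
        by (simp only:) (rule ennreal_mult, auto intro!: sum_nonneg)
      also have "ennreal (\<Sum>qs\<in>?L. \<Sum>qs'\<in>?L. both_mates i n qs qs' X) =
          (\<Sum>qs\<in>?L. \<Sum>qs'\<in>?L. ennreal (both_mates i n qs qs' X))"
        by (subst sum_ennreal[symmetric], force intro!: sum_nonneg, intro sum.cong refl, subst sum_ennreal) auto
      also have "\<dots> = (\<Sum>qs\<in>?L. \<Sum>qs'\<in>?L. both_mates i n qs qs' X)"
        by (intro sum.cong refl) auto
      finally show "ennreal ((forest_weight d k X (X n) i)\<^sup>2) =
        ennreal (1 / (real d ^ k)\<^sup>2) * (\<Sum>qs\<in>?L. \<Sum>qs'\<in>?L. both_mates i n qs qs' X)" .
    qed
    also have "\<dots> = ennreal (1 / (real d ^ k)\<^sup>2) *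
       (\<integral>\<^sup>+X. (\<Sum>qs\<in>?L. \<Sum>qs'\<in>?L. both_mates i n qs qs' X) \<partial>?M)"
      by (intro nn_integral_cmult borel_measurable_sum m)
    also have "(\<integral>\<^sup>+X. (\<Sum>qs\<in>?L. \<Sum>qs'\<in>?L. both_mates i n qs qs' X) \<partial>?M) =
       (\<Sum>qs\<in>?L. \<integral>\<^sup>+X. (\<Sum>qs'\<in>?L. both_mates i n qs qs' X) \<partial>?M)"
      by (intro nn_integral_sum borel_measurable_sum m)
    also have "\<dots> = (\<Sum>qs\<in>?L. \<Sum>qs'\<in>?L. \<integral>\<^sup>+X. both_mates i n qs qs' X \<partial>?M)"
      by (intro sum.cong refl nn_integral_sum m)
    also have "\<dots> \<le> (\<Sum>qs\<in>?L. \<Sum>qs'\<in>?L. ennreal (exp 6 * (\<Prod>l<d. (1 / 2) ^ max (count_list qs l) (count_list qs' l))))"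
      using i by (intro sum_mono two_mates_probability) (auto simp: dir_lists_def n_def)
    also have "\<dots> = ennreal (exp 6 * S)"
      by (simp add: S_def sum_distrib_left sum_nonneg prod_nonneg)
    finally show ?thesis
      using S0 by (simp add: ennreal_mult[symmetric] mult_left_mono)
  qed
  have "(\<Sum>i<n. \<integral>\<^sup>+X. ennreal ((forest_weight d k X (X n) i)\<^sup>2) \<partial>?M) \<le> (\<Sum>i<n. ennreal (exp 6 * S / (real d ^ k)\<^sup>2))"
    by (intro sum_mono one) auto
  also have "\<dots> = ennreal (real n * (exp 6 * S / (real d ^ k)\<^sup>2))"
    using S0 by (intro sum_const_ennreal) simp
  also have "\<dots> \<le> ennreal (exp 6 * 16 ^ d * \<beta>)"
  proof (rule ennreal_leI)
    have "real n * S = (\<Sum>qs\<in>?L. \<Sum>qs'\<in>?L. 2 ^ k * (\<Prod>l<d. (1 / 2 :: real) ^ max (count_list qs l) (count_list qs' l)))"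
      by (simp add: S_def n_def sum_distrib_left)
    also have "\<dots> = (\<Sum>qs\<in>?L. \<Sum>qs'\<in>?L. \<Prod>l<d. \<rho> ^ ((count_list qs l - count_list qs' l) + (count_list qs' l - count_list qs l)))"
      unfolding \<rho>_def by (intro sum.cong refl half_power_max sum_count_list_dirs)
    also have "\<dots> = (\<Sum>qs'\<in>?L. \<Sum>qs\<in>?L. \<Prod>l<d. \<rho> ^ ((count_list qs l - count_list qs' l) + (count_list qs' l - count_list qs l)))"
      by (rule sum.swap)
    also have "\<dots> \<le> (\<Sum>qs'\<in>?L. real d ^ k * (2 ^ d * \<beta>) * (2 / (1 - \<rho>)) ^ d)"
      unfolding \<beta>_def using \<rho> by (intro sum_mono sum_dirs_collision_le d) auto
    also have "\<dots> \<le> (\<Sum>qs'\<in>?L. real d ^ k * (2 ^ d * \<beta>) * 8 ^ d)"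
    proof (intro sum_mono mult_left_mono power_mono)
      show "2 / (1 - \<rho>) \<le> 8" using \<rho> by (simp add: field_simps)
    qed (use \<rho> in \<open>auto simp: \<beta>_def\<close>)
    also have "\<dots> = (real d ^ k)\<^sup>2 * (16 ^ d * \<beta>)"
      by (simp add: card_dir_lists power2_eq_square power_mult_distrib[symmetric] mult_ac)
    finally have "real n * S \<le> (real d ^ k)\<^sup>2 * (16 ^ d * \<beta>)" .
    then have "real n * S / (real d ^ k)\<^sup>2 \<le> 16 ^ d * \<beta>" using d by (simp add: field_simps)
    then have "exp 6 * (real n * S / (real d ^ k)\<^sup>2) \<le> exp 6 * (16 ^ d * \<beta>)" by (rule mult_left_mono) simp
    then show "real n * (exp 6 * S / (real d ^ k)\<^sup>2) \<le> exp 6 * 16 ^ d * \<beta>" by (simp add: mult_ac)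
  qed
  finally show ?thesis by (simp add: n_def \<beta>_def)
qed

section \<open>Regression noise\<close>

lemma abs_diff_le_sum_partial_derivs:
  assumes f: "bounded_partial_derivs d f" and x: "x \<in> cube d" and y: "y \<in> cube d"
  shows "\<bar>f y - f x\<bar> \<le> (\<Sum>l<d. sup_norm d (partial_deriv f l) * \<bar>y l - x l\<bar>)"
proof -
  define z where "z m = (\<lambda>l. if l < m then y l else x l)" for m :: nat
  have zc: "(z m)(l := t) \<in> cube d" if "t \<in> {0..1}" "l < d" for m l t
    using x y that by (auto simp: z_def cube_def PiE_iff extensional_def)
  have step: "\<bar>f (z (Suc m)) - f (z m)\<bar> \<le> sup_norm d (partial_deriv f m) * \<bar>y m - x m\<bar>" if m: "m < d" for m
  proof -
    define g where "g = (\<lambda>t. f ((z m)(m := t)))"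
    have der: "(g has_derivative (\<lambda>h. h *\<^sub>R partial_deriv f m ((z m)(m := t)))) (at t within {0..1})" if t: "t \<in> {0..1}" for t
    proof -
      have "(\<lambda>s. f (((z m)(m := t))(m := s))) differentiable (at (((z m)(m := t)) m) within {0..1})"
        using f m zc[OF t m, of m] unfolding bounded_partial_derivs_def by blast
      then show ?thesis
        by (simp add: vector_derivative_works has_vector_derivative_def partial_deriv_def g_def)
    qed
    have bd: "bdd_above ((\<lambda>x. \<bar>partial_deriv f m x\<bar>) ` cube d)"
    proof -
      have "bounded (partial_deriv f m ` cube d)" using f m unfolding bounded_partial_derivs_def by blast
      then obtain B where "\<And>v. v \<in> partial_deriv f m ` cube d \<Longrightarrow> norm v \<le> B" unfolding bounded_iff by blast
      then show ?thesis by (intro bdd_aboveI[of _ B]) auto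
    qed
    have xy: "x m \<in> {0..1}" "y m \<in> {0..1}" using x y m by (auto simp: cube_def PiE_iff)
    have "norm (g (y m) - g (x m)) \<le> sup_norm d (partial_deriv f m) * norm (y m - x m)"
    proof (rule differentiable_bound[OF _ der])
      fix t :: real assume t: "t \<in> {0..1}"
      have "norm (h *\<^sub>R partial_deriv f m ((z m)(m := t))) \<le> sup_norm d (partial_deriv f m) * norm h" for h :: real
        unfolding sup_norm_def using cSUP_upper[OF zc[OF t m, of m] bd]
        by (simp add: abs_mult mult.commute mult_left_mono)
      then show "onorm (\<lambda>h. h *\<^sub>R partial_deriv f m ((z m)(m := t))) \<le> sup_norm d (partial_deriv f m)"
        by (intro onorm_le) auto
    qed (use xy in auto)
    moreover have "(z m)(m := x m) = z m" "(z m)(m := y m) = z (Suc m)" by (auto simp: z_def fun_eq_iff)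
    ultimately show ?thesis by (simp add: g_def)
  qed
  have tel: "\<bar>f (z m) - f (z 0)\<bar> \<le> (\<Sum>l<m. sup_norm d (partial_deriv f l) * \<bar>y l - x l\<bar>)" if "m \<le> d" for m
    using that
  proof (induction m)
    case (Suc m)
    then show ?case using step[of m] by simp
  qed simp
  have "z 0 = x" by (simp add: z_def)
  moreover have "z d = y" using x y by (auto simp: z_def cube_def PiE_iff extensional_def fun_eq_iff)
  ultimately show ?thesis using tel[of d] by simp
qed

section \<open>Locality, range and measurability of the weights\<close>

lemma mate_cong:
  assumes "\<And>j. j \<in> S \<Longrightarrow> X j = X' j"
  shows "mate X i x qs S = mate X' i x qs S"
  using assms
proof (induction qs arbitrary: S)
  case (Cons q qs)
  have IH: "mate X i x qs L = mate X' i x qs L" if "L \<subseteq> S" for L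
    using that by (intro Cons.IH Cons.prems) auto
  show ?case
    unfolding mate.simps
  proof (rule bex_cong[OF refl])
    fix L assume L: "L \<in> Pow S"
    have 1: "(\<forall>j\<in>L. \<forall>j'\<in>S - L. X j q < X j' q) = (\<forall>j\<in>L. \<forall>j'\<in>S - L. X' j q < X' j' q)"
      using L Cons.prems by (intro ball_cong refl) auto
    have 2: "(\<forall>j'\<in>S - L. \<exists>j\<in>L. 2 * x q \<le> X j q + X j' q) = (\<forall>j'\<in>S - L. \<exists>j\<in>L. 2 * x q \<le> X' j q + X' j' q)"
      using L Cons.prems by (intro ball_cong bex_cong refl) auto
    have "L \<subseteq> S" "S - L \<subseteq> S" using L by auto
    then show "(2 * card L = card S \<and> (\<forall>j\<in>L. \<forall>j'\<in>S - L. X j q < X j' q) \<and>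
       (if \<forall>j'\<in>S - L. \<exists>j\<in>L. 2 * x q \<le> X j q + X j' q then mate X i x qs L else mate X i x qs (S - L))) =
      (2 * card L = card S \<and> (\<forall>j\<in>L. \<forall>j'\<in>S - L. X' j q < X' j' q) \<and>
       (if \<forall>j'\<in>S - L. \<exists>j\<in>L. 2 * x q \<le> X' j q + X' j' q then mate X' i x qs L else mate X' i x qs (S - L)))"
      unfolding 1 2 by (simp only: IH)
  qed
qed simp

lemma forest_weight_cong:
  assumes "\<And>j. j < 2 ^ k \<Longrightarrow> X j = X' j"
  shows "forest_weight d k X x i = forest_weight d k X' x i"
  unfolding forest_weight_def using mate_cong[of "{..<2 ^ k}" X X'] assms by simp

lemma forest_weight_nonneg: "0 \<le> forest_weight d k X x i"
  by (simp add: forest_weight_def sum_nonneg del: sum_of_bool_eq)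

lemma forest_weight_le_1: "d \<ge> 1 \<Longrightarrow> forest_weight d k X x i \<le> 1"
proof -
  assume d: "d \<ge> 1"
  have "(\<Sum>qs\<in>dir_lists d k. of_bool (mate X i x qs {..<2 ^ k})) \<le> (\<Sum>qs\<in>dir_lists d k. 1 :: real)"
    by (intro sum_mono) auto
  then show ?thesis using d unfolding forest_weight_def by (simp add: card_dir_lists del: sum_of_bool_eq)
qed

lemma measurable_forest_weight:
  "(\<lambda>X. forest_weight d k X (X (2 ^ k)) i) \<in> borel_measurable (cubes d {..2 ^ k})"
proof -
  have "(\<lambda>X. of_bool (mate X i (X (2 ^ k)) qs {..<2 ^ k}) :: real) \<in> borel_measurable (cubes d {..2 ^ k})"
    if "qs \<in> dir_lists d k" for qs
  proof -
    have "Measurable.pred (cubes d {..2 ^ k}) (\<lambda>X. mate X i (X (2 ^ k)) qs {..<2 ^ k})"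
      using that by (intro measurable_mate) (auto simp: dir_lists_def)
    then show ?thesis
      unfolding of_bool_def pred_def by (intro measurable_If measurable_const) simp_all
  qed
  then show ?thesis
    unfolding forest_weight_def by (intro borel_measurable_divide borel_measurable_sum borel_measurable_const)
qed

text \<open>The weights form a probability vector, and the weighted variance of \<open>b\<close> is
  nonnegative.\<close>

lemma weighted_square_le:
  fixes w b :: "'a \<Rightarrow> real"
  assumes "\<And>i. i \<in> A \<Longrightarrow> 0 \<le> w i" "(\<Sum>i\<in>A. w i) = 1"
  shows "(\<Sum>i\<in>A. w i * b i)\<^sup>2 \<le> (\<Sum>i\<in>A. w i * (b i)\<^sup>2)"
proof -
  define m where "m = (\<Sum>i\<in>A. w i * b i)"
  have "0 \<le> (\<Sum>i\<in>A. w i * (b i - m)\<^sup>2)" using assms(1) by (intro sum_nonneg) auto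
  also have "\<dots> = (\<Sum>i\<in>A. w i * (b i)\<^sup>2 - 2 * m * (w i * b i) + m\<^sup>2 * w i)"
    by (intro sum.cong) (simp_all add: power2_eq_square algebra_simps)
  also have "\<dots> = (\<Sum>i\<in>A. w i * (b i)\<^sup>2) - m\<^sup>2"
    by (simp add: sum.distrib sum_subtractf sum_distrib_left[symmetric] assms(2) m_def[symmetric] power2_eq_square)
  finally show ?thesis by (simp add: m_def)
qed

context
  fixes d P f \<sigma>
  assumes model: "regression_model d P f \<sigma>"
begin

lemma prob_space_P: "prob_space P"
  using model by (simp add: regression_model_def)

lemma sets_P: "sets P = sets (uniform_cube d \<Otimes>\<^sub>M borel)"
  using model by (simp add: regression_model_def)

lemma measurable_fst_P: "fst \<in> measurable P (uniform_cube d)"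
  using measurable_fst by (simp add: measurable_cong_sets[OF sets_P refl])

lemma measurable_noise: "noise f \<in> borel_measurable P"
proof -
  have f: "f \<in> borel_measurable (uniform_cube d)" using model by (simp add: regression_model_def)
  have "(\<lambda>z. snd z - f (fst z)) \<in> borel_measurable (uniform_cube d \<Otimes>\<^sub>M borel)"
    by (intro borel_measurable_diff measurable_snd measurable_compose[OF measurable_fst f])
  then show ?thesis
    by (simp add: measurable_cong_sets[OF sets_P refl] noise_def case_prod_unfold)
qed

lemma subalgebra_sigma_X: "subalgebra P (sigma_X d P)"
proof -
  have f: "fst \<in> space P \<rightarrow> space (uniform_cube d)"
    using measurable_space[OF measurable_fst_P] by blast
  show ?thesis
    unfolding subalgebra_def sigma_X_def sets_vimage_algebra2[OF f]
    using measurable_sets[OF measurable_fst_P] by auto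
qed

lemma measurable_sigma_X: "h \<in> measurable (uniform_cube d) N \<Longrightarrow> (\<lambda>z. h (fst z)) \<in> measurable (sigma_X d P) N"
  unfolding sigma_X_def
  by (rule measurable_compose[OF measurable_vimage_algebra1]) (auto intro: measurable_space[OF measurable_fst_P])

lemma sigma_finite_sigma_X: "sigma_finite_subalgebra P (sigma_X d P)"
proof -
  interpret prob_space P by (rule prob_space_P)
  show ?thesis
    by (intro finite_measure_subalgebra_is_sigma_finite finite_measure_subalgebra.intro
        finite_measure_subalgebra_axioms.intro subalgebra_sigma_X finite_measure_axioms)
qed

lemma integrable_noise: "integrable P (noise f)"
proof -
  interpret sigma_finite_subalgebra P "sigma_X d P" by (rule sigma_finite_sigma_X)
  have snd: "integrable P snd" and ae: "AE z in P. real_cond_exp P (sigma_X d P) snd z = f (fst z)"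
    and f: "f \<in> borel_measurable (uniform_cube d)"
    using model by (auto simp: regression_model_def)
  have "integrable P (\<lambda>z. f (fst z))"
    using real_cond_exp_int(1)[OF snd] ae
    by (subst integrable_cong_AE[where g = "real_cond_exp P (sigma_X d P) snd"])
       (auto intro: measurable_compose[OF measurable_fst_P f])
  then have "integrable P (\<lambda>z. snd z - f (fst z))" using snd by (intro Bochner_Integration.integrable_diff)
  then show ?thesis by (simp add: noise_def case_prod_unfold)
qed

lemma integral_times_noise:
  fixes h :: "(nat \<Rightarrow> real) \<Rightarrow> real"
  assumes h: "h \<in> borel_measurable (uniform_cube d)" and int: "integrable P (\<lambda>z. h (fst z) * noise f z)"
  shows "(\<integral>z. h (fst z) * noise f z \<partial>P) = 0"
proof -
  interpret sigma_finite_subalgebra P "sigma_X d P" by (rule sigma_finite_sigma_X)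
  have "(\<integral>z. h (fst z) * noise f z \<partial>P) = (\<integral>z. h (fst z) * real_cond_exp P (sigma_X d P) (noise f) z \<partial>P)"
    by (rule real_cond_exp_intg(2)[OF int measurable_sigma_X[OF h] measurable_noise, symmetric])
  also have "\<dots> = (\<integral>z. 0 \<partial>P)"
  proof (rule integral_cong_AE)
    have "AE z in P. real_cond_exp P (sigma_X d P) (noise f) z = 0" using model by (simp add: regression_model_def)
    then show "AE z in P. h (fst z) * real_cond_exp P (sigma_X d P) (noise f) z = 0" by eventually_elim simp
  qed (auto intro!: borel_measurable_times measurable_compose[OF measurable_fst_P h])
  finally show ?thesis by simp
qed

text \<open>The conditional mean of the noise vanishes, so \<open>cond_variance\<close> is a
  conditional second moment, and the factor \<open>h (fst z)\<close> may be taken out. Nonnegative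
  integrals are used because integrability of the squared noise is only a consequence.\<close>

lemma nn_integral_times_noise_square:
  fixes h :: "(nat \<Rightarrow> real) \<Rightarrow> ennreal"
  assumes h: "h \<in> borel_measurable (uniform_cube d)"
  shows "(\<integral>\<^sup>+z. h (fst z) * ennreal ((noise f z)\<^sup>2) \<partial>P) \<le> ennreal (\<sigma>\<^sup>2) * (\<integral>\<^sup>+y. h y \<partial>uniform_cube d)"
proof -
  interpret sigma_finite_subalgebra P "sigma_X d P" by (rule sigma_finite_sigma_X)
  let ?g = "\<lambda>z. ennreal ((noise f z - real_cond_exp P (sigma_X d P) (noise f) z)\<^sup>2)"
  have g: "?g \<in> borel_measurable P"
    by (intro measurable_compose[OF _ measurable_ennreal] borel_measurable_power borel_measurable_diff measurable_noise borel_measurable_cond_exp2)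
  have hP: "(\<lambda>z. h (fst z)) \<in> borel_measurable P" by (rule measurable_compose[OF measurable_fst_P h])
  have "AE z in P. real_cond_exp P (sigma_X d P) (noise f) z = 0" using model by (simp add: regression_model_def)
  then have "AE z in P. h (fst z) * ennreal ((noise f z)\<^sup>2) = h (fst z) * ?g z" by eventually_elim simp
  then have "(\<integral>\<^sup>+z. h (fst z) * ennreal ((noise f z)\<^sup>2) \<partial>P) = (\<integral>\<^sup>+z. h (fst z) * ?g z \<partial>P)"
    by (rule nn_integral_cong_AE)
  also have "\<dots> = (\<integral>\<^sup>+z. h (fst z) * nn_cond_exp P (sigma_X d P) ?g z \<partial>P)"
    by (rule nn_cond_exp_intg[OF measurable_sigma_X[OF h] g, symmetric])
  also have "\<dots> \<le> (\<integral>\<^sup>+z. ennreal (\<sigma>\<^sup>2) * h (fst z) \<partial>P)"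
  proof (rule nn_integral_mono_AE)
    have "AE z in P. cond_variance P (sigma_X d P) (noise f) z \<le> ennreal (\<sigma>\<^sup>2)"
      using model by (simp add: regression_model_def)
    then show "AE z in P. h (fst z) * nn_cond_exp P (sigma_X d P) ?g z \<le> ennreal (\<sigma>\<^sup>2) * h (fst z)"
      by eventually_elim (simp add: cond_variance_def mult.commute[of "ennreal (\<sigma>\<^sup>2)"] mult_left_mono)
  qed
  also have "\<dots> = ennreal (\<sigma>\<^sup>2) * (\<integral>\<^sup>+z. h (fst z) \<partial>P)" by (rule nn_integral_cmult[OF hP])
  also have "(\<integral>\<^sup>+z. h (fst z) \<partial>P) = (\<integral>\<^sup>+y. h y \<partial>distr P (uniform_cube d) fst)"
    by (rule nn_integral_distr[symmetric, OF measurable_fst_P]) (simp add: h)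
  also have "distr P (uniform_cube d) fst = uniform_cube d" using model by (simp add: regression_model_def)
  finally show ?thesis .
qed

lemma distr_inputs:
  assumes "finite I"
  shows "distr (PiM I (\<lambda>_. P)) (cubes d I) (compose I fst) = cubes d I"
proof -
  have "distr (PiM I (\<lambda>_. P)) (cubes d I) (compose I fst) = PiM I (\<lambda>_. distr P (uniform_cube d) fst)"
    using assms by (intro distr_PiM_finite_prob_space') (auto intro: prob_space_P prob_space_uniform_cube measurable_fst_P)
  then show ?thesis using model by (simp add: regression_model_def)
qed

lemma measurable_inputs: "compose I fst \<in> measurable (PiM I (\<lambda>_. P)) (cubes d I)"
  unfolding compose_def
proof (rule measurable_restrict)
  fix i assume "i \<in> I"
  then have "(\<lambda>D. D i) \<in> measurable (PiM I (\<lambda>_. P)) P" by (rule measurable_component_singleton)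
  from measurable_compose[OF this measurable_fst_P]
  show "(\<lambda>D. fst (D i)) \<in> measurable (PiM I (\<lambda>_. P)) (uniform_cube d)" .
qed

lemma measurable_noise_component: "j \<in> I \<Longrightarrow> (\<lambda>D. noise f (D j)) \<in> borel_measurable (PiM I (\<lambda>_. P))"
proof -
  assume "j \<in> I"
  then have "(\<lambda>D. D j) \<in> measurable (PiM I (\<lambda>_. P)) P" by (rule measurable_component_singleton)
  from measurable_compose[OF this measurable_noise] show ?thesis .
qed

lemma compose_fst_upd: "D \<in> extensional I \<Longrightarrow> compose (insert i I) fst (D(i := z)) = (compose (insert i I) fst D)(i := fst z)"
  by (auto simp: compose_def fun_eq_iff)

interpretation PP: product_sigma_finite "\<lambda>_::nat. P"
  by (intro product_sigma_finite.intro prob_space_imp_sigma_finite prob_space_P)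

text \<open>In the integral over the \<open>i\<close>-th pair, the other pairs being fixed, the
  weight is a function of the input \<open>fst (D i)\<close> alone; the conditional variance bound
  applies even though the weight depends on the input of its own observation.\<close>

lemma weighted_noise_square_le:
  fixes w :: "(nat \<Rightarrow> nat \<Rightarrow> real) \<Rightarrow> real"
  assumes fin: "finite I" and i: "i \<in> I" and w: "w \<in> borel_measurable (cubes d I)"
  shows "(\<integral>\<^sup>+D. ennreal ((w (compose I fst D) * noise f (D i))\<^sup>2) \<partial>PiM I (\<lambda>_. P))
    \<le> ennreal (\<sigma>\<^sup>2) * (\<integral>\<^sup>+X. ennreal ((w X)\<^sup>2) \<partial>cubes d I)"
proof -
  define I' where "I' = I - {i}"
  have I: "I = insert i I'" and I': "finite I'" "i \<notin> I'" using i fin by (auto simp: I'_def)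
  let ?w = "\<lambda>D. ennreal ((w (compose I fst D))\<^sup>2)"
  have wm: "(\<lambda>X. ennreal ((w X)\<^sup>2)) \<in> borel_measurable (cubes d I)" using w by measurable
  have wP: "?w \<in> borel_measurable (PiM I (\<lambda>_. P))"
    by (rule measurable_compose[OF measurable_inputs wm])
  have sq: "(\<lambda>D. ennreal ((noise f (D i))\<^sup>2)) \<in> borel_measurable (PiM I (\<lambda>_. P))"
    using measurable_noise_component[OF i] by measurable
  have "(\<integral>\<^sup>+D. ennreal ((w (compose I fst D) * noise f (D i))\<^sup>2) \<partial>PiM I (\<lambda>_. P)) =
     (\<integral>\<^sup>+D. ?w D * ennreal ((noise f (D i))\<^sup>2) \<partial>PiM I (\<lambda>_. P))"
    by (intro nn_integral_cong) (simp add: power_mult_distrib ennreal_mult)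
  also have "\<dots> = (\<integral>\<^sup>+D. \<integral>\<^sup>+z. ?w (D(i := z)) * ennreal ((noise f ((D(i := z)) i))\<^sup>2) \<partial>P \<partial>PiM I' (\<lambda>_. P))"
    using wP sq unfolding I by (intro PP.product_nn_integral_insert I' borel_measurable_times_ennreal)
  also have "\<dots> \<le> (\<integral>\<^sup>+D. ennreal (\<sigma>\<^sup>2) * (\<integral>\<^sup>+z. ?w (D(i := z)) \<partial>P) \<partial>PiM I' (\<lambda>_. P))"
  proof (rule nn_integral_mono)
    fix D assume D: "D \<in> space (PiM I' (\<lambda>_. P))"
    then have De: "D \<in> extensional I'" by (simp add: space_PiM PiE_def)
    define h where "h y = ennreal ((w ((compose I fst D)(i := y)))\<^sup>2)" for y
    have cD: "compose I' fst D \<in> space (cubes d I')"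
      by (rule measurable_space[OF measurable_inputs D])
    have ceq: "(compose I fst D)(i := y) = (compose I' fst D)(i := y)" for y
      using I'(2) unfolding I by (auto simp: compose_def fun_eq_iff)
    have hm: "h \<in> borel_measurable (uniform_cube d)"
      unfolding h_def ceq by (rule measurable_compose[OF measurable_component_update[OF cD I'(2)] wm[unfolded I]])
    have hz: "?w (D(i := z)) = h (fst z)" for z
      unfolding h_def I by (simp add: compose_fst_upd[OF De])
    have "(\<integral>\<^sup>+z. ?w (D(i := z)) * ennreal ((noise f ((D(i := z)) i))\<^sup>2) \<partial>P) = (\<integral>\<^sup>+z. h (fst z) * ennreal ((noise f z)\<^sup>2) \<partial>P)"
      by (simp add: hz)
    also have "\<dots> \<le> ennreal (\<sigma>\<^sup>2) * (\<integral>\<^sup>+y. h y \<partial>uniform_cube d)" by (rule nn_integral_times_noise_square[OF hm])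
    also have "(\<integral>\<^sup>+y. h y \<partial>uniform_cube d) = (\<integral>\<^sup>+y. h y \<partial>distr P (uniform_cube d) fst)"
      using model by (simp add: regression_model_def)
    also have "\<dots> = (\<integral>\<^sup>+z. ?w (D(i := z)) \<partial>P)"
      by (subst nn_integral_distr[OF measurable_fst_P]) (simp_all add: hz hm)
    finally show "(\<integral>\<^sup>+z. ?w (D(i := z)) * ennreal ((noise f ((D(i := z)) i))\<^sup>2) \<partial>P) \<le> ennreal (\<sigma>\<^sup>2) * (\<integral>\<^sup>+z. ?w (D(i := z)) \<partial>P)" .
  qed
  also have "\<dots> \<le> ennreal (\<sigma>\<^sup>2) * (\<integral>\<^sup>+D. \<integral>\<^sup>+z. ?w (D(i := z)) \<partial>P \<partial>PiM I' (\<lambda>_. P))"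
  proof (subst nn_integral_cmult)
    have "(\<lambda>(D, z). ?w (D(i := z))) \<in> borel_measurable (PiM I' (\<lambda>_. P) \<Otimes>\<^sub>M P)"
      using measurable_compose[OF measurable_add_dim, of ?w i I' "\<lambda>_. P"] wP I by (simp add: case_prod_unfold)
    then show "(\<lambda>D. \<integral>\<^sup>+z. ?w (D(i := z)) \<partial>P) \<in> borel_measurable (PiM I' (\<lambda>_. P))"
      by (rule sigma_finite_measure.borel_measurable_nn_integral[OF prob_space_imp_sigma_finite[OF prob_space_P]])
  qed simp
  also have "(\<integral>\<^sup>+D. \<integral>\<^sup>+z. ?w (D(i := z)) \<partial>P \<partial>PiM I' (\<lambda>_. P)) = (\<integral>\<^sup>+D. ?w D \<partial>PiM I (\<lambda>_. P))"
    using wP unfolding I by (intro PP.product_nn_integral_insert[symmetric] I')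
  also have "\<dots> = (\<integral>\<^sup>+X. ennreal ((w X)\<^sup>2) \<partial>distr (PiM I (\<lambda>_. P)) (cubes d I) (compose I fst))"
    by (rule nn_integral_distr[symmetric, OF measurable_inputs]) (simp add: wm)
  finally show ?thesis unfolding distr_inputs[OF fin] .
qed

text \<open>With all pairs but the \<open>i\<close>-th fixed, \<open>noise f (D j)\<close> is a
  constant and the weight a function of the \<open>i\<close>-th input, against which the
  \<open>i\<close>-th noise integrates to 0.\<close>

lemma noise_cross_term:
  fixes w :: "(nat \<Rightarrow> nat \<Rightarrow> real) \<Rightarrow> real"
  assumes fin: "finite I" and i: "i \<in> I" and j: "j \<in> I" "i \<noteq> j"
    and w: "w \<in> borel_measurable (cubes d I)" and wB: "\<And>X. \<bar>w X\<bar> \<le> 1"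
    and int: "integrable (PiM I (\<lambda>_. P)) (\<lambda>D. w (compose I fst D) * noise f (D j) * noise f (D i))"
  shows "(\<integral>D. w (compose I fst D) * noise f (D j) * noise f (D i) \<partial>PiM I (\<lambda>_. P)) = 0"
proof -
  define I' where "I' = I - {i}"
  have I: "I = insert i I'" and I': "finite I'" "i \<notin> I'" using i fin by (auto simp: I'_def)
  let ?F = "\<lambda>D. w (compose I fst D) * noise f (D j) * noise f (D i)"
  have "(\<integral>D. ?F D \<partial>PiM I (\<lambda>_. P)) = (\<integral>D. (\<integral>z. ?F (D(i := z)) \<partial>P) \<partial>PiM I' (\<lambda>_. P))"
    using int unfolding I by (intro PP.product_integral_insert I')
  also have "\<dots> = (\<integral>D. 0 \<partial>PiM I' (\<lambda>_. P))"
  proof (rule Bochner_Integration.integral_cong[OF refl])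
    fix D assume D: "D \<in> space (PiM I' (\<lambda>_. P))"
    then have De: "D \<in> extensional I'" by (simp add: space_PiM PiE_def)
    define h where "h y = w ((compose I fst D)(i := y)) * noise f (D j)" for y
    have cD: "compose I' fst D \<in> space (cubes d I')"
      by (rule measurable_space[OF measurable_inputs D])
    have ceq: "(compose I fst D)(i := y) = (compose I' fst D)(i := y)" for y
      using I'(2) unfolding I by (auto simp: compose_def fun_eq_iff)
    have hm: "h \<in> borel_measurable (uniform_cube d)"
      unfolding h_def ceq
      by (intro borel_measurable_times borel_measurable_const measurable_compose[OF measurable_component_update[OF cD I'(2)] w[unfolded I]])
    have hz: "?F (D(i := z)) = h (fst z) * noise f z" for z
      using j unfolding h_def I by (simp add: compose_fst_upd[OF De])
    \<comment> \<open>The bound 1 on the weight makes every slice integrable, where Fubini alone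
      would give almost every one.\<close>
    have "integrable P (\<lambda>z. h (fst z) * noise f z)"
    proof (rule Bochner_Integration.integrable_bound)
      show "integrable P (\<lambda>z. \<bar>noise f (D j)\<bar> * noise f z)"
        by (intro integrable_mult_right integrable_noise)
      show "(\<lambda>z. h (fst z) * noise f z) \<in> borel_measurable P"
        by (intro borel_measurable_times measurable_noise measurable_compose[OF measurable_fst_P hm])
      show "AE z in P. norm (h (fst z) * noise f z) \<le> norm (\<bar>noise f (D j)\<bar> * noise f z)"
        using wB by (intro AE_I2) (auto simp: h_def abs_mult intro!: mult_right_mono mult_left_le_one_le)
    qed
    then show "(\<integral>z. ?F (D(i := z)) \<partial>P) = 0"
      unfolding hz by (rule integral_times_noise[OF hm])
  qed
  finally show ?thesis by simp
qed

text \<open>Expanding the square leaves the diagonal, as the cross terms integrate to 0. The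
  expansion needs integrable products; these come from the second moments, which are finite because
  the weights are bounded by 1.\<close>

lemma weighted_noise_sum_le:
  fixes w :: "nat \<Rightarrow> (nat \<Rightarrow> nat \<Rightarrow> real) \<Rightarrow> real"
  assumes fin: "finite I" and w: "\<And>i. i \<in> I \<Longrightarrow> w i \<in> borel_measurable (cubes d I)"
    and wB: "\<And>i X. \<bar>w i X\<bar> \<le> 1"
  shows "(\<integral>\<^sup>+D. ennreal ((\<Sum>i\<in>I. w i (compose I fst D) * noise f (D i))\<^sup>2) \<partial>PiM I (\<lambda>_. P))
    \<le> ennreal (\<sigma>\<^sup>2) * (\<Sum>i\<in>I. \<integral>\<^sup>+X. ennreal ((w i X)\<^sup>2) \<partial>cubes d I)"
proof -
  interpret cubesI: prob_space "cubes d I" by (intro prob_space_PiM prob_space_uniform_cube)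
  let ?M = "PiM I (\<lambda>_. P)"
  define a where "a i D = w i (compose I fst D) * noise f (D i)" for i D
  have am: "a i \<in> borel_measurable ?M" if "i \<in> I" for i
    unfolding a_def using that
    by (intro borel_measurable_times measurable_noise_component measurable_compose[OF measurable_inputs w])
  have asq: "(\<integral>\<^sup>+D. ennreal ((a i D)\<^sup>2) \<partial>?M) \<le> ennreal (\<sigma>\<^sup>2) * (\<integral>\<^sup>+X. ennreal ((w i X)\<^sup>2) \<partial>cubes d I)"
    if "i \<in> I" for i
    unfolding a_def by (rule weighted_noise_square_le[OF fin that w[OF that]])
  have wsq: "(\<integral>\<^sup>+X. ennreal ((w i X)\<^sup>2) \<partial>cubes d I) \<le> 1" for i
  proof -
    have "(\<integral>\<^sup>+X. ennreal ((w i X)\<^sup>2) \<partial>cubes d I) \<le> (\<integral>\<^sup>+X. 1 \<partial>cubes d I)"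
      using wB[of i] by (intro nn_integral_mono) (simp add: abs_square_le_1)
    then show ?thesis by (simp add: cubesI.emeasure_space_1)
  qed
  have isq: "integrable ?M (\<lambda>D. (a i D)\<^sup>2)" if i: "i \<in> I" for i
  proof (rule integrableI_nonneg)
    have "(\<integral>\<^sup>+D. ennreal ((a i D)\<^sup>2) \<partial>?M) \<le> ennreal (\<sigma>\<^sup>2) * 1"
      using asq[OF i] wsq[of i] by (meson mult_left_mono order_trans zero_le)
    also have "\<dots> < \<infinity>" by simp
    finally show "(\<integral>\<^sup>+D. ennreal ((a i D)\<^sup>2) \<partial>?M) < \<infinity>" .
  qed (use am[OF i] in auto)
  have ij: "integrable ?M (\<lambda>D. a i D * a j D)" if "i \<in> I" "j \<in> I" for i j
  proof (rule Bochner_Integration.integrable_bound)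
    show "integrable ?M (\<lambda>D. (a i D)\<^sup>2 + (a j D)\<^sup>2)"
      by (intro Bochner_Integration.integrable_add isq that)
    show "(\<lambda>D. a i D * a j D) \<in> borel_measurable ?M" by (intro borel_measurable_times am that)
    show "AE D in ?M. norm (a i D * a j D) \<le> norm ((a i D)\<^sup>2 + (a j D)\<^sup>2)"
    proof (rule AE_I2)
      fix D
      have "2 * (\<bar>a i D\<bar> * \<bar>a j D\<bar>) \<le> \<bar>a i D\<bar>\<^sup>2 + \<bar>a j D\<bar>\<^sup>2"
        using sum_squares_bound[of "\<bar>a i D\<bar>" "\<bar>a j D\<bar>"] by (simp add: mult.assoc)
      moreover have "0 \<le> \<bar>a i D\<bar> * \<bar>a j D\<bar>" by simp
      ultimately have "\<bar>a i D\<bar> * \<bar>a j D\<bar> \<le> (a i D)\<^sup>2 + (a j D)\<^sup>2" unfolding power2_abs by linarith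
      then show "norm (a i D * a j D) \<le> norm ((a i D)\<^sup>2 + (a j D)\<^sup>2)" by (simp add: abs_mult)
    qed
  qed
  have cross: "(\<integral>D. a i D * a j D \<partial>?M) = 0" if "i \<in> I" "j \<in> I" "i \<noteq> j" for i j
  proof -
    let ?w = "\<lambda>X. w i X * w j X"
    have eq: "a i D * a j D = ?w (compose I fst D) * noise f (D j) * noise f (D i)" for D
      by (simp add: a_def)
    have "\<bar>?w X\<bar> \<le> 1" for X
      using mult_mono[OF wB[of i X] wB[of j X]] by (simp add: abs_mult)
    then show ?thesis
      unfolding eq using ij[OF that(1,2)] unfolding eq
      by (intro noise_cross_term fin that borel_measurable_times w)
  qed
  have "(\<integral>\<^sup>+D. ennreal ((\<Sum>i\<in>I. a i D)\<^sup>2) \<partial>?M) = ennreal (\<integral>D. (\<Sum>i\<in>I. a i D)\<^sup>2 \<partial>?M)"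
    unfolding power2_eq_square sum_product
    by (intro nn_integral_eq_integral Bochner_Integration.integrable_sum ij) (auto simp: sum_product[symmetric])
  also have "(\<integral>D. (\<Sum>i\<in>I. a i D)\<^sup>2 \<partial>?M) = (\<Sum>i\<in>I. \<Sum>j\<in>I. \<integral>D. a i D * a j D \<partial>?M)"
    unfolding power2_eq_square sum_product
    by (simp add: Bochner_Integration.integral_sum Bochner_Integration.integrable_sum ij)
  also have "\<dots> = (\<Sum>i\<in>I. \<Sum>j\<in>I. if i = j then (\<integral>D. (a i D)\<^sup>2 \<partial>?M) else 0)"
    by (intro sum.cong refl) (auto simp: cross power2_eq_square)
  also have "\<dots> = (\<Sum>i\<in>I. \<integral>D. (a i D)\<^sup>2 \<partial>?M)"
    using fin by simp
  also have "ennreal \<dots> = (\<Sum>i\<in>I. ennreal (\<integral>D. (a i D)\<^sup>2 \<partial>?M))"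
    by (intro sum_ennreal[symmetric]) simp
  also have "\<dots> = (\<Sum>i\<in>I. \<integral>\<^sup>+D. ennreal ((a i D)\<^sup>2) \<partial>?M)"
    by (intro sum.cong refl nn_integral_eq_integral[symmetric] isq) auto
  also have "\<dots> \<le> (\<Sum>i\<in>I. ennreal (\<sigma>\<^sup>2) * (\<integral>\<^sup>+X. ennreal ((w i X)\<^sup>2) \<partial>cubes d I))"
    by (intro sum_mono asq)
  finally show ?thesis by (simp add: a_def sum_distrib_left)
qed

end

section \<open>The excess risk\<close>

lemma ennreal_plus_sum_mult:
  assumes "0 \<le> a" "\<And>l. l \<in> A \<Longrightarrow> 0 \<le> c l" "\<And>l. l \<in> A \<Longrightarrow> 0 \<le> s l"
  shows "ennreal (2 * a + (\<Sum>l\<in>A. c l * s l)) = 2 * ennreal a + (\<Sum>l\<in>A. ennreal (c l) * ennreal (s l))"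
proof -
  have "(\<Sum>l\<in>A. ennreal (c l) * ennreal (s l)) = (\<Sum>l\<in>A. ennreal (c l * s l))"
    using assms by (intro sum.cong refl) (simp add: ennreal_mult)
  also have "\<dots> = ennreal (\<Sum>l\<in>A. c l * s l)" using assms by (intro sum_ennreal) simp
  moreover have "ennreal (2 * a + (\<Sum>l\<in>A. c l * s l)) = ennreal (2 * a) + ennreal (\<Sum>l\<in>A. c l * s l)"
    using assms by (intro ennreal_plus sum_nonneg) auto
  ultimately show ?thesis using assms(1) by (simp add: ennreal_mult)
qed

context
  fixes d P f \<sigma> and k :: nat
  assumes model: "regression_model d P f \<sigma>" and d: "d \<ge> 1"
begin

abbreviation "sample \<equiv> PiM {..<2 ^ k} (\<lambda>_. P)"
abbreviation "inputs \<equiv> cubes d {..2 ^ k}"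

text \<open>The test point is stored as the point with index \<open>2 ^ k\<close>.\<close>

definition all_inputs :: "training_set \<times> (nat \<Rightarrow> real) \<Rightarrow> nat \<Rightarrow> nat \<Rightarrow> real" where
  "all_inputs z = (compose {..<2 ^ k} fst (fst z))(2 ^ k := snd z)"

lemma all_inputs_simps [simp]: "all_inputs (D, x) (2 ^ k) = x" "i < 2 ^ k \<Longrightarrow> all_inputs (D, x) i = fst (D i)"
  by (simp_all add: all_inputs_def compose_def)

lemma atMost_insert: "{..2 ^ k} = insert (2 ^ k) {..<2 ^ k :: nat}"
  by auto

lemma measurable_all_inputs: "all_inputs \<in> measurable (sample \<Otimes>\<^sub>M uniform_cube d) inputs"
  unfolding all_inputs_def
  by (rule measurable_fun_upd[where J = "{..<2 ^ k}"])
     (auto intro: measurable_compose[OF measurable_fst measurable_inputs[OF model]])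

text \<open>The training inputs and the test point together are \<open>2 ^ k + 1\<close> independent
  uniform points, the setting of the moment bounds.\<close>

lemma nn_integral_all_inputs:
  assumes g: "g \<in> borel_measurable inputs"
  shows "(\<integral>\<^sup>+z. g (all_inputs z) \<partial>(sample \<Otimes>\<^sub>M uniform_cube d)) = (\<integral>\<^sup>+X. g X \<partial>inputs)"
proof -
  define H where "H X = (\<integral>\<^sup>+x. g (X(2 ^ k := x)) \<partial>uniform_cube d)" for X
  have H: "H \<in> borel_measurable (cubes d {..<2 ^ k})"
  proof -
    have "(\<lambda>(X, x). g (X(2 ^ k := x))) \<in> borel_measurable (cubes d {..<2 ^ k} \<Otimes>\<^sub>M uniform_cube d)"
      using measurable_compose[OF measurable_add_dim, of g "2 ^ k" "{..<2 ^ k}" "\<lambda>_. uniform_cube d"] g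
      by (simp add: atMost_insert case_prod_unfold)
    then show ?thesis
      unfolding H_def by (rule sigma_finite_measure.borel_measurable_nn_integral[OF prob_space_imp_sigma_finite[OF prob_space_uniform_cube]])
  qed
  have "(\<integral>\<^sup>+z. g (all_inputs z) \<partial>(sample \<Otimes>\<^sub>M uniform_cube d)) =
      (\<integral>\<^sup>+D. \<integral>\<^sup>+x. g (all_inputs (D, x)) \<partial>uniform_cube d \<partial>sample)"
    by (rule sigma_finite_measure.nn_integral_fst[OF prob_space_imp_sigma_finite[OF prob_space_uniform_cube], symmetric])
       (rule measurable_compose[OF measurable_all_inputs g])
  also have "\<dots> = (\<integral>\<^sup>+D. H (compose {..<2 ^ k} fst D) \<partial>sample)"
    by (simp add: H_def all_inputs_def)
  also have "\<dots> = (\<integral>\<^sup>+X. H X \<partial>distr sample (cubes d {..<2 ^ k}) (compose {..<2 ^ k} fst))"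
    by (rule nn_integral_distr[symmetric, OF measurable_inputs[OF model]]) (simp add: H)
  also have "\<dots> = (\<integral>\<^sup>+X. H X \<partial>cubes d {..<2 ^ k})"
    by (simp add: distr_inputs[OF model])
  also have "\<dots> = (\<integral>\<^sup>+X. g X \<partial>inputs)"
    unfolding H_def atMost_insert using g
    by (intro points.product_nn_integral_insert[symmetric]) (auto simp: atMost_insert)
  finally show ?thesis .
qed

lemma distr_all_inputs: "distr (sample \<Otimes>\<^sub>M uniform_cube d) inputs all_inputs = inputs"
proof (rule measure_eqI)
  fix A assume "A \<in> sets (distr (sample \<Otimes>\<^sub>M uniform_cube d) inputs all_inputs)"
  then have A: "A \<in> sets inputs" by simp
  have "emeasure (distr (sample \<Otimes>\<^sub>M uniform_cube d) inputs all_inputs) A =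
      (\<integral>\<^sup>+X. indicator A X \<partial>distr (sample \<Otimes>\<^sub>M uniform_cube d) inputs all_inputs)"
    using A by simp
  also have "\<dots> = (\<integral>\<^sup>+z. indicator A (all_inputs z) \<partial>(sample \<Otimes>\<^sub>M uniform_cube d))"
    using A by (intro nn_integral_distr measurable_all_inputs) simp
  also have "\<dots> = (\<integral>\<^sup>+X. indicator A X \<partial>inputs)"
    using A by (intro nn_integral_all_inputs) simp
  finally show "emeasure (distr (sample \<Otimes>\<^sub>M uniform_cube d) inputs all_inputs) A = emeasure inputs A"
    using A by simp
qed simp

definition weight :: "training_set \<times> (nat \<Rightarrow> real) \<Rightarrow> nat \<Rightarrow> real" where
  "weight z i = forest_weight d k (all_inputs z) (all_inputs z (2 ^ k)) i"

lemma measurable_weight: "(\<lambda>z. weight z i) \<in> borel_measurable (sample \<Otimes>\<^sub>M uniform_cube d)"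
  unfolding weight_def by (rule measurable_compose[OF measurable_all_inputs measurable_forest_weight])

definition noise_part :: "training_set \<times> (nat \<Rightarrow> real) \<Rightarrow> real" where
  "noise_part z = (\<Sum>i<2 ^ k. weight z i * noise f (fst z i))"

lemma measurable_noise_part: "noise_part \<in> borel_measurable (sample \<Otimes>\<^sub>M uniform_cube d)"
  unfolding noise_part_def
  by (intro borel_measurable_sum borel_measurable_times measurable_weight
      measurable_compose[OF measurable_fst measurable_noise_component[OF model]]) auto

text \<open>The test point is integrated outermost: once it is fixed, the weights are functions of
  the training inputs, as \<open>weighted_noise_sum_le\<close> requires.\<close>

lemma nn_integral_noise_part:
  "(\<integral>\<^sup>+z. ennreal ((noise_part z)\<^sup>2) \<partial>(sample \<Otimes>\<^sub>M uniform_cube d))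
    \<le> ennreal (\<sigma>\<^sup>2) * ennreal (exp 6 * 16 ^ d * decay d k)"
proof -
  interpret PS: pair_sigma_finite sample "uniform_cube d"
    by (intro pair_sigma_finite.intro prob_space_imp_sigma_finite prob_space_uniform_cube prob_space_PiM prob_space_P[OF model])
  let ?I = "{..<2 ^ k :: nat}"
  let ?w = "\<lambda>x i X. forest_weight d k (X(2 ^ k := x)) x i"
  let ?G = "\<lambda>i X. ennreal ((forest_weight d k X (X (2 ^ k)) i)\<^sup>2)"
  have G: "?G i \<in> borel_measurable inputs" for i
    by (intro measurable_compose[OF _ measurable_ennreal] borel_measurable_power measurable_forest_weight)
  have "(\<integral>\<^sup>+z. ennreal ((noise_part z)\<^sup>2) \<partial>(sample \<Otimes>\<^sub>M uniform_cube d)) =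
      (\<integral>\<^sup>+x. \<integral>\<^sup>+D. ennreal ((noise_part (D, x))\<^sup>2) \<partial>sample \<partial>uniform_cube d)"
    by (rule PS.nn_integral_snd[symmetric])
       (intro measurable_compose[OF _ measurable_ennreal] borel_measurable_power measurable_noise_part)
  also have "\<dots> \<le> (\<integral>\<^sup>+x. ennreal (\<sigma>\<^sup>2) * (\<Sum>i\<in>?I. \<integral>\<^sup>+X. ?G i (X(2 ^ k := x)) \<partial>cubes d ?I) \<partial>uniform_cube d)"
  proof (rule nn_integral_mono)
    fix x assume x: "x \<in> space (uniform_cube d)"
    have "(\<integral>\<^sup>+D. ennreal ((noise_part (D, x))\<^sup>2) \<partial>sample) =
       (\<integral>\<^sup>+D. ennreal ((\<Sum>i\<in>?I. ?w x i (compose ?I fst D) * noise f (D i))\<^sup>2) \<partial>sample)"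
      by (simp add: noise_part_def weight_def all_inputs_def)
    also have "\<dots> \<le> ennreal (\<sigma>\<^sup>2) * (\<Sum>i\<in>?I. \<integral>\<^sup>+X. ennreal ((?w x i X)\<^sup>2) \<partial>cubes d ?I)"
    proof (rule weighted_noise_sum_le[OF model])
      fix i
      have "(\<lambda>X. X(2 ^ k := x)) \<in> measurable (cubes d ?I) inputs"
        using x by (intro measurable_fun_upd[where J = ?I]) auto
      from measurable_compose[OF this measurable_forest_weight[of d k i]]
      show "?w x i \<in> borel_measurable (cubes d ?I)" by simp
      show "\<bar>?w x i X\<bar> \<le> 1" for X using forest_weight_nonneg forest_weight_le_1[OF d] by simp
    qed simp
    finally show "(\<integral>\<^sup>+D. ennreal ((noise_part (D, x))\<^sup>2) \<partial>sample) \<le>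
        ennreal (\<sigma>\<^sup>2) * (\<Sum>i\<in>?I. \<integral>\<^sup>+X. ?G i (X(2 ^ k := x)) \<partial>cubes d ?I)" by simp
  qed
  also have "\<dots> = ennreal (\<sigma>\<^sup>2) * (\<Sum>i\<in>?I. \<integral>\<^sup>+x. \<integral>\<^sup>+X. ?G i (X(2 ^ k := x)) \<partial>cubes d ?I \<partial>uniform_cube d)"
  proof -
    have m: "(\<lambda>x. \<integral>\<^sup>+X. ?G i (X(2 ^ k := x)) \<partial>cubes d ?I) \<in> borel_measurable (uniform_cube d)" for i
    proof -
      have "(\<lambda>z. (snd z)(2 ^ k := fst z)) \<in> measurable (uniform_cube d \<Otimes>\<^sub>M cubes d ?I) inputs"
        by (intro measurable_fun_upd[where J = ?I]) auto
      from measurable_compose[OF this G[of i]]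
      have "(\<lambda>(x, X). ?G i (X(2 ^ k := x))) \<in> borel_measurable (uniform_cube d \<Otimes>\<^sub>M cubes d ?I)"
        by (simp only: case_prod_unfold)
      then show ?thesis
        by (rule sigma_finite_measure.borel_measurable_nn_integral[OF prob_space_imp_sigma_finite[OF prob_space_PiM[OF prob_space_uniform_cube]]])
    qed
    show ?thesis
      unfolding nn_integral_sum[OF m, symmetric]
      by (intro nn_integral_cmult borel_measurable_sum m)
  qed
  also have "\<dots> = ennreal (\<sigma>\<^sup>2) * (\<Sum>i\<in>?I. \<integral>\<^sup>+X. ?G i X \<partial>inputs)"
  proof (intro arg_cong2[where f="(*)"] sum.cong refl)
    fix i
    show "(\<integral>\<^sup>+x. \<integral>\<^sup>+X. ?G i (X(2 ^ k := x)) \<partial>cubes d ?I \<partial>uniform_cube d) = (\<integral>\<^sup>+X. ?G i X \<partial>inputs)"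
      using G[of i] unfolding atMost_insert
      by (intro points.product_nn_integral_insert_rev[symmetric]) auto
  qed
  also have "\<dots> \<le> ennreal (\<sigma>\<^sup>2) * ennreal (exp 6 * 16 ^ d * decay d k)"
    by (intro mult_left_mono variance_moment d) simp
  finally show ?thesis .
qed

context
  assumes f: "bounded_partial_derivs d f"
begin

text \<open>As the weights sum to 1, the error is \<open>noise_part\<close> plus a weighted mean of
  increments of \<open>f\<close>. The factor 2 comes from
  \<open>(u + v)^2 \<le> 2 u^2 + 2 v^2\<close>, which avoids a cross term, and the factor
  \<open>d\<close> from Cauchy-Schwarz over the directions.\<close>

lemma squared_error_le:
  assumes z: "z \<in> space (sample \<Otimes>\<^sub>M uniform_cube d)" and ties: "\<forall>q<d. inj_on (\<lambda>j. all_inputs z j q) {..2 ^ k}"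
  shows "ennreal ((median_forest d (2 ^ k) (fst z) (snd z) - f (snd z))\<^sup>2) \<le>
    2 * ennreal ((noise_part z)\<^sup>2) + (\<Sum>l<d. ennreal (2 * real d * (sup_norm d (partial_deriv f l))\<^sup>2) *
      (\<Sum>i<2 ^ k. ennreal (weight z i * (all_inputs z i l - all_inputs z (2 ^ k) l)\<^sup>2)))"
proof -
  obtain D x where zD: "z = (D, x)" by (cases z)
  define M where "M l = sup_norm d (partial_deriv f l)" for l
  let ?W = "weight z"
  have x: "x \<in> cube d" using z by (simp add: zD space_pair_measure space_uniform_cube)
  have X: "fst (D i) \<in> cube d" if "i < 2 ^ k" for i
  proof -
    have "D i \<in> space P" using z that by (auto simp: zD space_pair_measure space_PiM)
    then show ?thesis using measurable_space[OF measurable_fst_P[OF model]] by (simp add: space_uniform_cube)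
  qed
  have inj: "\<forall>q<d. inj_on (\<lambda>i. fst (D i) q) {..<2 ^ k}"
  proof (intro allI impI)
    fix q assume "q < d"
    then have "inj_on (\<lambda>j. all_inputs z j q) {..2 ^ k}" using ties by blast
    then have "inj_on (\<lambda>j. all_inputs z j q) {..<2 ^ k}" by (rule inj_on_subset) auto
    then show "inj_on (\<lambda>i. fst (D i) q) {..<2 ^ k}" by (simp add: zD inj_on_def)
  qed
  have W: "forest_weight d k (\<lambda>i. fst (D i)) x i = ?W i" for i
    unfolding weight_def zD by (simp add: forest_weight_cong[of k "all_inputs (D, x)" "\<lambda>i. fst (D i)"])
  have W0: "?W i \<ge> 0" for i by (simp add: weight_def forest_weight_nonneg)
  have W1: "(\<Sum>i<2 ^ k. ?W i) = 1" using sum_forest_weight[OF d inj, of x] by (simp add: W)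
  have mf: "median_forest d (2 ^ k) D x = (\<Sum>i<2 ^ k. ?W i * snd (D i))"
    using median_forest_eq[OF d x _ inj] X by (simp add: W)
  define B where "B = (\<Sum>i<2 ^ k. ?W i * (f (fst (D i)) - f x))"
  have "noise_part z + B = (\<Sum>i<2 ^ k. ?W i * snd (D i) - ?W i * f x)"
    unfolding noise_part_def B_def sum.distrib[symmetric]
    by (intro sum.cong refl) (simp add: zD noise_def case_prod_unfold algebra_simps)
  also have "\<dots> = median_forest d (2 ^ k) D x - f x"
    using W1 by (simp add: mf sum_subtractf sum_distrib_right[symmetric])
  finally have "median_forest d (2 ^ k) D x - f x = noise_part z + B" ..
  then have "(median_forest d (2 ^ k) D x - f x)\<^sup>2 \<le> 2 * (noise_part z)\<^sup>2 + 2 * B\<^sup>2"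
    using sum_squares_bound[of "noise_part z" B] by (simp add: power2_sum)
  also have "B\<^sup>2 \<le> (\<Sum>i<2 ^ k. ?W i * (f (fst (D i)) - f x)\<^sup>2)"
    unfolding B_def using W0 W1 by (intro weighted_square_le) auto
  also have "\<dots> \<le> (\<Sum>i<2 ^ k. ?W i * (real d * (\<Sum>l<d. (M l)\<^sup>2 * (fst (D i) l - x l)\<^sup>2)))"
  proof (intro sum_mono mult_left_mono W0)
    fix i assume i: "i \<in> {..<2 ^ k :: nat}"
    have "\<bar>f (fst (D i)) - f x\<bar> \<le> (\<Sum>l<d. M l * \<bar>fst (D i) l - x l\<bar>)"
      unfolding M_def by (rule abs_diff_le_sum_partial_derivs[OF f x X]) (use i in simp)
    then have "(f (fst (D i)) - f x)\<^sup>2 \<le> (\<Sum>l<d. M l * \<bar>fst (D i) l - x l\<bar>)\<^sup>2"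
      by (rule abs_le_square_iff[THEN iffD1, OF order_trans[OF _ abs_ge_self]])
    also have "\<dots> \<le> (\<Sum>l<d. (M l * \<bar>fst (D i) l - x l\<bar>)\<^sup>2) * real (card {..<d})"
      by (rule sum_squared_le_sum_of_squares)
    finally show "(f (fst (D i)) - f x)\<^sup>2 \<le> real d * (\<Sum>l<d. (M l)\<^sup>2 * (fst (D i) l - x l)\<^sup>2)"
      by (simp add: power_mult_distrib mult.commute)
  qed
  also have "2 * (noise_part z)\<^sup>2 + 2 * \<dots> =
      2 * (noise_part z)\<^sup>2 + (\<Sum>l<d. 2 * real d * (M l)\<^sup>2 * (\<Sum>i<2 ^ k. ?W i * (fst (D i) l - x l)\<^sup>2))"
    by (simp add: sum_distrib_left sum_distrib_right sum.swap[of _ "{..<d}" "{..<2 ^ k}"] mult_ac)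
  finally have "(median_forest d (2 ^ k) D x - f x)\<^sup>2 \<le>
      2 * (noise_part z)\<^sup>2 + (\<Sum>l<d. 2 * real d * (M l)\<^sup>2 * (\<Sum>i<2 ^ k. ?W i * (fst (D i) l - x l)\<^sup>2))" by simp
  then have "ennreal ((median_forest d (2 ^ k) D x - f x)\<^sup>2) \<le>
      ennreal (2 * (noise_part z)\<^sup>2 + (\<Sum>l<d. 2 * real d * (M l)\<^sup>2 * (\<Sum>i<2 ^ k. ?W i * (fst (D i) l - x l)\<^sup>2)))"
    by (rule ennreal_leI)
  also have "\<dots> = 2 * ennreal ((noise_part z)\<^sup>2) + (\<Sum>l<d. ennreal (2 * real d * (M l)\<^sup>2) *
      (\<Sum>i<2 ^ k. ennreal (?W i * (fst (D i) l - x l)\<^sup>2)))"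
  proof -
    have "ennreal (\<Sum>i<2 ^ k. ?W i * (fst (D i) l - x l)\<^sup>2) = (\<Sum>i<2 ^ k. ennreal (?W i * (fst (D i) l - x l)\<^sup>2))" for l
      using W0 by (intro sum_ennreal[symmetric]) simp
    moreover have "0 \<le> (\<Sum>i<2 ^ k. ?W i * (fst (D i) l - x l)\<^sup>2)" for l
      using W0 by (intro sum_nonneg) simp
    ultimately show ?thesis by (subst ennreal_plus_sum_mult) simp_all
  qed
  finally show ?thesis by (simp add: zD M_def)
qed

theorem excess_risk_median_forest_le:
  "excess_risk d P f (2 ^ k) (median_forest d (2 ^ k)) \<le>
    ennreal (2 * exp 6 * real d * (\<Sum>l<d. (sup_norm d (partial_deriv f l))\<^sup>2) * (1 - 3 / (4 * real d)) ^ k +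
      \<sigma>\<^sup>2 * (2 * exp 6 * 16 ^ d) * decay d k)"
proof -
  let ?M = "sample \<Otimes>\<^sub>M uniform_cube d"
  let ?c = "\<lambda>l. ennreal (2 * real d * (sup_norm d (partial_deriv f l))\<^sup>2)"
  let ?g = "\<lambda>l i X. ennreal (forest_weight d k X (X (2 ^ k)) i * (X i l - X (2 ^ k) l)\<^sup>2)"
  define A where "A = (1 - 3 / (4 * real d)) ^ k"
  define B where "B = exp 6 * 16 ^ d * decay d k"
  have A0: "A \<ge> 0" unfolding A_def using d by (intro zero_le_power) (simp add: field_simps)
  have B0: "B \<ge> 0" unfolding B_def by simp
  have g: "?g l i \<in> borel_measurable inputs" if "l < d" "i < 2 ^ k" for l i
    using that
    by (intro measurable_compose[OF _ measurable_ennreal] borel_measurable_times borel_measurable_power borel_measurable_diff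
        measurable_forest_weight measurable_point_coordinate) auto
  have gT: "(\<lambda>z. ?g l i (all_inputs z)) \<in> borel_measurable ?M" if "l < d" "i < 2 ^ k" for l i
    by (rule measurable_compose[OF measurable_all_inputs g[OF that]])
  have nm: "(\<lambda>z. ennreal ((noise_part z)\<^sup>2)) \<in> borel_measurable ?M"
    by (intro measurable_compose[OF _ measurable_ennreal] borel_measurable_power measurable_noise_part)
  have "excess_risk d P f (2 ^ k) (median_forest d (2 ^ k)) \<le>
     (\<integral>\<^sup>+z. 2 * ennreal ((noise_part z)\<^sup>2) + (\<Sum>l<d. ?c l * (\<Sum>i<2 ^ k. ?g l i (all_inputs z))) \<partial>?M)"
    unfolding excess_risk_def case_prod_unfold
  \<comment> \<open>A bound almost everywhere suffices here, so \<open>median_forest\<close>, itself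
    an integral, is never shown to be measurable.\<close>
  proof (rule nn_integral_mono_AE)
    have "AE X in distr ?M inputs all_inputs. \<forall>q<d. inj_on (\<lambda>j. X j q) {..2 ^ k}"
      unfolding distr_all_inputs by (intro AE_no_ties) simp
    then have "AE z in ?M. \<forall>q<d. inj_on (\<lambda>j. all_inputs z j q) {..2 ^ k}"
      by (rule AE_distrD[OF measurable_all_inputs])
    with AE_space show "AE z in ?M. ennreal ((median_forest d (2 ^ k) (fst z) (snd z) - f (snd z))\<^sup>2) \<le>
        2 * ennreal ((noise_part z)\<^sup>2) + (\<Sum>l<d. ?c l * (\<Sum>i<2 ^ k. ?g l i (all_inputs z)))"
      by eventually_elim (rule squared_error_le[unfolded weight_def])
  qed
  also have "\<dots> = (\<integral>\<^sup>+z. 2 * ennreal ((noise_part z)\<^sup>2) \<partial>?M) + (\<integral>\<^sup>+z. (\<Sum>l<d. ?c l * (\<Sum>i<2 ^ k. ?g l i (all_inputs z))) \<partial>?M)"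
    by (intro nn_integral_add borel_measurable_times_ennreal borel_measurable_sum borel_measurable_const nm gT) auto
  also have "(\<integral>\<^sup>+z. 2 * ennreal ((noise_part z)\<^sup>2) \<partial>?M) = 2 * (\<integral>\<^sup>+z. ennreal ((noise_part z)\<^sup>2) \<partial>?M)"
    by (rule nn_integral_cmult[OF nm])
  also have "(\<integral>\<^sup>+z. (\<Sum>l<d. ?c l * (\<Sum>i<2 ^ k. ?g l i (all_inputs z))) \<partial>?M) =
     (\<Sum>l<d. \<integral>\<^sup>+z. ?c l * (\<Sum>i<2 ^ k. ?g l i (all_inputs z)) \<partial>?M)"
    by (intro nn_integral_sum borel_measurable_times_ennreal borel_measurable_sum borel_measurable_const gT) auto
  also have "\<dots> = (\<Sum>l<d. ?c l * (\<Sum>i<2 ^ k. \<integral>\<^sup>+X. ?g l i X \<partial>inputs))"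
  proof (intro sum.cong refl)
    fix l assume l: "l \<in> {..<d}"
    have "(\<integral>\<^sup>+z. ?c l * (\<Sum>i<2 ^ k. ?g l i (all_inputs z)) \<partial>?M) = ?c l * (\<integral>\<^sup>+z. (\<Sum>i<2 ^ k. ?g l i (all_inputs z)) \<partial>?M)"
      using l by (intro nn_integral_cmult borel_measurable_sum gT) auto
    also have "(\<integral>\<^sup>+z. (\<Sum>i<2 ^ k. ?g l i (all_inputs z)) \<partial>?M) = (\<Sum>i<2 ^ k. \<integral>\<^sup>+z. ?g l i (all_inputs z) \<partial>?M)"
      using l by (intro nn_integral_sum gT) auto
    also have "\<dots> = (\<Sum>i<2 ^ k. \<integral>\<^sup>+X. ?g l i X \<partial>inputs)"
      using l by (intro sum.cong refl nn_integral_all_inputs g) auto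
    finally show "(\<integral>\<^sup>+z. ?c l * (\<Sum>i<2 ^ k. ?g l i (all_inputs z)) \<partial>?M) = ?c l * (\<Sum>i<2 ^ k. \<integral>\<^sup>+X. ?g l i X \<partial>inputs)" .
  qed
  also have "2 * (\<integral>\<^sup>+z. ennreal ((noise_part z)\<^sup>2) \<partial>?M) + \<dots> \<le>
      2 * (ennreal (\<sigma>\<^sup>2) * ennreal B) + (\<Sum>l<d. ?c l * ennreal (exp 6 * A))"
    unfolding A_def B_def
    by (intro add_mono mult_left_mono sum_mono nn_integral_noise_part bias_moment d) auto
  also have "\<dots> = ennreal (2 * (\<sigma>\<^sup>2 * B) + (\<Sum>l<d. 2 * real d * (sup_norm d (partial_deriv f l))\<^sup>2 * (exp 6 * A)))"
    using A0 B0 by (subst ennreal_plus_sum_mult) (simp_all add: ennreal_mult[symmetric])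
  also have "2 * (\<sigma>\<^sup>2 * B) + (\<Sum>l<d. 2 * real d * (sup_norm d (partial_deriv f l))\<^sup>2 * (exp 6 * A)) =
      2 * exp 6 * real d * (\<Sum>l<d. (sup_norm d (partial_deriv f l))\<^sup>2) * A +
      \<sigma>\<^sup>2 * (2 * exp 6 * 16 ^ d) * decay d k"
    by (simp add: B_def sum_distrib_left sum_distrib_right mult_ac)
  finally show ?thesis by (simp add: A_def)
qed

end

end

text \<open>Since \<open>k \<le> d * (k div d + 1)\<close>, passing from the balanced count to
  \<open>k\<close> costs a constant depending on \<open>d\<close> only; it goes into
  \<open>C2\<close>.\<close>

lemma powr_div_le:
  assumes "d \<ge> 1" "k \<ge> 1"
  shows "decay d k \<le> (1 + real d) powr ((real d - 1) / 2) * real k powr (- ((real d - 1) / 2))"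
proof -
  define s where "s = (real d - 1) / 2"
  have s: "s \<ge> 0" using assms by (simp add: s_def)
  have "k = d * (k div d) + k mod d" by simp
  also have "\<dots> \<le> d * (k div d) + d" using assms by (intro add_left_mono less_imp_le mod_less_divisor) simp
  finally have "real k \<le> real (d * (k div d) + d)" by (simp only: of_nat_le_iff)
  also have "\<dots> \<le> (1 + real d) * real (k div d + 1)" by (simp add: algebra_simps)
  finally have "real k powr s \<le> ((1 + real d) * real (k div d + 1)) powr s"
    using s by (intro powr_mono2) auto
  also have "\<dots> = (1 + real d) powr s * real (k div d + 1) powr s"
    by (intro powr_mult)
  finally have le: "real k powr s \<le> (1 + real d) powr s * real (k div d + 1) powr s" .
  have "real (k div d + 1) powr (- s) \<le> (1 + real d) powr s * real k powr (- s)"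
    using le assms by (simp add: powr_minus field_simps)
  then show ?thesis by (simp only: s_def)
qed

text \<open>For \<open>d = 1\<close> the direction is forced, the forest is a single interpolating
  tree and the noise bound does not decay; hence the case distinction for consistency, which is
  stated along powers of two. \<open>n \<ge> 2\<close> keeps \<open>log 2 n\<close> positive: at
  \<open>n = 1\<close> the convention \<open>0 powr a = 0\<close> would erase the variance
  term.\<close>

theorem theorem5p1:
  shows "\<exists>(C1::real) (C2::nat \<Rightarrow> real). 0 < C1 \<and> (\<forall>d. 0 < C2 d) \<and>
    (\<forall>d\<ge>1. \<forall>P f \<sigma>. regression_model d P f \<sigma> \<and> bounded_partial_derivs d f \<longrightarrow>
       (d \<ge> 2 \<or> \<sigma> = 0 \<longrightarrow>
          (\<lambda>k. excess_risk d P f (2 ^ k) (median_forest d (2 ^ k))) \<longlonglongrightarrow> 0) \<and>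
       (\<forall>n\<ge>2. (\<exists>k. n = 2 ^ k) \<longrightarrow>
          excess_risk d P f n (median_forest d n)
            \<le> ennreal (C1 * real d * (\<Sum>l<d. (sup_norm d (partial_deriv f l))\<^sup>2)
                          * (1 - 3 / (4 * real d)) powr (log 2 (real n))
                        + \<sigma>\<^sup>2 * C2 d * (log 2 (real n)) powr (- ((real d - 1) / 2)))))"
proof -
  define C1 :: real where "C1 = 2 * exp 6"
  define C2 :: "nat \<Rightarrow> real" where "C2 d = 2 * exp 6 * 16 ^ d * (1 + real d) powr ((real d - 1) / 2)" for d
  define bound where "bound d f \<sigma> k = C1 * real d * (\<Sum>l<d. (sup_norm d (partial_deriv f l))\<^sup>2) * (1 - 3 / (4 * real d)) ^ k
      + \<sigma>\<^sup>2 * C2 d * real k powr (- ((real d - 1) / 2))" for d f \<sigma> k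
  have risk: "excess_risk d P f (2 ^ k) (median_forest d (2 ^ k)) \<le> ennreal (bound d f \<sigma> k)"
    if "d \<ge> 1" "k \<ge> 1" "regression_model d P f \<sigma>" "bounded_partial_derivs d f" for d k P f \<sigma>
  proof -
    have "\<sigma>\<^sup>2 * (2 * exp 6 * 16 ^ d) * decay d k \<le>
       \<sigma>\<^sup>2 * (2 * exp 6 * 16 ^ d) * ((1 + real d) powr ((real d - 1) / 2) * real k powr (- ((real d - 1) / 2)))"
      using that by (intro mult_left_mono powr_div_le) auto
    then have "ennreal (2 * exp 6 * real d * (\<Sum>l<d. (sup_norm d (partial_deriv f l))\<^sup>2) * (1 - 3 / (4 * real d)) ^ k +
      \<sigma>\<^sup>2 * (2 * exp 6 * 16 ^ d) * decay d k) \<le> ennreal (bound d f \<sigma> k)"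
      by (intro ennreal_leI) (simp add: bound_def C1_def C2_def mult.assoc)
    then show ?thesis using excess_risk_median_forest_le[OF that(3,1,4), of k] by (rule order_trans[rotated])
  qed
  have consistent: "(\<lambda>k. excess_risk d P f (2 ^ k) (median_forest d (2 ^ k))) \<longlonglongrightarrow> 0"
    if "d \<ge> 1" "regression_model d P f \<sigma>" "bounded_partial_derivs d f" "d \<ge> 2 \<or> \<sigma> = 0" for d P f \<sigma>
  proof (rule tendsto_sandwich[of "\<lambda>_. 0" _ _ "\<lambda>k. ennreal (bound d f \<sigma> k)"])
    show "\<forall>\<^sub>F k in sequentially. excess_risk d P f (2 ^ k) (median_forest d (2 ^ k)) \<le> ennreal (bound d f \<sigma> k)"
      using eventually_ge_at_top[of 1] by eventually_elim (rule risk[OF that(1) _ that(2,3)])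
    have b: "(\<lambda>k. (1 - 3 / (4 * real d)) ^ k) \<longlonglongrightarrow> 0"
      using that(1) by (intro LIMSEQ_realpow_zero) (simp_all add: field_simps)
    have v: "(\<lambda>k. \<sigma>\<^sup>2 * C2 d * real k powr (- ((real d - 1) / 2))) \<longlonglongrightarrow> 0"
    proof (cases "\<sigma> = 0")
      case False
      then have "(\<lambda>k. real k powr (- ((real d - 1) / 2))) \<longlonglongrightarrow> 0"
        using that(4) by (intro tendsto_neg_powr filterlim_real_sequentially) auto
      then show ?thesis by (rule tendsto_mult_right_zero)
    qed simp
    have "(\<lambda>k. bound d f \<sigma> k) \<longlonglongrightarrow> 0 + 0"
      unfolding bound_def by (rule tendsto_add[OF tendsto_mult_right_zero[OF b] v])
    then have "(\<lambda>k. ennreal (bound d f \<sigma> k)) \<longlonglongrightarrow> ennreal 0" by (intro tendsto_ennrealI) simp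
    then show "(\<lambda>k. ennreal (bound d f \<sigma> k)) \<longlonglongrightarrow> 0" by simp
  qed auto
  have rate: "excess_risk d P f n (median_forest d n) \<le> ennreal (C1 * real d * (\<Sum>l<d. (sup_norm d (partial_deriv f l))\<^sup>2)
                          * (1 - 3 / (4 * real d)) powr (log 2 (real n))
                        + \<sigma>\<^sup>2 * C2 d * (log 2 (real n)) powr (- ((real d - 1) / 2)))"
    if "d \<ge> 1" "regression_model d P f \<sigma>" "bounded_partial_derivs d f" "n \<ge> 2" "n = 2 ^ k" for d P f \<sigma> n k
  proof -
    have k: "k \<ge> 1" using that(4,5) by (cases k) auto
    have log: "log 2 (real n) = real k" using that(5) by (simp add: log_nat_power)
    have "0 < 1 - 3 / (4 * real d)" using that(1) by (simp add: field_simps)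
    then have "(1 - 3 / (4 * real d)) powr (log 2 (real n)) = (1 - 3 / (4 * real d)) ^ k"
      unfolding log by (rule powr_realpow)
    then show ?thesis using risk[OF that(1) k that(2,3)] unfolding log that(5)[symmetric] bound_def by simp
  qed
  have "0 < C1" "\<forall>d. 0 < C2 d" by (auto simp: C1_def C2_def)
  then show ?thesis using consistent rate by (intro exI[of _ C1] exI[of _ C2]) blast
qed

end
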